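(* Let $V>0$, let $\mathcal{D}$ be a known centered sub-exponential distribution with $\|\mathcal{D}\|_{\psi_1}\le\sigma$, and let the data be generated by the uncoupled isotonic regression model with $n\ge3$ observations, regression function $f\in\mathcal{F}_V$ and noise distribution $\mathcal{D}$. Let $\hat g$ be the discretized minimum Wasserstein deconvolution estimator defined in the context. Then $\hat g$ achieves the rate of the minimum Wasserstein deconvolution estimator $\hat f\in\operatorname{argmin}_{g\in\mathcal{F}_V}W_2^2(\pi_g*\mathcal{D},\hat\pi)$, that is: there is a universal constant $C$ such that, for all $1\le p<\infty$, $$\sup_{f\in\mathcal{F}_V}\big(\mathbb{E}\|f-\hat g\|_p^p\big)^{1/p}\le C\,p\,V\,\frac{\log\log n}{\log n}\,\big(1+o_{V,\sigma,p}(1)\big),$$ where $o_{V,\sigma,p}(1)$ denotes a quantity depending on $V$, $\sigma$ and $p$ (and $n$) that goes to $0$ as $n\to\infty$.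
   Context: Model: $x_1<\dots<x_n$ are fixed deterministic design points in $[0,1]$, $y_i=f(x_i)+\xi_i$ with $\xi_i$ i.i.d. from $\mathcal{D}$, and only the unordered sets (multisets) $\{x_i\}$ and $\{y_i\}$ are observed; $V,\mathcal{D}$ are known. $\mathcal{F}_V$ is the class of nondecreasing $f:[0,1]\to\mathbb{R}$ with $|f|\le V$ on $[0,1]$. $\|g\|_p^p:=\frac1n\sum_{i=1}^n|g(x_i)|^p$. $\|X\|_{\psi_1}:=\inf\{t>0:\mathbb{E}[e^{|X|/t}-1]\le1\}$, $\|\mathcal{D}\|_{\psi_1}:=\|\xi\|_{\psi_1}$ for $\xi\sim\mathcal{D}$, and $\mathcal{D}$ is sub-exponential if this is finite. For nondecreasing $g:[0,1]\to\mathbb{R}$, $\pi_g:=\frac1n\sum_{i=1}^n\delta_{g(x_i)}$; $\hat\pi:=\frac1n\sum_{i=1}^n\delta_{y_i}$; $*$ is convolution; $W_2$ is the Wasserstein-2 distance. Definition of $\hat g$: let $\alpha_0:=-(V+\sigma)\log n$, $N:=\lceil 2n^{1/4}\log n\rceil$, $\alpha_i:=\alpha_0+i\,\frac{V+\sigma}{n^{1/4}}$ for $1\le i\le N$, and $\mathcal{A}:=\{\alpha_i\}_{i=0}^N$. Let $\mathcal{M}_{\mathcal{A},V}$ be the set of probability measures supported on $\mathcal{A}\cap[-V,V]$ (nonempty for $n$ large enough). Define $\Pi_{\mathcal{A}}:\mathbb{R}\to\mathcal{A}$ by $\Pi_{\mathcal{A}}(x)=\alpha_0$ if $x<\alpha_0$,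 $\Pi_{\mathcal{A}}(x)=\alpha_i$ if $\alpha_i\le x<\alpha_{i+1}$ for $0\le i\le N-1$, and $\Pi_{\mathcal{A}}(x)=\alpha_N$ if $x\ge\alpha_N$. Let $(\Pi_{\mathcal{A}})_\sharp$ denote pushforward of measures by $\Pi_{\mathcal{A}}$, and let $\hat\mu\in\operatorname{argmin}_{\mu\in\mathcal{M}_{\mathcal{A},V}}W_2^2\big((\Pi_{\mathcal{A}})_\sharp(\mu*\mathcal{D}),\hat\pi\big)$. With $\mathcal{Q}_{\hat\mu}$ the quantile function of $\hat\mu$, set $\hat g(x_i):=\mathcal{Q}_{\hat\mu}(i/n)$ for $1\le i\le n$ and extend $\hat g$ arbitrarily to $[0,1]$ so that $\hat g\in\mathcal{F}_V$. "Universal constant" means independent of $n,V,\mathcal{D},\sigma,p,f$ and the design points. $\log$ is the natural logarithm. *)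

theory Defs
  imports "HOL-Probability.Probability" "HOL-Library.Multiset"
begin

text \<open>Functions on the unit interval are total functions on the reals of which only the values
  on \<open>{0..1}\<close> matter.\<close>

definition isotonic_class :: "real \<Rightarrow> (real \<Rightarrow> real) set" where
  "isotonic_class V = {f. mono_on {0..1} f \<and> (\<forall>t\<in>{0..1}. \<bar>f t\<bar> \<le> V)}"

definition fixed_design :: "nat \<Rightarrow> (nat \<Rightarrow> real) \<Rightarrow> bool" where
  "fixed_design n x \<longleftrightarrow> strict_mono_on {1..n} x \<and> x ` {1..n} \<subseteq> {0..1}"

definition empirical_norm_pow :: "nat \<Rightarrow> (nat \<Rightarrow> real) \<Rightarrow> real \<Rightarrow> (real \<Rightarrow> real) \<Rightarrow> real" where
  "empirical_norm_pow n x p g = (1 / real n) * (\<Sum>i=1..n. \<bar>g (x i)\<bar> powr p)"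

text \<open>The Orlicz norm is extended-real valued: it is \<open>\<infinity>\<close> if no admissible \<open>t\<close> exists.\<close>

definition psi1_norm :: "real measure \<Rightarrow> ereal" where
  "psi1_norm D = Inf {ereal t | t. 0 < t \<and> (\<integral>\<^sup>+ z. ennreal (exp (\<bar>z\<bar> / t) - 1) \<partial>D) \<le> 1}"

definition centered :: "real measure \<Rightarrow> bool" where
  "centered D \<longleftrightarrow> integrable D (\<lambda>z. z) \<and> (\<integral>z. z \<partial>D) = 0"

definition couplings :: "real measure \<Rightarrow> real measure \<Rightarrow> (real \<times> real) measure set" where
  "couplings \<mu> \<nu> = {\<gamma>. sets \<gamma> = sets (borel \<Otimes>\<^sub>M borel) \<and>
                      distr \<gamma> borel fst = \<mu> \<and> distr \<gamma> borel snd = \<nu>}"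

definition wasserstein2_sq :: "real measure \<Rightarrow> real measure \<Rightarrow> ennreal" where
  "wasserstein2_sq \<mu> \<nu> = (INF \<gamma>\<in>couplings \<mu> \<nu>. \<integral>\<^sup>+ z. ennreal (\<bar>fst z - snd z\<bar>\<^sup>2) \<partial>\<gamma>)"

definition quantile :: "real measure \<Rightarrow> real \<Rightarrow> real" where
  "quantile \<mu> t = Inf {z. t \<le> cdf \<mu> z}"

definition empirical_measure :: "real multiset \<Rightarrow> real measure" where
  "empirical_measure Y = distr (measure_pmf (pmf_of_multiset Y)) borel (\<lambda>z. z)"

definition grid_pt :: "real \<Rightarrow> real \<Rightarrow> nat \<Rightarrow> nat \<Rightarrow> real" where
  "grid_pt V \<sigma> n i = - (V + \<sigma>) * ln (real n) + real i * ((V + \<sigma>) / real n powr (1/4))"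

definition grid_size :: "nat \<Rightarrow> nat" where
  "grid_size n = nat \<lceil>2 * real n powr (1/4) * ln (real n)\<rceil>"

definition grid :: "real \<Rightarrow> real \<Rightarrow> nat \<Rightarrow> real set" where
  "grid V \<sigma> n = grid_pt V \<sigma> n ` {0..grid_size n}"

definition grid_proj :: "real \<Rightarrow> real \<Rightarrow> nat \<Rightarrow> real \<Rightarrow> real" where
  "grid_proj V \<sigma> n z =
    (if z < grid_pt V \<sigma> n 0 then grid_pt V \<sigma> n 0
     else if grid_pt V \<sigma> n (grid_size n) \<le> z then grid_pt V \<sigma> n (grid_size n)
     else grid_pt V \<sigma> n
       (THE i. i < grid_size n \<and> grid_pt V \<sigma> n i \<le> z \<and> z < grid_pt V \<sigma> n (Suc i)))"

definition grid_measures :: "real \<Rightarrow> real \<Rightarrow> nat \<Rightarrow> real measure set" where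
  "grid_measures V \<sigma> n = {\<mu>. real_distribution \<mu> \<and> measure \<mu> (grid V \<sigma> n \<inter> {-V..V}) = 1}"

definition deconvolution_argmin ::
  "real \<Rightarrow> real \<Rightarrow> real measure \<Rightarrow> nat \<Rightarrow> real multiset \<Rightarrow> real measure \<Rightarrow> bool" where
  "deconvolution_argmin V \<sigma> D n Y \<mu> \<longleftrightarrow>
    is_arg_min
      (\<lambda>\<nu>. wasserstein2_sq (distr (\<nu> \<star> D) borel (grid_proj V \<sigma> n)) (empirical_measure Y))
      (\<lambda>\<nu>. \<nu> \<in> grid_measures V \<sigma> n) \<mu>"

text \<open>The values \<open>y 1, \<dots>, y n\<close> with their order forgotten.\<close>

definition unordered :: "nat \<Rightarrow> (nat \<Rightarrow> real) \<Rightarrow> real multiset" where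
  "unordered n y = image_mset y (mset_set {1..n})"

text \<open>\<open>G\<close> maps the observed multiset of responses to a regression function. Neither the minimiser
  nor the extension to the unit interval is unique, so this is a predicate that holds for every
  admissible choice. Measurability of the values at the design points makes the risk of \<open>G\<close> well
  defined.\<close>

definition discretized_deconvolution_estimator ::
  "real \<Rightarrow> real \<Rightarrow> real measure \<Rightarrow> nat \<Rightarrow> (nat \<Rightarrow> real) \<Rightarrow> (real multiset \<Rightarrow> real \<Rightarrow> real) \<Rightarrow> bool"
where
  "discretized_deconvolution_estimator V \<sigma> D n x G \<longleftrightarrow>
    (\<forall>Y. size Y = n \<longrightarrow>
       G Y \<in> isotonic_class V \<and>
       (\<exists>\<mu>. deconvolution_argmin V \<sigma> D n Y \<mu> \<and>
            (\<forall>i\<in>{1..n}. G Y (x i) = quantile \<mu> (real i / real n)))) \<and>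
    (\<forall>i\<in>{1..n}. (\<lambda>y. G (unordered n y) (x i)) \<in> borel_measurable (\<Pi>\<^sub>M j\<in>{1..n}. borel))"

text \<open>The expectation of the \<open>p\<close>-th power loss in the model \<open>y i = f (x i) + \<xi> i\<close>, with the i.i.d.
  noise realised as the coordinates of the product measure.\<close>

definition risk_pow ::
  "real measure \<Rightarrow> nat \<Rightarrow> (nat \<Rightarrow> real) \<Rightarrow> real \<Rightarrow> (real \<Rightarrow> real) \<Rightarrow> (real multiset \<Rightarrow> real \<Rightarrow> real) \<Rightarrow> real"
where
  "risk_pow D n x p f G =
    (\<integral>\<xi>. empirical_norm_pow n x p
           (\<lambda>t. f t - G (unordered n (\<lambda>i. f (x i) + \<xi> i)) t) \<partial>(\<Pi>\<^sub>M j\<in>{1..n}. D))"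

end

theory Submission
  imports Defs "HOL-Computational_Algebra.Polynomial" "HOL-Real_Asymp.Real_Asymp"
begin

text \<open>Let \<open>\<pi>\<close> be the uniform distribution on the values \<open>f (x i)\<close> and \<open>\<mu>\<close> the minimiser that defines the estimator.
  At the design points \<open>f\<close> and the estimator are the \<open>i / n\<close>-quantiles of \<open>\<pi>\<close> and of \<open>\<mu>\<close>, so the loss
  is an \<open>n\<close>-point version of the \<open>p\<close>-th power of the Wasserstein-\<open>p\<close> distance between \<open>\<pi>\<close> and \<open>\<mu>\<close>,
  and the theorem says that this distance has order \<open>p V ln (ln n) / ln n\<close>.  Two ideas give this.

  From smooth statistics to the loss.  Because both sequences are monotone, the indices at which
  they lie on opposite sides of an interval \<open>[s, t]\<close> are counted by \<open>F_\<pi> s - F_\<mu> t\<close> and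
  \<open>F_\<mu> s - F_\<pi> t\<close>, where \<open>F\<close> denotes distribution functions.  Summing over dyadic intervals of length \<open>V\<close> down to \<open>V / 2 ^ J\<close> recovers the loss up
  to \<open>(4 V / 2 ^ J) powr p\<close> (\<open>monotone_rearrangement_loss\<close>).  To bound a gap between distribution
  functions, the indicator of \<open>x \<le> s\<close> is replaced by a polynomial step, the antiderivative of an even
  power \<open>2 r\<close> of the Dirichlet kernel, written as a polynomial of degree proportional to \<open>2 ^ J r\<close>
  (\<open>step_polynomial_exists\<close>).  Its tails decay like a power larger than \<open>p\<close>, so their contributions to
  all scales add up to a constant times \<open>(4 V / 2 ^ J) powr p\<close> (\<open>dyadic_gap_cdf_le\<close>, \<open>isotonic_loss_le\<close>).
  As \<open>r\<close> is proportional to \<open>p\<close>, a polynomial of degree \<open>k\<close> resolves the scale \<open>p V / k\<close>.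

  Deconvolution.  The polynomials are taken in \<open>sin (h x)\<close> instead of \<open>x\<close>, with \<open>h\<close> proportional to
  \<open>1 / k\<close>.  A polynomial of degree \<open>k\<close> in \<open>sin (h x)\<close> only uses frequencies up to \<open>k h\<close>, a constant that
  can be made so small that the characteristic function of the noise is at least \<open>1 / 2\<close> on this
  range.  There the noise can be divided out.
  The price is that \<open>sin (h x) / (h V)\<close> has to be normalised to unit scale, which multiplies the error
  by at most \<open>(constant * k) ^ k\<close>.  The characteristic functions themselves agree up to a negative power of
  \<open>n\<close>: the minimiser cannot be worse than the distribution of the rounded values of \<open>f\<close>, characteristic
  functions are Lipschitz in the Wasserstein distance (\<open>char_diff_le_wasserstein\<close>), and the rounded values
  give a small Wasserstein distance because the empirical distribution function of the data
  fluctuates by at most \<open>n powr (-1/2)\<close> on average (\<open>wasserstein_rounded_design_le\<close>,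
  \<open>good_noise_event\<close>, \<open>char_deconvolution_le\<close>).  So \<open>k\<close> is allowed to grow as long as \<open>k ln k\<close> is at most a
  small multiple of \<open>ln n\<close>; this means \<open>k\<close> of order \<open>ln n / ln (ln n)\<close>, and the resolution
  \<open>p V / k\<close> is the claimed rate.

  For small \<open>n\<close> the trivial bound \<open>2 V\<close> is absorbed into the factor \<open>1 + r n\<close>, so \<open>r\<close> vanishes from some \<open>n\<close> on.\<close>

section \<open>Polynomials that approximate a step\<close>

text \<open>This is the Dirichlet kernel \<open>sin ((2 m + 1) t) / sin t\<close> as a polynomial in \<open>sin t\<close>, up to sign the quotient of the Chebyshev
  polynomial of degree \<open>2 m + 1\<close> by its variable.  It lives on the scale \<open>1 / m\<close>, whereas a positive
  polynomial such as \<open>(1 - u\<^sup>2) ^ m\<close> would only reach \<open>1 / sqrt m\<close>.\<close>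

fun dirichlet_poly :: "nat \<Rightarrow> real poly" where
  "dirichlet_poly 0 = 1"
| "dirichlet_poly (Suc 0) = [:3, 0, -4:]"
| "dirichlet_poly (Suc (Suc m)) = [:2, 0, -4:] * dirichlet_poly (Suc m) - dirichlet_poly m"

lemma sin_odd_multiple:
  "sin (real (2 * m + 1) * t) = sin t * poly (dirichlet_poly m) (sin t)"
proof (induction m rule: dirichlet_poly.induct)
  case 1
  then show ?case by simp
next
  case 2
  have "sin (3 * t) = sin (2 * t + t)" by (simp add: algebra_simps)
  also have "\<dots> = sin t * (3 - 4 * (sin t)^2)"
    unfolding sin_add sin_double
    by (simp only: cos_double cos_squared_eq mult.assoc power2_eq_square[of "cos t", symmetric])
       (simp add: algebra_simps power2_eq_square)
  finally show ?case by (simp add: power2_eq_square)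
next
  case (3 m)
  let ?a = "real (2 * m + 3) * t"
  have "sin (?a + 2 * t) + sin (?a - 2 * t) = 2 * cos (2 * t) * sin ?a"
    by (simp add: sin_add sin_diff)
  moreover have "?a + 2 * t = real (2 * Suc (Suc m) + 1) * t" "?a - 2 * t = real (2 * m + 1) * t"
      "?a = real (2 * Suc m + 1) * t"
    by (simp_all add: algebra_simps)
  moreover have "cos (2 * t) = 1 - 2 * (sin t)^2"
    by (simp add: cos_double cos_squared_eq)
  ultimately have "sin (real (2 * Suc (Suc m) + 1) * t)
      = 2 * (1 - 2 * (sin t)^2) * sin (real (2 * Suc m + 1) * t) - sin (real (2 * m + 1) * t)"
    by (simp add: add.commute)
  also have "\<dots> = 2 * (1 - 2 * (sin t)^2) * (sin t * poly (dirichlet_poly (Suc m)) (sin t))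
      - sin t * poly (dirichlet_poly m) (sin t)"
    unfolding 3 ..
  finally show ?case
    by (simp add: algebra_simps power2_eq_square)
qed

lemma degree_dirichlet_poly: "degree (dirichlet_poly m) \<le> 2 * m"
proof (induction m rule: dirichlet_poly.induct)
  case (3 m)
  have "degree ([:2, 0, -4:] * dirichlet_poly (Suc m)) \<le> 2 + 2 * Suc m"
    using degree_mult_le[of "[:2, 0, -4:]" "dirichlet_poly (Suc m)"] 3(1) by simp
  then show ?case
    using 3(2) by (auto intro!: degree_diff_le)
qed auto

text \<open>The \<open>l\<^sup>1\<close>-norm of the coefficients controls the error when every monomial is integrated with the same error.\<close>

definition coeff_norm :: "real poly \<Rightarrow> real" where
  "coeff_norm p = (\<Sum>i\<le>degree p. \<bar>coeff p i\<bar>)"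

lemma coeff_norm_eq: "degree p \<le> n \<Longrightarrow> coeff_norm p = (\<Sum>i\<le>n. \<bar>coeff p i\<bar>)"
  unfolding coeff_norm_def by (rule sum.mono_neutral_left) (auto simp: coeff_eq_0)

lemma coeff_norm_nonneg [simp]: "0 \<le> coeff_norm p"
  by (simp add: coeff_norm_def sum_nonneg)

lemma coeff_norm_0 [simp]: "coeff_norm 0 = 0"
  by (simp add: coeff_norm_def)

lemma coeff_norm_pCons [simp]: "coeff_norm (pCons a p) = \<bar>a\<bar> + coeff_norm p"
proof -
  have "coeff_norm (pCons a p) = (\<Sum>i\<le>Suc (degree p). \<bar>coeff (pCons a p) i\<bar>)"
    by (rule coeff_norm_eq) (rule degree_pCons_le)
  also have "\<dots> = \<bar>a\<bar> + coeff_norm p"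
    by (subst sum.atMost_Suc_shift) (simp add: coeff_norm_def)
  finally show ?thesis .
qed

lemma coeff_norm_1 [simp]: "coeff_norm 1 = 1"
  unfolding one_pCons by simp

lemma coeff_norm_add: "coeff_norm (p + q) \<le> coeff_norm p + coeff_norm q"
proof -
  define n where "n = max (degree p) (degree q)"
  have "coeff_norm (p + q) = (\<Sum>i\<le>n. \<bar>coeff (p + q) i\<bar>)"
    by (rule coeff_norm_eq) (simp add: n_def degree_add_le_max)
  also have "\<dots> \<le> (\<Sum>i\<le>n. \<bar>coeff p i\<bar> + \<bar>coeff q i\<bar>)"
    by (intro sum_mono) (simp add: abs_triangle_ineq)
  also have "\<dots> = coeff_norm p + coeff_norm q"
    by (simp add: sum.distrib coeff_norm_eq[of _ n] n_def)
  finally show ?thesis .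
qed

lemma coeff_norm_smult [simp]: "coeff_norm (smult c p) = \<bar>c\<bar> * coeff_norm p"
  by (simp add: coeff_norm_def abs_mult sum_distrib_left)

lemma coeff_norm_diff: "coeff_norm (p - q) \<le> coeff_norm p + coeff_norm q"
  using coeff_norm_add[of p "smult (-1) q"] coeff_norm_smult[of "-1" q] by simp

lemma coeff_norm_mult: "coeff_norm (p * q) \<le> coeff_norm p * coeff_norm q"
proof (induction p)
  case (pCons a p)
  have "coeff_norm (pCons a p * q) \<le> coeff_norm (smult a q) + coeff_norm (pCons 0 (p * q))"
    unfolding mult_pCons_left by (rule coeff_norm_add)
  also have "\<dots> \<le> \<bar>a\<bar> * coeff_norm q + coeff_norm p * coeff_norm q"
    using pCons by simp
  finally show ?case by (simp add: algebra_simps)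
qed simp

lemma coeff_norm_power: "coeff_norm (p ^ n) \<le> coeff_norm p ^ n"
proof (induction n)
  case (Suc n)
  have "coeff_norm (p ^ Suc n) \<le> coeff_norm p * coeff_norm (p ^ n)"
    using coeff_norm_mult[of p "p ^ n"] by simp
  also have "\<dots> \<le> coeff_norm p * coeff_norm p ^ n"
    using Suc by (intro mult_left_mono) auto
  finally show ?case by simp
qed simp

text \<open>Any bound that is exponential in the degree will do: the normalisation of \<open>sin (h x)\<close> costs
  \<open>k ^ k\<close> for degree \<open>k\<close> anyway.\<close>

lemma coeff_norm_dirichlet_poly: "coeff_norm (dirichlet_poly m) \<le> 7 ^ m"
proof (induction m rule: dirichlet_poly.induct)
  case (3 m)
  have "coeff_norm (dirichlet_poly (Suc (Suc m)))
      \<le> coeff_norm ([:2, 0, -4:] * dirichlet_poly (Suc m)) + coeff_norm (dirichlet_poly m)"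
    by (simp only: dirichlet_poly.simps coeff_norm_diff)
  also have "\<dots> \<le> 6 * 7 ^ Suc m + 7 ^ m"
    using coeff_norm_mult[of "[:2, 0, -4:]" "dirichlet_poly (Suc m)"] 3 by simp
  also have "\<dots> \<le> 7 ^ Suc (Suc m)" by simp
  finally show ?case .
qed auto

lemma abs_dirichlet_poly_le:
  assumes "\<bar>u\<bar> \<le> 1" shows "\<bar>u\<bar> * \<bar>poly (dirichlet_poly m) u\<bar> \<le> 1"
proof -
  have u: "sin (arcsin u) = u" using assms by (intro sin_arcsin) auto
  have "\<bar>u\<bar> * \<bar>poly (dirichlet_poly m) u\<bar> = \<bar>sin (real (2 * m + 1) * arcsin u)\<bar>"
    unfolding sin_odd_multiple u abs_mult ..
  also have "\<dots> \<le> 1" by (rule abs_sin_le_one)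
  finally show ?thesis .
qed

lemma sin_expansive:
  assumes "-1 \<le> x" "x \<le> y" "y \<le> (1::real)"
  shows "sin y - sin x \<ge> (y - x) / 2"
proof -
  have "(\<lambda>z. sin z - z / 2) x \<le> (\<lambda>z. sin z - z / 2) y"
  proof (rule DERIV_nonneg_imp_nondecreasing[OF assms(2)])
    fix z assume z: "x \<le> z" "z \<le> y"
    have "cos 1 \<le> cos \<bar>z\<bar>"
      using z assms pi_gt3 by (intro cos_monotone_0_pi_le) auto
    moreover have "cos (1::real) \<ge> cos (pi / 3)"
      using pi_gt3 by (intro cos_monotone_0_pi_le) auto
    ultimately have "cos z \<ge> 1 / 2" by (simp add: cos_60)
    thus "\<exists>d. ((\<lambda>z. sin z - z / 2) has_real_derivative d) (at z) \<and> 0 \<le> d"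
      by (intro exI[of _ "cos z - 1 / 2"]) (auto intro!: derivative_eq_intros)
  qed
  thus ?thesis by (simp add: field_simps)
qed

lemma dirichlet_poly_lower:
  assumes "0 < u" "u \<le> 1 / (2 * real (2 * m + 1))"
  shows "poly (dirichlet_poly m) u \<ge> real (2 * m + 1) / 2"
proof -
  define N where "N = real (2 * m + 1)"
  have N: "N \<ge> 1" by (simp add: N_def)
  have u: "u \<le> 1 / (2 * N)" using assms by (simp add: N_def)
  have "1 / (2 * N) \<le> 1 / 2" using N by (simp add: field_simps)
  with u have u1: "u \<le> 1/2" by linarith
  define t where "t = arcsin u"
  have st: "sin t = u" using assms u1 by (simp add: t_def)
  have t0: "0 < t" using assms u1 arcsin_less_arcsin[of 0 u] by (simp add: t_def)
  have "u \<le> sin (1 / N)"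
    using sin_expansive[of 0 "1 / N"] N u by simp
  hence "t \<le> arcsin (sin (1 / N))"
    using assms u1 unfolding t_def by (intro arcsin_le_arcsin) auto
  also have "1 / N \<le> 1" using N by simp
  hence "arcsin (sin (1 / N)) = 1 / N"
    using N pi_gt3 by (intro arcsin_sin) (linarith | simp add: order_trans[of _ 0])+
  finally have tN: "N * t \<le> 1" using N by (simp add: field_simps)
  have "N * t / 2 \<le> sin (N * t)" using sin_expansive[of 0 "N * t"] tN N t0 by simp
  also have "\<dots> = u * poly (dirichlet_poly m) u"
    using sin_odd_multiple[of m t] by (simp add: N_def st)
  finally have "N * t / 2 \<le> u * poly (dirichlet_poly m) u" .
  moreover have "u \<le> t" using sin_x_le_x[of t] t0 st by simp
  hence "u * (N / 2) \<le> N * t / 2" using N by (simp add: mult.commute mult_left_mono)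
  ultimately have "u * (N / 2) \<le> u * poly (dirichlet_poly m) u" by linarith
  thus ?thesis using assms(1) by (simp add: N_def)
qed

lemma poly_antiderivative_exists:
  fixes p :: "real poly"
  obtains q where "pderiv q = p" "degree q \<le> Suc (degree p)" "coeff_norm q \<le> coeff_norm p"
    "poly q 0 = 0"
proof -
  define q where "q = Poly (0 # map (\<lambda>i. coeff p i / real (Suc i)) [0..<Suc (degree p)])"
  have c: "coeff q i = (case i of 0 \<Rightarrow> 0 | Suc j \<Rightarrow> coeff p j / real (Suc j))" for i
    unfolding q_def coeff_Poly_eq
    by (auto simp: nth_default_def coeff_eq_0 split: nat.splits simp del: upt_Suc)
  have 1: "pderiv q = p"
    by (rule poly_eqI) (simp add: coeff_pderiv c)
  have 2: "degree q \<le> Suc (degree p)"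
    by (rule degree_le) (auto simp: c coeff_eq_0 split: nat.splits)
  have "coeff_norm q = (\<Sum>i\<le>Suc (degree p). \<bar>coeff q i\<bar>)"
    by (rule coeff_norm_eq) (rule 2)
  also have "\<dots> = (\<Sum>i\<le>degree p. \<bar>coeff p i\<bar> / real (Suc i))"
    by (subst sum.atMost_Suc_shift) (simp add: c)
  also have "\<dots> \<le> (\<Sum>i\<le>degree p. \<bar>coeff p i\<bar>)"
    by (intro sum_mono) (simp add: field_simps mult_left_le)
  finally have 3: "coeff_norm q \<le> coeff_norm p" by (simp add: coeff_norm_def)
  have "poly q 0 = 0" by (simp add: poly_0_coeff_0 c)
  from that[OF 1 2 3 this] show thesis .
qed

text \<open>The function \<open>P u + 1 / u ^ q\<close> is nonincreasing on \<open>(0, 1]\<close>, since the derivative of the second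
  term is \<open>- q / u ^ Suc q\<close>.\<close>

lemma kernel_tail:
  fixes P P' :: "real \<Rightarrow> real"
  assumes "\<And>u. (P has_real_derivative P' u) (at u)"
    and "\<And>u. 0 < u \<Longrightarrow> u \<le> 1 \<Longrightarrow> P' u \<le> 1 / u ^ Suc q" and "q \<ge> 1" and v: "0 < v" "v \<le> 1"
  shows "P 1 - P v \<le> 1 / v ^ q"
proof -
  define H where "H = (\<lambda>u. P u + 1 / u ^ q)"
  have "H 1 \<le> H v"
  proof (rule DERIV_nonpos_imp_nonincreasing[OF v(2)])
    fix u assume u: "v \<le> u" "u \<le> 1"
    hence u0: "u > 0" using v by linarith
    have "(H has_real_derivative (P' u - real q / u ^ Suc q)) (at u)"
      unfolding H_def using u0 \<open>q \<ge> 1\<close>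
      by (auto intro!: derivative_eq_intros assms(1)) (cases q; simp add: field_simps power2_eq_square)
    moreover have "P' u \<le> real q / u ^ Suc q"
    proof -
      have "1 / u ^ Suc q \<le> real q / u ^ Suc q" using u0 \<open>q \<ge> 1\<close> by (intro divide_right_mono) auto
      thus ?thesis using assms(2)[OF u0 u(2)] by linarith
    qed
    ultimately show "\<exists>y. (H has_real_derivative y) (at u) \<and> y \<le> 0" by (metis diff_le_0_iff_le)
  qed
  moreover have "1 / v ^ q \<ge> 0" using v by simp
  ultimately show ?thesis by (simp add: H_def)
qed

text \<open>Normalise the antiderivative of \<open>K = dirichlet_poly m ^ (2 * r)\<close>.  It increases because \<open>K \<ge> 0\<close>, and
  its tails are small because \<open>K u \<le> \<bar>u\<bar> ^ (- 2 r)\<close>, while the total increase \<open>M\<close> is already large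
  from the interval \<open>[0, 1 / (2 N)]\<close>, on which \<open>K \<ge> (N / 2) ^ (2 r)\<close>.\<close>

lemma step_polynomial_exists:
  fixes m r :: nat
  defines "N \<equiv> real (2 * m + 1)"
  assumes "N \<ge> 8" "r \<ge> 1"
  obtains Q :: "real poly" where
    "degree Q \<le> 4 * m * r + 1" "coeff_norm Q \<le> 2 * 7 ^ (2 * m * r)"
    "\<And>v. \<bar>v\<bar> \<le> 1 \<Longrightarrow> 0 \<le> poly Q v \<and> poly Q v \<le> 1"
    "\<And>v. 0 < v \<Longrightarrow> v \<le> 1 \<Longrightarrow> 1 - poly Q v \<le> (8 / (N * v)) ^ (2 * r - 1)"
    "\<And>v. 0 < v \<Longrightarrow> v \<le> 1 \<Longrightarrow> poly Q (- v) \<le> (8 / (N * v)) ^ (2 * r - 1)"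
proof -
  define K where "K = dirichlet_poly m ^ (2 * r)"
  define q where "q = 2 * r - 1"
  have q: "Suc q = 2 * r" "q \<ge> 1" using assms by (auto simp: q_def)
  obtain R where R: "pderiv R = K" "degree R \<le> Suc (degree K)" "coeff_norm R \<le> coeff_norm K" "poly R 0 = 0"
    by (rule poly_antiderivative_exists)
  have dR: "(poly R has_real_derivative poly K u) (at u)" for u
    using poly_DERIV[of R u] R(1) by simp
  have K0: "poly K u \<ge> 0" for u by (simp add: K_def zero_le_even_power')
  have Kle: "poly K u \<le> 1 / \<bar>u\<bar> ^ Suc q" if "0 < \<bar>u\<bar>" "\<bar>u\<bar> \<le> 1" for u
  proof -
    have "\<bar>poly (dirichlet_poly m) u\<bar> \<le> 1 / \<bar>u\<bar>"
      using abs_dirichlet_poly_le[of u m] that by (simp add: field_simps)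
    hence "\<bar>poly (dirichlet_poly m) u\<bar> ^ (2 * r) \<le> (1 / \<bar>u\<bar>) ^ (2 * r)"
      by (intro power_mono) auto
    thus ?thesis by (simp add: K_def q power_divide power_even_abs)
  qed
  have Rmono: "poly R a \<le> poly R b" if "a \<le> b" for a b
    using dR K0 by (intro DERIV_nonneg_imp_nondecreasing[OF that]) auto
  have t1: "poly R 1 - poly R v \<le> 1 / v ^ q" if "0 < v" "v \<le> 1" for v
  proof (rule kernel_tail[OF dR])
    show "poly K u \<le> 1 / u ^ Suc q" if "0 < u" "u \<le> 1" for u
      using Kle[of u] that by simp
  qed (use q that in auto)
  have t2: "poly R (-v) - poly R (-1) \<le> 1 / v ^ q" if "0 < v" "v \<le> 1" for v
  proof -
    have "- poly R (-1) - (- poly R (- v)) \<le> 1 / v ^ q"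
    proof (rule kernel_tail[where P = "\<lambda>u. - poly R (- u)" and P' = "\<lambda>u. poly K (- u)"])
      show "((\<lambda>u. - poly R (- u)) has_real_derivative poly K (- u)) (at u)" for u
        by (auto intro!: derivative_eq_intros DERIV_chain2[OF dR] simp: R(1))
      show "poly K (- u) \<le> 1 / u ^ Suc q" if "0 < u" "u \<le> 1" for u
        using Kle[of "- u"] that by simp
    qed (use q that in auto)
    thus ?thesis by simp
  qed
  define M where "M = poly R 1 - poly R (-1)"
  have M: "M \<ge> 1 / (2 * N) * (N / 2) ^ (2 * r)"
  proof -
    have N0: "1 / (2 * N) > 0" using assms by simp
    obtain z where z: "0 < z" "z < 1 / (2 * N)" "poly R (1 / (2 * N)) - poly R 0 = (1 / (2 * N) - 0) * poly K z"
      using MVT2[OF N0, of "poly R" "poly K"] dR by blast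
    have "poly K z \<ge> (N / 2) ^ (2 * r)"
      unfolding K_def poly_power N_def using z by (intro power_mono dirichlet_poly_lower) (auto simp: N_def)
    hence "1 / (2 * N) * (N / 2) ^ (2 * r) \<le> poly R (1 / (2 * N)) - poly R 0"
      using z(3) N0 by (simp add: mult_left_mono divide_right_mono)
    moreover have "poly R (1 / (2 * N)) \<le> poly R 1"
      using assms by (intro Rmono) (auto simp: field_simps)
    moreover have "poly R (-1) \<le> poly R 0" by (rule Rmono) simp
    ultimately show ?thesis unfolding M_def by linarith
  qed
  \<comment> \<open>One factor \<open>N / 2\<close> cancels the length of the interval, which is why the exponent drops to \<open>2 r - 1\<close>.\<close>
  have Meq: "1 / (2 * N) * (N / 2) ^ (2 * r) = (N / 2) ^ q / 4"
    using \<open>N \<ge> 8\<close> unfolding q(1)[symmetric] by (simp add: field_simps)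
  have M1: "M \<ge> (N / 2) ^ q / 4" using M Meq by simp
  \<comment> \<open>The hypothesis \<open>N \<ge> 8\<close> makes \<open>M \<ge> 1\<close>, so that normalising does not increase the coefficients.\<close>
  have "4 \<le> (N / 2) ^ 1" using assms by simp
  also have "\<dots> \<le> (N / 2) ^ q" using assms q by (intro power_increasing) auto
  finally have M2: "M \<ge> 1" using M1 by simp
  have tail: "1 / v ^ q / M \<le> (8 / (N * v)) ^ q" if "0 < v" "v \<le> 1" for v
  proof -
    have N0: "N > 0" using assms by simp
    have "1 / v ^ q / M \<le> 1 / v ^ q / ((N / 2) ^ q / 4)"
      using that N0 M1 M2 by (intro divide_left_mono) auto
    also have "\<dots> = 4 * (2 / (N * v)) ^ q" using N0 that by (simp add: field_simps)
    also have "\<dots> \<le> 4 ^ q * (2 / (N * v)) ^ q"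
      using power_increasing[of 1 q "4::real"] q N0 that by (intro mult_right_mono) auto
    also have "\<dots> = (8 / (N * v)) ^ q" by (simp add: power_mult_distrib[symmetric])
    finally show ?thesis .
  qed
  define Q where "Q = smult (1 / M) (R - [:poly R (-1):])"
  have pQ: "poly Q v = (poly R v - poly R (-1)) / M" for v by (simp add: Q_def)
  have pQ': "1 - poly Q v = (poly R 1 - poly R v) / M" for v
    using M2 by (simp add: pQ M_def[symmetric] field_simps) (simp add: M_def)
  show thesis
  proof (rule that)
    have "degree K \<le> 2 * m * (2 * r)"
      unfolding K_def using degree_power_le[of "dirichlet_poly m" "2 * r"] degree_dirichlet_poly[of m]
      by (meson le_trans mult_le_mono1)
    hence "degree R \<le> 4 * m * r + 1" using R(2) by (simp add: mult.assoc)
    thus "degree Q \<le> 4 * m * r + 1"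
      unfolding Q_def by (intro order_trans[OF degree_smult_le] degree_diff_le) auto
    have cK: "coeff_norm K \<le> 7 ^ (2 * m * r)"
    proof -
      have "coeff_norm K \<le> coeff_norm (dirichlet_poly m) ^ (2 * r)"
        unfolding K_def by (rule coeff_norm_power)
      also have "\<dots> \<le> (7 ^ m) ^ (2 * r)"
        by (intro power_mono coeff_norm_dirichlet_poly) auto
      finally show ?thesis by (simp add: power_mult[symmetric] mult_ac)
    qed
    have "\<bar>poly R (-1)\<bar> \<le> coeff_norm R"
      unfolding poly_altdef coeff_norm_def
      by (intro order_trans[OF sum_abs] sum_mono) (simp add: abs_mult power_abs)
    hence "coeff_norm (R - [:poly R (-1):]) \<le> 2 * coeff_norm R"
      using coeff_norm_diff[of R "[:poly R (-1):]"] by simp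
    hence "coeff_norm Q \<le> 2 * coeff_norm R"
      using M2 unfolding Q_def coeff_norm_smult
      by (smt (verit, best) coeff_norm_nonneg divide_le_eq_1_pos mult_left_le_one_le zero_le_divide_iff)
    thus "coeff_norm Q \<le> 2 * 7 ^ (2 * m * r)" using R(3) cK by linarith
    show "0 \<le> poly Q v \<and> poly Q v \<le> 1" if "\<bar>v\<bar> \<le> 1" for v
    proof
      show "0 \<le> poly Q v" unfolding pQ using M2 Rmono[of "-1" v] that by simp
      have "0 \<le> 1 - poly Q v" unfolding pQ' using M2 Rmono[of v 1] that by simp
      thus "poly Q v \<le> 1" by simp
    qed
    fix v :: real assume v: "0 < v" "v \<le> 1"
    have "1 - poly Q v \<le> 1 / v ^ q / M"
      unfolding pQ' using t1[OF v] M2 by (intro divide_right_mono) auto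
    thus "1 - poly Q v \<le> (8 / (N * v)) ^ (2 * r - 1)" using tail[OF v] by (simp add: q_def)
    have "poly Q (- v) \<le> 1 / v ^ q / M"
      unfolding pQ using t2[OF v] M2 by (intro divide_right_mono) auto
    thus "poly Q (- v) \<le> (8 / (N * v)) ^ (2 * r - 1)" using tail[OF v] by (simp add: q_def)
  qed
qed

section \<open>Polynomials in a slow sine and characteristic functions\<close>

lemma sin_power_expansion:
  "complex_of_real (sin y ^ j) =
    (\<Sum>i\<le>j. of_nat (j choose i) * (- 1) ^ (j - i) / (2 * \<i>) ^ j * iexp ((2 * real i - real j) * y))"
proof -
  have s: "complex_of_real (sin y) = (iexp y + - iexp (- y)) / (2 * \<i>)"
    by (simp add: sin_of_real[symmetric] sin_exp_eq del: sin_of_real)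
  have "complex_of_real (sin y ^ j) = (iexp y + - iexp (- y)) ^ j / (2 * \<i>) ^ j"
    unfolding of_real_power s power_divide ..
  also have "\<dots> = (\<Sum>i\<le>j. of_nat (j choose i) * iexp y ^ i * (- iexp (- y)) ^ (j - i)) / (2 * \<i>) ^ j"
    unfolding binomial_ring ..
  also have "\<dots> = (\<Sum>i\<le>j. of_nat (j choose i) * (- 1) ^ (j - i) / (2 * \<i>) ^ j * iexp ((2 * real i - real j) * y))"
    unfolding sum_divide_distrib
  proof (rule sum.cong, simp)
    fix i assume i: "i \<in> {..j}"
    have "iexp ((2 * real i - real j) * y) = exp (of_nat i * (\<i> * y) + of_nat (j - i) * (\<i> * (- y)))"
      using i by (simp add: algebra_simps of_nat_diff)
    also have "\<dots> = iexp y ^ i * iexp (- y) ^ (j - i)"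
      by (simp only: exp_add exp_of_nat_mult of_real_minus)
    finally have e: "iexp ((2 * real i - real j) * y) = iexp y ^ i * iexp (- y) ^ (j - i)" .
    show "of_nat (j choose i) * iexp y ^ i * (- iexp (- y)) ^ (j - i) / (2 * \<i>) ^ j =
        of_nat (j choose i) * (- 1) ^ (j - i) / (2 * \<i>) ^ j * iexp ((2 * real i - real j) * y)"
      unfolding e by (simp add: power_minus[of "iexp (- y)"] del: of_real_minus)
  qed
  finally show ?thesis .
qed

lemma sin_moment_char:
  assumes "real_distribution \<mu>"
  shows "complex_of_real (\<integral>x. sin (h * x) ^ j \<partial>\<mu>) =
    (\<Sum>i\<le>j. of_nat (j choose i) * (- 1) ^ (j - i) / (2 * \<i>) ^ j * char \<mu> (h * (2 * real i - real j)))"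
proof -
  interpret real_distribution \<mu> by fact
  have [measurable_cong]: "sets \<mu> = sets borel" by simp
  have int: "integrable \<mu> (\<lambda>x. iexp (t * x))" for t
    by (rule integrable_iexp) auto
  have "complex_of_real (\<integral>x. sin (h * x) ^ j \<partial>\<mu>) = (CLINT x|\<mu>. complex_of_real (sin (h * x) ^ j))"
    by (rule integral_complex_of_real[symmetric])
  also have "\<dots> = (CLINT x|\<mu>. (\<Sum>i\<le>j. of_nat (j choose i) * (- 1) ^ (j - i) / (2 * \<i>) ^ j
      * iexp ((h * (2 * real i - real j)) * x)))"
    unfolding sin_power_expansion by (simp add: mult_ac)
  also have "\<dots> = (\<Sum>i\<le>j. of_nat (j choose i) * (- 1) ^ (j - i) / (2 * \<i>) ^ j
      * char \<mu> (h * (2 * real i - real j)))"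
    unfolding char_def
    by (subst Bochner_Integration.integral_sum, intro integrable_mult_right int)
       (simp only: integral_mult_right_zero)
  finally show ?thesis .
qed

text \<open>The coefficients \<open>(j choose i) / 2 ^ j\<close> of the expansion of \<open>sin (h x) ^ j\<close> into characters sum to one in absolute
  value, so no precision is lost.\<close>

lemma sin_moment_diff:
  assumes "real_distribution \<mu>" "real_distribution \<nu>"
    and e: "\<And>t. \<bar>t\<bar> \<le> h * real j \<Longrightarrow> cmod (char \<mu> t - char \<nu> t) \<le> \<epsilon>" and h: "h \<ge> 0"
  shows "\<bar>(\<integral>x. sin (h * x) ^ j \<partial>\<mu>) - (\<integral>x. sin (h * x) ^ j \<partial>\<nu>)\<bar> \<le> \<epsilon>"
proof -
  have "\<bar>(\<integral>x. sin (h * x) ^ j \<partial>\<mu>) - (\<integral>x. sin (h * x) ^ j \<partial>\<nu>)\<bar>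
      = cmod (complex_of_real (\<integral>x. sin (h * x) ^ j \<partial>\<mu>) - complex_of_real (\<integral>x. sin (h * x) ^ j \<partial>\<nu>))"
    by (metis norm_of_real of_real_diff real_norm_def)
  also have "\<dots> = cmod (\<Sum>i\<le>j. of_nat (j choose i) * (- 1) ^ (j - i) / (2 * \<i>) ^ j
      * (char \<mu> (h * (2 * real i - real j)) - char \<nu> (h * (2 * real i - real j))))"
    unfolding sin_moment_char[OF assms(1)] sin_moment_char[OF assms(2)]
    by (simp add: sum_subtractf[symmetric] right_diff_distrib)
  also have "\<dots> \<le> (\<Sum>i\<le>j. real (j choose i) / 2 ^ j * \<epsilon>)"
  proof (intro order_trans[OF norm_sum] sum_mono)
    fix i assume i: "i \<in> {..j}"
    have "\<bar>2 * real i - real j\<bar> \<le> real j" using i by auto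
    hence "cmod (char \<mu> (h * (2 * real i - real j)) - char \<nu> (h * (2 * real i - real j))) \<le> \<epsilon>"
      using h by (intro e) (simp add: abs_mult mult_left_mono)
    thus "cmod (of_nat (j choose i) * (- 1) ^ (j - i) / (2 * \<i>) ^ j
      * (char \<mu> (h * (2 * real i - real j)) - char \<nu> (h * (2 * real i - real j))))
      \<le> real (j choose i) / 2 ^ j * \<epsilon>"
      by (simp add: norm_mult norm_divide norm_power divide_right_mono mult_left_mono)
  qed
  also have "\<dots> = (\<Sum>i\<le>j. real (j choose i)) / 2 ^ j * \<epsilon>"
    by (simp add: sum_distrib_right sum_divide_distrib)
  also have "(\<Sum>i\<le>j. real (j choose i)) = 2 ^ j"
    using choose_row_sum[of j] by (metis of_nat_sum of_nat_numeral of_nat_power)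
  finally show ?thesis by simp
qed

text \<open>Expand \<open>(c - a * sin (h x)) ^ i\<close> binomially; the absolute values of the coefficients sum to
  \<open>(\<bar>c\<bar> + \<bar>a\<bar>) ^ i\<close>.\<close>

lemma sin_polynomial_diff:
  fixes Q :: "real poly"
  assumes \<mu>: "real_distribution \<mu>" and \<nu>: "real_distribution \<nu>"
    and e: "\<And>t. \<bar>t\<bar> \<le> h * real d \<Longrightarrow> cmod (char \<mu> t - char \<nu> t) \<le> \<epsilon>" and h: "h \<ge> 0"
    and d: "degree Q \<le> d" and B: "1 \<le> B" "\<bar>c\<bar> + \<bar>a\<bar> \<le> B"
  shows "\<bar>(\<integral>x. poly Q (c - a * sin (h * x)) \<partial>\<mu>) - (\<integral>x. poly Q (c - a * sin (h * x)) \<partial>\<nu>)\<bar>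
    \<le> coeff_norm Q * B ^ d * \<epsilon>"
proof -
  have e0: "\<epsilon> \<ge> 0" using e[of 0] h by (simp add: order_trans[OF norm_ge_zero])
  have ex: "poly Q (c - a * sin (h * x)) =
      (\<Sum>i\<le>degree Q. \<Sum>l\<le>i. coeff Q i * real (i choose l) * (- a) ^ l * c ^ (i - l) * sin (h * x) ^ l)" for x
  proof -
    have "poly Q (c - a * sin (h * x)) = (\<Sum>i\<le>degree Q. coeff Q i * ((- a * sin (h * x)) + c) ^ i)"
      by (simp add: poly_altdef)
    also have "\<dots> = (\<Sum>i\<le>degree Q. \<Sum>l\<le>i. coeff Q i * real (i choose l) * (- a) ^ l * c ^ (i - l) * sin (h * x) ^ l)"
      unfolding binomial_ring sum_distrib_left power_mult_distrib by (simp add: mult_ac)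
    finally show ?thesis .
  qed
  have int: "(\<integral>x. poly Q (c - a * sin (h * x)) \<partial>M) =
      (\<Sum>i\<le>degree Q. \<Sum>l\<le>i. coeff Q i * real (i choose l) * (- a) ^ l * c ^ (i - l) * (\<integral>x. sin (h * x) ^ l \<partial>M))"
    if "real_distribution M" for M
  proof -
    interpret real_distribution M by fact
    have [measurable_cong]: "sets M = sets borel" by simp
    have i: "integrable M (\<lambda>x. sin (h * x) ^ l)" for l
      by (rule integrable_const_bound[of _ 1]) (auto simp: power_le_one power_abs)
    show ?thesis unfolding ex
      by (subst Bochner_Integration.integral_sum; (intro Bochner_Integration.integrable_sum integrable_mult_right i)?)
         (subst Bochner_Integration.integral_sum; (intro integrable_mult_right i)?; simp)
  qed
  have "(\<integral>x. poly Q (c - a * sin (h * x)) \<partial>\<mu>) - (\<integral>x. poly Q (c - a * sin (h * x)) \<partial>\<nu>) =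
    (\<Sum>i\<le>degree Q. \<Sum>l\<le>i. coeff Q i * real (i choose l) * (- a) ^ l * c ^ (i - l) *
       ((\<integral>x. sin (h * x) ^ l \<partial>\<mu>) - (\<integral>x. sin (h * x) ^ l \<partial>\<nu>)))"
    unfolding int[OF \<mu>] int[OF \<nu>] by (simp add: sum_subtractf[symmetric] right_diff_distrib)
  also have "\<bar>\<dots>\<bar> \<le> (\<Sum>i\<le>degree Q. \<Sum>l\<le>i. \<bar>coeff Q i\<bar> * (real (i choose l) * \<bar>a\<bar> ^ l * \<bar>c\<bar> ^ (i - l)) * \<epsilon>)"
  proof (intro order_trans[OF sum_abs] sum_mono)
    fix i l assume il: "i \<in> {..degree Q}" "l \<in> {..i}"
    have "\<bar>(\<integral>x. sin (h * x) ^ l \<partial>\<mu>) - (\<integral>x. sin (h * x) ^ l \<partial>\<nu>)\<bar> \<le> \<epsilon>"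
    proof (rule sin_moment_diff[OF \<mu> \<nu> e h])
      fix t assume "\<bar>t\<bar> \<le> h * real l"
      also have "\<dots> \<le> h * real d" using il d h by (intro mult_left_mono) auto
      finally show "\<bar>t\<bar> \<le> h * real d" .
    qed
    thus "\<bar>coeff Q i * real (i choose l) * (- a) ^ l * c ^ (i - l) *
       ((\<integral>x. sin (h * x) ^ l \<partial>\<mu>) - (\<integral>x. sin (h * x) ^ l \<partial>\<nu>))\<bar>
       \<le> \<bar>coeff Q i\<bar> * (real (i choose l) * \<bar>a\<bar> ^ l * \<bar>c\<bar> ^ (i - l)) * \<epsilon>"
      by (simp add: abs_mult power_abs mult.assoc mult_left_mono)
  qed
  also have "\<dots> = (\<Sum>i\<le>degree Q. \<bar>coeff Q i\<bar> * (\<bar>a\<bar> + \<bar>c\<bar>) ^ i * \<epsilon>)"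
    unfolding binomial_ring sum_distrib_left sum_distrib_right by (simp add: mult_ac)
  also have "\<dots> \<le> (\<Sum>i\<le>degree Q. \<bar>coeff Q i\<bar> * B ^ d * \<epsilon>)"
  proof (intro sum_mono mult_right_mono mult_left_mono e0)
    fix i assume i: "i \<in> {..degree Q}"
    have "(\<bar>a\<bar> + \<bar>c\<bar>) ^ i \<le> B ^ i" using B by (intro power_mono) auto
    also have "\<dots> \<le> B ^ d" using B i d by (intro power_increasing) auto
    finally show "(\<bar>a\<bar> + \<bar>c\<bar>) ^ i \<le> B ^ d" .
  qed auto
  also have "\<dots> = coeff_norm Q * B ^ d * \<epsilon>"
    by (simp add: coeff_norm_def sum_distrib_right)
  finally show ?thesis .
qed

section \<open>Gaps between distribution functions on a dyadic grid\<close>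

lemma sum_inverse_squares_le: "(\<Sum>k<n. 1 / (real k + 1) ^ 2) \<le> 2 - 1 / real (max 1 n)"
proof (induction n)
  case (Suc n)
  show ?case
  proof (cases "n = 0")
    case False
    have "1 / (real n + 1) ^ 2 \<le> 1 / (real n * (real n + 1))"
      using False unfolding power2_eq_square by (intro divide_left_mono mult_right_mono) auto
    also have "\<dots> = 1 / real n - 1 / (real n + 1)"
      using False by (simp add: field_simps)
    finally have "1 / (real n + 1) ^ 2 \<le> 1 / real n - 1 / (real n + 1)" .
    thus ?thesis using Suc False by (simp add: max_def add.commute)
  qed simp
qed simp

lemma sum_inverse_squares_int_le:
  assumes "finite (A :: int set)"
  shows "(\<Sum>l\<in>A. if a \<le> l then 1 / (real_of_int (l - a) + 1) ^ 2 else 0) \<le> 2"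
proof -
  define B where "B = (\<lambda>l. nat (l - a)) ` (A \<inter> {a..})"
  have fB: "finite B" using assms by (simp add: B_def)
  then obtain n where n: "B \<subseteq> {..<n}"
    by (metis finite_nat_bounded)
  have "(\<Sum>l\<in>A. if a \<le> l then 1 / (real_of_int (l - a) + 1) ^ 2 else 0)
      = (\<Sum>l\<in>A \<inter> {a..}. 1 / (real (nat (l - a)) + 1) ^ 2)"
    using assms by (subst sum.inter_restrict) (auto intro!: sum.cong)
  also have "\<dots> = (\<Sum>k\<in>B. 1 / (real k + 1) ^ 2)"
    unfolding B_def by (subst sum.reindex) (auto simp: inj_on_def)
  also have "\<dots> \<le> (\<Sum>k<n. 1 / (real k + 1) ^ 2)"
    using n by (intro sum_mono2) auto
  also have "\<dots> \<le> 2" using sum_inverse_squares_le[of n] by (smt (verit) zero_le_divide_1_iff of_nat_0_le_iff)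
  finally show ?thesis .
qed

text \<open>The point \<open>x\<close> lies to the left of the grid point \<open>l w\<close> only from \<open>l = \<lceil>x / w\<rceil>\<close> on, and then the distances to
  the midpoints grow linearly.  A power \<open>q \<ge> 2\<close> makes the sum converge, uniformly in \<open>x\<close>; this is what
  keeps the number of intervals out of the estimate.\<close>

lemma grid_tail_sum_le:
  fixes w \<kappa> x :: real
  assumes w: "w > 0" and \<kappa>: "\<kappa> \<ge> 0" and q: "q \<ge> 2" and A: "finite (A :: int set)"
  shows "(\<Sum>l\<in>A. if x \<le> real_of_int l * w then (\<kappa> * w / (2 * ((real_of_int l + 1 / 2) * w - x))) ^ q else 0)
    \<le> 2 * \<kappa> ^ q"
proof -
  define a where "a = \<lceil>x / w\<rceil>"
  have iff: "x \<le> real_of_int l * w \<longleftrightarrow> a \<le> l" for l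
    using w by (simp add: a_def ceiling_le_iff field_simps)
  have "(\<Sum>l\<in>A. if x \<le> real_of_int l * w then (\<kappa> * w / (2 * ((real_of_int l + 1 / 2) * w - x))) ^ q else 0)
    \<le> (\<Sum>l\<in>A. \<kappa> ^ q * (if a \<le> l then 1 / (real_of_int (l - a) + 1) ^ 2 else 0))"
  proof (rule sum_mono)
    fix l assume "l \<in> A"
    show "(if x \<le> real_of_int l * w then (\<kappa> * w / (2 * ((real_of_int l + 1 / 2) * w - x))) ^ q else 0)
      \<le> \<kappa> ^ q * (if a \<le> l then 1 / (real_of_int (l - a) + 1) ^ 2 else 0)"
    proof (cases "a \<le> l")
      case True
      define k where "k = real_of_int (l - a)"
      have k: "k \<ge> 0" using True by (simp add: k_def)
      have "x / w \<le> real_of_int a" by (simp add: a_def)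
      hence "x \<le> real_of_int a * w" using w by (simp add: field_simps)
      hence "(k + 1 / 2) * w \<le> (real_of_int l + 1 / 2) * w - x"
        by (simp add: k_def algebra_simps)
      hence d: "(2 * k + 1) * w \<le> 2 * ((real_of_int l + 1 / 2) * w - x)"
        by (simp add: algebra_simps)
      have "(k + 1) * w \<le> (2 * k + 1) * w" using k w by (intro mult_right_mono) auto
      with d have d: "(k + 1) * w \<le> 2 * ((real_of_int l + 1 / 2) * w - x)" by linarith
      have pos: "0 < (k + 1) * w" using k w by simp
      have pos': "0 < 2 * ((real_of_int l + 1 / 2) * w - x)" using d pos by linarith
      have "\<kappa> * w / (2 * ((real_of_int l + 1 / 2) * w - x)) \<le> \<kappa> * w / ((k + 1) * w)"
        using \<kappa> w by (intro divide_left_mono[OF d _ mult_pos_pos[OF pos' pos]]) auto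
      also have "\<dots> = \<kappa> / (k + 1)" using w by simp
      finally have "(\<kappa> * w / (2 * ((real_of_int l + 1 / 2) * w - x))) ^ q \<le> (\<kappa> / (k + 1)) ^ q"
        using \<kappa> w pos' by (intro power_mono divide_nonneg_pos) auto
      also have "\<dots> = \<kappa> ^ q * (1 / (k + 1) ^ q)" by (simp add: power_divide)
      also have "\<dots> \<le> \<kappa> ^ q * (1 / (k + 1) ^ 2)"
        using k \<kappa> q by (intro mult_left_mono divide_left_mono power_increasing mult_pos_pos zero_less_power) auto
      finally show ?thesis using True iff by (simp add: k_def)
    qed (simp add: iff)
  qed
  also have "\<dots> = \<kappa> ^ q * (\<Sum>l\<in>A. if a \<le> l then 1 / (real_of_int (l - a) + 1) ^ 2 else 0)"
    by (simp add: sum_distrib_left)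
  also have "\<dots> \<le> \<kappa> ^ q * 2"
    using \<kappa> by (intro mult_left_mono sum_inverse_squares_int_le A) auto
  finally show ?thesis by (simp add: mult.commute)
qed

text \<open>The expected number of intervals of length \<open>V / 2 ^ i\<close> that the monotone coupling of two distributions crosses
  upwards has this form: mass that is to the left of an interval under \<open>F\<close> and to the right of
  it under \<open>G\<close>.  The intervals subdivide \<open>[-V, V]\<close>.\<close>

definition dyadic_gap :: "real \<Rightarrow> nat \<Rightarrow> (real \<Rightarrow> real) \<Rightarrow> (real \<Rightarrow> real) \<Rightarrow> real" where
  "dyadic_gap V i F G = (\<Sum>l\<in>{- (2 ^ i)..<2 ^ i :: int}.
     max 0 (F (real_of_int l * (V / 2 ^ i)) - G ((real_of_int l + 1) * (V / 2 ^ i))))"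

text \<open>For the interval \<open>[s, t]\<close> with midpoint \<open>c\<close>, the function \<open>P c x = Q (g c - g x)\<close> is close to one
  for \<open>x \<le> s\<close>, close to zero for \<open>x > t\<close>, and between zero and one throughout.  Hence
  \<open>F_\<mu> s - F_\<nu> t\<close> is at most the difference of the integrals of \<open>P c\<close>, which is controlled by the characteristic
  functions, plus two tail integrals.  The tails are summed over the grid before they are integrated.\<close>

lemma dyadic_gap_cdf_le:
  fixes \<mu> \<nu> :: "real measure" and m r i :: nat
  defines "N \<equiv> real (2 * m + 1)" and "d \<equiv> 4 * m * r + 1" and "q \<equiv> 2 * r - 1"
  assumes \<mu>: "real_distribution \<mu>" "AE x in \<mu>. \<bar>x\<bar> \<le> V"
    and \<nu>: "real_distribution \<nu>" "AE x in \<nu>. \<bar>x\<bar> \<le> V"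
    and V: "V > 0" and h: "h > 0" "h * V \<le> 1" and N: "N \<ge> 8" and r: "r \<ge> 2"
    and close: "\<And>t. \<bar>t\<bar> \<le> h * real d \<Longrightarrow> cmod (char \<mu> t - char \<nu> t) \<le> \<epsilon>"
  shows "dyadic_gap V i (cdf \<mu>) (cdf \<nu>)
    \<le> 4 * (64 * 2 ^ i / N) ^ q + 4 * 2 ^ i * 7 ^ (2 * m * r) * (1 / 2 + 1 / (2 * h * V)) ^ d * \<epsilon>"
proof -
  define w where "w = V / 2 ^ i"
  interpret \<mu>: real_distribution \<mu> by fact
  interpret \<nu>: real_distribution \<nu> by fact
  have [measurable_cong]: "sets \<mu> = sets borel" "sets \<nu> = sets borel" by auto
  have [simp]: "r \<ge> 1" using r by simp
  obtain Q :: "real poly" where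
    Q: "degree Q \<le> d" "coeff_norm Q \<le> 2 * 7 ^ (2 * m * r)"
    "\<And>v. \<bar>v\<bar> \<le> 1 \<Longrightarrow> 0 \<le> poly Q v \<and> poly Q v \<le> 1"
    "\<And>v. 0 < v \<Longrightarrow> v \<le> 1 \<Longrightarrow> 1 - poly Q v \<le> (8 / (N * v)) ^ q"
    "\<And>v. 0 < v \<Longrightarrow> v \<le> 1 \<Longrightarrow> poly Q (- v) \<le> (8 / (N * v)) ^ q"
    by (rule step_polynomial_exists[of m r, folded N_def d_def q_def, OF N \<open>r \<ge> 1\<close>]) (rule that)
  \<comment> \<open>The map \<open>g\<close> takes \<open>[-V, V]\<close> into \<open>[-1/2, 1/2]\<close>, so differences stay in the range where \<open>Q\<close> is a step, and it contracts distances by a factor of at most \<open>4 V\<close>.\<close>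
  define g where "g = (\<lambda>x. sin (h * x) / (2 * h * V))"
  have hx: "\<bar>h * x\<bar> \<le> 1" if "\<bar>x\<bar> \<le> V" for x
  proof -
    have "h * \<bar>x\<bar> \<le> h * V" using h that by (intro mult_left_mono) auto
    moreover have "\<bar>h * x\<bar> = h * \<bar>x\<bar>" using h by (simp add: abs_mult)
    ultimately show ?thesis using h by linarith
  qed
  have g1: "\<bar>g x\<bar> \<le> 1 / 2" if "\<bar>x\<bar> \<le> V" for x
  proof -
    have "\<bar>sin (h * x)\<bar> \<le> \<bar>h * x\<bar>" by (rule abs_sin_x_le_abs_x)
    also have "\<dots> \<le> h * V" using h that by (simp add: abs_mult)
    finally show ?thesis using h V by (simp add: g_def field_simps)
  qed
  have g2: "g y - g x \<ge> (y - x) / (4 * V)" if "\<bar>x\<bar> \<le> V" "\<bar>y\<bar> \<le> V" "x \<le> y" for x y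
  proof -
    have "(h * y - h * x) / 2 \<le> sin (h * y) - sin (h * x)"
      using hx[OF that(1)] hx[OF that(2)] that h by (intro sin_expansive mult_left_mono) auto
    hence "(h * y - h * x) / 2 / (2 * h * V) \<le> (sin (h * y) - sin (h * x)) / (2 * h * V)"
      using h V by (intro divide_right_mono) auto
    moreover have "(h * y - h * x) / 2 / (2 * h * V) = (y - x) / (4 * V)"
      using h V by (simp add: field_simps)
    ultimately show ?thesis by (simp add: g_def diff_divide_distrib)
  qed
  define P where "P = (\<lambda>c x. poly Q (g c - g x))"
  have P01: "0 \<le> P c x \<and> P c x \<le> 1" if "\<bar>x\<bar> \<le> V" "\<bar>c\<bar> \<le> V" for c x
    unfolding P_def using g1[OF that(1)] g1[OF that(2)] by (intro Q(3)) linarith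
  have Pm [measurable]: "P c \<in> borel_measurable borel" for c
    unfolding P_def g_def poly_altdef by measurable
  have tail: "(8 / (N * (g y - g x))) ^ q \<le> (32 * V / (N * (y - x))) ^ q \<and> 0 < g y - g x \<and> g y - g x \<le> 1"
    if "\<bar>x\<bar> \<le> V" "\<bar>y\<bar> \<le> V" "x < y" for x y
  proof -
    have p: "0 < (y - x) / (4 * V)" using that V by simp
    have b: "(y - x) / (4 * V) \<le> g y - g x" using g2[of x y] that by simp
    have N0: "N > 0" using N by simp
    have pg: "0 < g y - g x" using p b by linarith
    have "8 / (N * (g y - g x)) \<le> 8 / (N * ((y - x) / (4 * V)))"
      using b N0 by (intro divide_left_mono mult_left_mono mult_pos_pos p pg) auto
    also have "\<dots> = 32 * V / (N * (y - x))" using V N that by (simp add: field_simps)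
    finally have c: "8 / (N * (g y - g x)) \<le> 32 * V / (N * (y - x))" .
    have "0 \<le> 8 / (N * (g y - g x))" using N0 pg by simp
    hence "(8 / (N * (g y - g x))) ^ q \<le> (32 * V / (N * (y - x))) ^ q"
      by (rule power_mono[OF c])
    thus ?thesis using pg g1[OF that(1)] g1[OF that(2)] by linarith
  qed
  define \<kappa> where "\<kappa> = 64 * 2 ^ i / N"
  have w: "w > 0" using V by (simp add: w_def)
  have \<kappa>w: "\<kappa> * w / (2 * z) = 32 * V / (N * z)" for z using V by (simp add: \<kappa>_def w_def)
  have \<kappa>0: "\<kappa> \<ge> 0" using N by (simp add: \<kappa>_def)
  \<comment> \<open>This bounds \<open>1 - P c\<close> to the left of the interval with index \<open>l\<close>; its reflection, with index \<open>- l - 1\<close>, bounds \<open>P c\<close> to the right.\<close>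
  define T where "T = (\<lambda>(l::int) x. if x \<le> real_of_int l * w then (\<kappa> * w / (2 * ((real_of_int l + 1 / 2) * w - x))) ^ q else 0)"
  have Tm [measurable]: "T l \<in> borel_measurable borel" for l unfolding T_def by measurable
  have T0: "T l x \<ge> 0" for l x
  proof -
    have "(real_of_int l + 1 / 2) * w - x \<ge> 0" if "x \<le> real_of_int l * w" using that w
      by (simp add: algebra_simps)
    thus ?thesis using \<kappa>0 w by (auto simp: T_def intro!: zero_le_power divide_nonneg_nonneg)
  qed
  have q2: "q \<ge> 2" using r by (simp add: q_def)
  have Tsum: "(\<Sum>l\<in>A. T l x) \<le> 2 * \<kappa> ^ q" if "finite A" for A x
    unfolding T_def by (rule grid_tail_sum_le[OF w \<kappa>0 q2 that])
  have T1: "T l x \<le> 2 * \<kappa> ^ q" for l x using Tsum[of "{l}" x] by simp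
  have Tint: "integrable M (T l)" "integrable M (\<lambda>x. T l (- x))" if "prob_space M" "sets M = sets borel" for l and M :: "real measure"
  proof -
    interpret M: prob_space M by fact
    have [measurable_cong]: "sets M = sets borel" by fact
    show "integrable M (T l)" by (rule M.integrable_const_bound[of _ "2 * \<kappa> ^ q"]) (use T0 T1 in auto)
    show "integrable M (\<lambda>x. T l (- x))" by (rule M.integrable_const_bound[of _ "2 * \<kappa> ^ q"]) (use T0 T1 in auto)
  qed
  define L where "L = {- (2 ^ i)..<2 ^ i :: int}"
  define E where "E = 2 * 7 ^ (2 * m * r) * (1 / 2 + 1 / (2 * h * V)) ^ d * \<epsilon>"
  have eps0: "\<epsilon> \<ge> 0" using close[of 0] h by (simp add: order_trans[OF norm_ge_zero])
  have B1: "1 \<le> 1 / 2 + 1 / (2 * h * V)" using h V by (simp add: field_simps)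
  have E0: "E \<ge> 0" using eps0 B1 by (simp add: E_def)
  have step: "max 0 (cdf \<mu> (real_of_int l * w) - cdf \<nu> ((real_of_int l + 1) * w))
      \<le> (\<integral>x. T l x \<partial>\<mu>) + (\<integral>x. T (- l - 1) (- x) \<partial>\<nu>) + E" if l: "l \<in> L" for l
  proof -
    define c where "c = (real_of_int l + 1 / 2) * w"
    have lw: "- (2 ^ i) \<le> real_of_int l" "real_of_int l + 1 \<le> 2 ^ i"
    proof -
      have "- (2 ^ i) \<le> l" "l + 1 \<le> 2 ^ i" using l by (auto simp: L_def)
      hence "real_of_int (- (2 ^ i)) \<le> real_of_int l" "real_of_int (l + 1) \<le> real_of_int (2 ^ i)"
        by (simp_all only: of_int_le_iff)
      thus "- (2 ^ i) \<le> real_of_int l" "real_of_int l + 1 \<le> 2 ^ i" by simp_all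
    qed
    have cV: "\<bar>c\<bar> \<le> V"
    proof -
      have "\<bar>real_of_int l + 1 / 2\<bar> \<le> 2 ^ i" using lw by linarith
      hence "\<bar>c\<bar> \<le> 2 ^ i * w" using w unfolding c_def abs_mult by (intro mult_mono) auto
      thus ?thesis by (simp add: w_def)
    qed
    have Pint: "integrable M (P c)" if "real_distribution M" "AE x in M. \<bar>x\<bar> \<le> V" for M
    proof -
      interpret M: real_distribution M by fact
      have [measurable_cong]: "sets M = sets borel" by simp
      show ?thesis by (rule M.integrable_const_bound[of _ 1]) (use that(2) P01[OF _ cV] in \<open>auto elim!: eventually_mono\<close>)
    qed
    have lc: "real_of_int l * w < c" "c < (real_of_int l + 1) * w" using w by (auto simp: c_def algebra_simps)
    have "cdf \<mu> (real_of_int l * w) = (\<integral>x. indicator {..real_of_int l * w} x \<partial>\<mu>)"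
      by (simp add: cdf_def)
    also have "\<dots> \<le> (\<integral>x. P c x + T l x \<partial>\<mu>)"
    proof (rule integral_mono_AE)
      show "integrable \<mu> (\<lambda>x. P c x + T l x)" using Pint[OF \<mu>] Tint(1)[of \<mu> l] \<mu>.prob_space_axioms by auto
      show "AE x in \<mu>. indicator {..real_of_int l * w} x \<le> P c x + T l x"
        using \<mu>(2)
      proof eventually_elim
        case (elim x)
        show ?case
        proof (cases "x \<le> real_of_int l * w")
          case True
          hence "x < c" using lc by linarith
          hence "1 - P c x \<le> T l x"
            using Q(4)[of "g c - g x"] tail[OF elim cV] True unfolding P_def T_def \<kappa>w c_def by fastforce
          thus ?thesis using True by simp
        qed (use P01[OF elim cV] T0 in auto)
      qed
    qed (auto simp: integrable_indicator_iff less_top[symmetric])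
    also have "\<dots> = (\<integral>x. P c x \<partial>\<mu>) + (\<integral>x. T l x \<partial>\<mu>)"
      using Pint[OF \<mu>] Tint(1)[of \<mu> l] \<mu>.prob_space_axioms by simp
    finally have 1: "cdf \<mu> (real_of_int l * w) \<le> (\<integral>x. P c x \<partial>\<mu>) + (\<integral>x. T l x \<partial>\<mu>)" .
    have "(\<integral>x. P c x \<partial>\<nu>) \<le> (\<integral>x. indicator {..(real_of_int l + 1) * w} x + T (- l - 1) (- x) \<partial>\<nu>)"
    proof (rule integral_mono_AE)
      show "integrable \<nu> (\<lambda>x. indicator {..(real_of_int l + 1) * w} x + T (- l - 1) (- x))"
        using Tint(2)[of \<nu> "- l - 1"] \<nu>.prob_space_axioms
        by (auto simp: integrable_indicator_iff less_top[symmetric])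
      show "AE x in \<nu>. P c x \<le> indicator {..(real_of_int l + 1) * w} x + T (- l - 1) (- x)"
        using \<nu>(2)
      proof eventually_elim
        case (elim x)
        show ?case
        proof (cases "x \<le> (real_of_int l + 1) * w")
          case False
          hence "c < x" using lc by linarith
          have "P c x \<le> (32 * V / (N * (x - c))) ^ q"
            using Q(5)[of "g x - g c"] tail[OF cV elim \<open>c < x\<close>] unfolding P_def by fastforce
          also have "\<dots> = T (- l - 1) (- x)"
            using False unfolding T_def \<kappa>w c_def by (auto simp: algebra_simps)
          finally show ?thesis using False by (simp add: indicator_def)
        qed (use P01[OF elim cV] T0[of "- l - 1" "- x"] in auto)
      qed
    qed (use Pint[OF \<nu>] in auto)
    also have "\<dots> = cdf \<nu> ((real_of_int l + 1) * w) + (\<integral>x. T (- l - 1) (- x) \<partial>\<nu>)"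
      using Tint(2)[of \<nu> "- l - 1"] \<nu>.prob_space_axioms
      by (subst Bochner_Integration.integral_add) (auto simp: integrable_indicator_iff less_top[symmetric] cdf_def)
    finally have 2: "(\<integral>x. P c x \<partial>\<nu>) \<le> cdf \<nu> ((real_of_int l + 1) * w) + (\<integral>x. T (- l - 1) (- x) \<partial>\<nu>)" .
    have "\<bar>(\<integral>x. P c x \<partial>\<mu>) - (\<integral>x. P c x \<partial>\<nu>)\<bar> \<le> coeff_norm Q * (1 / 2 + 1 / (2 * h * V)) ^ d * \<epsilon>"
    proof -
      have "P c = (\<lambda>x. poly Q (g c - 1 / (2 * h * V) * sin (h * x)))"
        by (simp add: P_def g_def)
      moreover have "\<bar>g c\<bar> + \<bar>1 / (2 * h * V)\<bar> \<le> 1 / 2 + 1 / (2 * h * V)"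
        using g1[OF cV] h V by simp
      ultimately show ?thesis
        using sin_polynomial_diff[OF \<mu>(1) \<nu>(1), of h d \<epsilon> Q, OF close _ Q(1) B1, of "g c" "1 / (2 * h * V)"] h
        by simp
    qed
    also have "\<dots> \<le> E" unfolding E_def using Q(2) B1 eps0 by (intro mult_right_mono) auto
    finally have 3: "(\<integral>x. P c x \<partial>\<mu>) - (\<integral>x. P c x \<partial>\<nu>) \<le> E" by linarith
    have "0 \<le> (\<integral>x. T l x \<partial>\<mu>)" "0 \<le> (\<integral>x. T (- l - 1) (- x) \<partial>\<nu>)"
      using T0 by (auto intro!: integral_nonneg_AE)
    thus ?thesis using 1 2 3 E0 by linarith
  qed
  have fL: "finite L" by (simp add: L_def)
  have s1: "(\<Sum>l\<in>L. \<integral>x. T l x \<partial>\<mu>) \<le> 2 * \<kappa> ^ q"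
  proof -
    have "(\<Sum>l\<in>L. \<integral>x. T l x \<partial>\<mu>) = (\<integral>x. (\<Sum>l\<in>L. T l x) \<partial>\<mu>)"
      using Tint(1)[of \<mu>] \<mu>.prob_space_axioms by simp
    also have "\<dots> \<le> 2 * \<kappa> ^ q"
      using Tint(1)[of \<mu>] \<mu>.prob_space_axioms Tsum[OF fL] by (intro \<mu>.integral_le_const) auto
    finally show ?thesis .
  qed
  have s2: "(\<Sum>l\<in>L. \<integral>x. T (- l - 1) (- x) \<partial>\<nu>) \<le> 2 * \<kappa> ^ q"
  proof -
    have "(\<Sum>l\<in>L. \<integral>x. T (- l - 1) (- x) \<partial>\<nu>) = (\<integral>x. (\<Sum>l\<in>L. T (- l - 1) (- x)) \<partial>\<nu>)"
      using Tint(2)[of \<nu>] \<nu>.prob_space_axioms by simp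
    also have "\<dots> \<le> 2 * \<kappa> ^ q"
    proof (intro \<nu>.integral_le_const AE_I2)
      fix x
      have "(\<Sum>l\<in>L. T (- l - 1) (- x)) = (\<Sum>l\<in>(\<lambda>l. - l - 1) ` L. T l (- x))"
        by (subst sum.reindex) (auto simp: inj_on_def)
      thus "(\<Sum>l\<in>L. T (- l - 1) (- x)) \<le> 2 * \<kappa> ^ q" using Tsum[of "(\<lambda>l. - l - 1) ` L" "- x"] fL by simp
    qed (use Tint(2)[of \<nu>] \<nu>.prob_space_axioms in auto)
    finally show ?thesis .
  qed
  have "(\<Sum>l\<in>L. max 0 (cdf \<mu> (real_of_int l * w) - cdf \<nu> ((real_of_int l + 1) * w)))
     \<le> (\<Sum>l\<in>L. (\<integral>x. T l x \<partial>\<mu>) + (\<integral>x. T (- l - 1) (- x) \<partial>\<nu>) + E)"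
    by (intro sum_mono step)
  also have "\<dots> \<le> 4 * \<kappa> ^ q + real (card L) * E"
    using s1 s2 by (simp add: sum.distrib)
  also have "real (card L) = 2 * 2 ^ i" by (simp add: L_def)
  finally have "dyadic_gap V i (cdf \<mu>) (cdf \<nu>) \<le> 4 * \<kappa> ^ q + 2 * 2 ^ i * E"
    unfolding dyadic_gap_def w_def L_def .
  thus ?thesis by (simp add: \<kappa>_def E_def algebra_simps)
qed

section \<open>Monotone rearrangements and dyadic gaps\<close>

text \<open>The term with the smallest \<open>i\<close> such that \<open>2 V / 2 ^ i \<le> z\<close> dominates \<open>z powr p\<close> if \<open>i \<le> J\<close>;
  otherwise the first summand does.\<close>

lemma powr_le_dyadic_sum:
  fixes V z p :: real
  assumes V: "V > 0" and z: "0 \<le> z" "z \<le> 2 * V" and p: "p \<ge> 1"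
  shows "z powr p \<le> (4 * (V / 2 ^ J)) powr p +
    (\<Sum>i\<le>J. (4 * (V / 2 ^ i)) powr p * (if 2 * (V / 2 ^ i) \<le> z then 1 else 0))"
proof (cases "2 * (V / 2 ^ J) \<le> z")
  case False
  hence "z \<le> 4 * (V / 2 ^ J)" using V by (smt (verit) divide_pos_pos zero_less_power)
  hence "z powr p \<le> (4 * (V / 2 ^ J)) powr p" using z p by (intro powr_mono2) auto
  moreover have "0 \<le> (\<Sum>i\<le>J. (4 * (V / 2 ^ i)) powr p * (if 2 * (V / 2 ^ i) \<le> z then 1 else 0))"
    by (intro sum_nonneg) auto
  ultimately show ?thesis by linarith
next
  case True
  define i where "i = (LEAST i. 2 * (V / 2 ^ i) \<le> z)"
  have i: "2 * (V / 2 ^ i) \<le> z" unfolding i_def by (rule LeastI) (rule True)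
  have iJ: "i \<le> J" unfolding i_def by (rule Least_le) (rule True)
  have "z \<le> 4 * (V / 2 ^ i)"
  proof (cases i)
    case 0 thus ?thesis using z V by simp
  next
    case (Suc k)
    have "\<not> 2 * (V / 2 ^ k) \<le> z" using not_less_Least[of k "\<lambda>i. 2 * (V / 2 ^ i) \<le> z"] Suc by (simp add: i_def)
    thus ?thesis using Suc by simp
  qed
  hence "z powr p \<le> (4 * (V / 2 ^ i)) powr p" using z p by (intro powr_mono2) auto
  also have "\<dots> = (4 * (V / 2 ^ i)) powr p * (if 2 * (V / 2 ^ i) \<le> z then 1 else 0)" using i by simp
  also have "\<dots> \<le> (\<Sum>i\<le>J. (4 * (V / 2 ^ i)) powr p * (if 2 * (V / 2 ^ i) \<le> z then 1 else 0))"
    using iJ by (intro member_le_sum) auto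
  finally show ?thesis by (simp add: add_increasing)
qed

text \<open>An interval of length \<open>2 w\<close> contains a grid interval of length \<open>w\<close>: start at \<open>\<lceil>a / w\<rceil>\<close>.\<close>

lemma grid_interval_between:
  fixes a b V :: real and i :: nat
  defines "w \<equiv> V / 2 ^ i"
  assumes V: "V > 0" and ab: "- V \<le> a" "b \<le> V" "2 * w \<le> b - a"
  shows "\<exists>l\<in>{- (2 ^ i)..<2 ^ i :: int}. a \<le> real_of_int l * w \<and> (real_of_int l + 1) * w < b"
proof -
  have w: "w > 0" "V = 2 ^ i * w" using V by (auto simp: w_def)
  define l where "l = \<lceil>a / w\<rceil>"
  have "a / w \<le> real_of_int l" "real_of_int l < a / w + 1" by (auto simp: l_def) linarith
  hence l: "a \<le> real_of_int l * w" "real_of_int l * w < a + w" using w by (auto simp: field_simps)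
  have b: "(real_of_int l + 1) * w < b" using l ab by (simp add: algebra_simps)
  have "real_of_int (- (2 ^ i)) \<le> a / w" using ab w by (simp add: field_simps)
  hence "- (2 ^ i) \<le> l" unfolding l_def by (smt (verit) ceiling_mono ceiling_of_int)
  moreover have "(real_of_int l + 1) * w < 2 ^ i * w" using b ab w by linarith
  hence "real_of_int l + 1 < real_of_int (2 ^ i)" using w by simp
  hence "l < 2 ^ i" by linarith
  ultimately show ?thesis using l b by (intro bexI[of _ l]) auto
qed

text \<open>The additional one comes from rounding; after division by \<open>n\<close> it becomes the discretisation error \<open>1 / n\<close> of
  evaluating quantiles at multiples of \<open>1 / n\<close>.\<close>

lemma card_nat_between:
  assumes "0 \<le> y"
  shows "real (card {i\<in>{1..n}. real i \<le> z \<and> \<not> real i \<le> y}) \<le> max 0 (z - y) + 1"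
proof -
  have "{i\<in>{1..n}. real i \<le> z \<and> \<not> real i \<le> y} \<subseteq> {nat \<lfloor>y\<rfloor><..nat \<lfloor>z\<rfloor>}"
    using assms by (auto simp: le_nat_floor) (simp add: nat_less_iff floor_less_iff not_le)
  hence "card {i\<in>{1..n}. real i \<le> z \<and> \<not> real i \<le> y} \<le> nat \<lfloor>z\<rfloor> - nat \<lfloor>y\<rfloor>"
    using card_mono[of "{nat \<lfloor>y\<rfloor><..nat \<lfloor>z\<rfloor>}"] by fastforce
  hence "real (card {i\<in>{1..n}. real i \<le> z \<and> \<not> real i \<le> y}) \<le> real (nat \<lfloor>z\<rfloor> - nat \<lfloor>y\<rfloor>)" by simp
  also have "\<dots> \<le> max 0 (z - y) + 1" using assms by linarith
  finally show ?thesis .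
qed

text \<open>This is the step from distribution functions to the loss, and it is here that monotonicity enters.  A sequence that is described by \<open>a i \<le> s \<longleftrightarrow> i \<le> n F s\<close> is nondecreasing, and the indices
  with \<open>a i \<le> s\<close> and \<open>t < b i\<close> form the interval \<open>(n G t, n F s]\<close>.  Thus the number of indices that cross
  \<open>[s, t]\<close> is determined by the gap \<open>F s - G t\<close>.  Counting crossings of dyadic intervals bounds the
  \<open>p\<close>-th powers.\<close>

lemma monotone_rearrangement_loss:
  fixes a b :: "nat \<Rightarrow> real" and F G :: "real \<Rightarrow> real"
  assumes n: "n \<ge> 1" and V: "V > 0" and p: "p \<ge> 1"
    and a: "\<And>i s. i \<in> {1..n} \<Longrightarrow> a i \<le> s \<longleftrightarrow> real i \<le> real n * F s"
    and b: "\<And>i s. i \<in> {1..n} \<Longrightarrow> b i \<le> s \<longleftrightarrow> real i \<le> real n * G s"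
    and FG: "\<And>s. F s \<ge> 0" "\<And>s. G s \<ge> 0"
    and bd: "\<And>i. i \<in> {1..n} \<Longrightarrow> \<bar>a i\<bar> \<le> V" "\<And>i. i \<in> {1..n} \<Longrightarrow> \<bar>b i\<bar> \<le> V"
  shows "(1 / real n) * (\<Sum>i=1..n. \<bar>a i - b i\<bar> powr p) \<le> (4 * (V / 2 ^ J)) powr p +
    (\<Sum>k\<le>J. (4 * (V / 2 ^ k)) powr p *
      (dyadic_gap V k F G + dyadic_gap V k G F + 4 * 2 ^ k / real n))"
proof -
  define L where "L = (\<lambda>k::nat. {- (2 ^ k)..<2 ^ k :: int})"
  have fL: "finite (L k)" for k by (simp add: L_def)
  define crossings where "crossings = (\<lambda>k (x :: nat \<Rightarrow> real) y (i :: nat). \<Sum>l\<in>L k.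
    if x i \<le> real_of_int l * (V / 2 ^ k) \<and> (real_of_int l + 1) * (V / 2 ^ k) < y i then 1 else (0::real))"
  have cross: "(\<Sum>i=1..n. if x i \<le> s \<and> t < y i then 1 else 0) / real n \<le> max 0 (X s - Y t) + 1 / real n"
    if x: "\<And>i s. i \<in> {1..n} \<Longrightarrow> x i \<le> s \<longleftrightarrow> real i \<le> real n * X s"
    and y: "\<And>i s. i \<in> {1..n} \<Longrightarrow> y i \<le> s \<longleftrightarrow> real i \<le> real n * Y s" and Y: "\<And>s. Y s \<ge> 0"
    for x y :: "nat \<Rightarrow> real" and X Y s t
  proof -
    have "(\<Sum>i=1..n. if x i \<le> s \<and> t < y i then 1 else (0::real))
        = real (card {i\<in>{1..n}. x i \<le> s \<and> t < y i})"
      by (simp add: sum.If_cases Int_def)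
    also have "{i\<in>{1..n}. x i \<le> s \<and> t < y i} = {i\<in>{1..n}. real i \<le> real n * X s \<and> \<not> real i \<le> real n * Y t}"
      using x y by (auto simp: not_le[symmetric])
    also have "real (card \<dots>) \<le> max 0 (real n * X s - real n * Y t) + 1"
      using Y[of t] by (intro card_nat_between) simp
    finally have "(\<Sum>i=1..n. if x i \<le> s \<and> t < y i then 1 else (0::real)) / real n
      \<le> (max 0 (real n * X s - real n * Y t) + 1) / real n" by (intro divide_right_mono) auto
    also have "\<dots> = max 0 (X s - Y t) + 1 / real n"
      using n by (simp add: max_def field_simps mult_le_cancel_left)
    finally show ?thesis .
  qed
  have pt: "\<bar>a i - b i\<bar> powr p \<le> (4 * (V / 2 ^ J)) powr p + (\<Sum>k\<le>J. (4 * (V / 2 ^ k)) powr p *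
      (crossings k a b i + crossings k b a i))"
    if i: "i \<in> {1..n}" for i
  proof -
    have ind: "(if 2 * (V / 2 ^ k) \<le> \<bar>a i - b i\<bar> then 1 else 0) \<le>
      (crossings k a b i + crossings k b a i)"
 for k
    proof -
      have S0: "crossings k x y i \<ge> 0" for x y :: "nat \<Rightarrow> real" unfolding crossings_def by (intro sum_nonneg) auto
      have S1: "crossings k x y i \<ge> 1" if xy: "\<bar>x i\<bar> \<le> V" "\<bar>y i\<bar> \<le> V" "2 * (V / 2 ^ k) \<le> y i - x i" for x y :: "nat \<Rightarrow> real"
      proof -
        have "- V \<le> x i" "y i \<le> V" using xy by linarith+
        then obtain l where l: "l \<in> L k" "x i \<le> real_of_int l * (V / 2 ^ k) \<and> (real_of_int l + 1) * (V / 2 ^ k) < y i"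
          using grid_interval_between[OF V _ _ xy(3)] unfolding L_def by blast
        have "1 = (if x i \<le> real_of_int l * (V / 2 ^ k) \<and> (real_of_int l + 1) * (V / 2 ^ k) < y i then 1 else (0::real))"
          using l by simp
        also have "\<dots> \<le> crossings k x y i" unfolding crossings_def by (rule member_le_sum[OF l(1)]) (auto simp: fL)
        finally show ?thesis .
      qed
      show ?thesis
        using S0[of a b] S0[of b a] S1[of a b] S1[of b a] bd(1)[OF i] bd(2)[OF i] by (auto simp: abs_if split: if_splits)
    qed
    have "\<bar>a i - b i\<bar> powr p \<le> (4 * (V / 2 ^ J)) powr p +
        (\<Sum>k\<le>J. (4 * (V / 2 ^ k)) powr p * (if 2 * (V / 2 ^ k) \<le> \<bar>a i - b i\<bar> then 1 else 0))"
      using bd(1)[OF i] bd(2)[OF i] V p by (intro powr_le_dyadic_sum) auto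
    also have "\<dots> \<le> (4 * (V / 2 ^ J)) powr p + (\<Sum>k\<le>J. (4 * (V / 2 ^ k)) powr p *
      (crossings k a b i + crossings k b a i))"
      by (intro add_left_mono sum_mono mult_left_mono ind) auto
    finally show ?thesis .
  qed
  have swap: "(1 / real n) * (\<Sum>i=1..n. crossings k x y i) \<le> dyadic_gap V k X Y + 2 * 2 ^ k / real n"
    if x: "\<And>i s. i \<in> {1..n} \<Longrightarrow> x i \<le> s \<longleftrightarrow> real i \<le> real n * X s"
    and y: "\<And>i s. i \<in> {1..n} \<Longrightarrow> y i \<le> s \<longleftrightarrow> real i \<le> real n * Y s" and Y: "\<And>s. Y s \<ge> 0"
    for x y :: "nat \<Rightarrow> real" and X Y k
  proof -
    define w where "w = V / 2 ^ k"
    have "(1 / real n) * (\<Sum>i=1..n. crossings k x y i)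
       = (\<Sum>l\<in>L k. (\<Sum>i=1..n. if x i \<le> real_of_int l * w \<and> (real_of_int l + 1) * w < y i then 1 else 0) / real n)"
      unfolding crossings_def w_def by (subst sum.swap) (simp add: sum_divide_distrib)
    also have "\<dots> \<le> (\<Sum>l\<in>L k. max 0 (X (real_of_int l * w) - Y ((real_of_int l + 1) * w)) + 1 / real n)"
      by (intro sum_mono cross x y Y)
    also have "\<dots> = dyadic_gap V k X Y + 2 * 2 ^ k / real n"
      by (simp add: sum.distrib L_def dyadic_gap_def w_def)
    finally show ?thesis .
  qed
  define A where "A = (\<lambda>k. \<Sum>i=1..n. crossings k a b i)"
  define B where "B = (\<lambda>k. \<Sum>i=1..n. crossings k b a i)"
  have "(\<Sum>i=1..n. \<bar>a i - b i\<bar> powr p) \<le> (\<Sum>i=1..n. (4 * (V / 2 ^ J)) powr p +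
      (\<Sum>k\<le>J. (4 * (V / 2 ^ k)) powr p * (crossings k a b i + crossings k b a i)))"
    by (intro sum_mono pt)
  also have "\<dots> = real n * (4 * (V / 2 ^ J)) powr p + (\<Sum>k\<le>J. (4 * (V / 2 ^ k)) powr p * (A k + B k))"
    unfolding A_def B_def
    by (subst sum.distrib, subst sum.swap) (simp add: sum.distrib sum_distrib_left[symmetric])
  finally have "(1 / real n) * (\<Sum>i=1..n. \<bar>a i - b i\<bar> powr p)
     \<le> (1 / real n) * (real n * (4 * (V / 2 ^ J)) powr p + (\<Sum>k\<le>J. (4 * (V / 2 ^ k)) powr p * (A k + B k)))"
    by (intro mult_left_mono) auto
  also have "\<dots> = (4 * (V / 2 ^ J)) powr p + (\<Sum>k\<le>J. (4 * (V / 2 ^ k)) powr p * ((1 / real n) * A k + (1 / real n) * B k))"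
    using n by (simp add: distrib_left sum_distrib_left sum_divide_distrib field_simps)
  also have "\<dots> \<le> (4 * (V / 2 ^ J)) powr p + (\<Sum>k\<le>J. (4 * (V / 2 ^ k)) powr p *
      ((dyadic_gap V k F G + 2 * 2 ^ k / real n) + (dyadic_gap V k G F + 2 * 2 ^ k / real n)))"
    unfolding A_def B_def
    by (intro add_left_mono sum_mono mult_left_mono add_mono swap a b FG) auto
  finally show ?thesis by (simp add: add_ac)
qed

definition empirical_cdf :: "nat \<Rightarrow> (nat \<Rightarrow> real) \<Rightarrow> real \<Rightarrow> real" where
  "empirical_cdf n y z = real (card {i\<in>{1..n}. y i \<le> z}) / real n"

lemma sorted_le_iff_count:
  fixes a :: "nat \<Rightarrow> real"
  assumes "mono_on {1..n} a" "i \<in> {1..n}"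
  shows "a i \<le> s \<longleftrightarrow> i \<le> card {j\<in>{1..n}. a j \<le> s}"
proof
  assume "a i \<le> s"
  hence "{1..i} \<subseteq> {j\<in>{1..n}. a j \<le> s}"
    using assms by (auto simp: mono_on_def) (metis order_trans)
  thus "i \<le> card {j\<in>{1..n}. a j \<le> s}" using card_mono[of "{j\<in>{1..n}. a j \<le> s}" "{1..i}"] by simp
next
  assume i: "i \<le> card {j\<in>{1..n}. a j \<le> s}"
  show "a i \<le> s"
  proof (rule ccontr)
    assume "\<not> a i \<le> s"
    hence "{j\<in>{1..n}. a j \<le> s} \<subseteq> {1..<i}"
      using assms by (auto simp: mono_on_def) (metis linorder_not_le order_trans)
    hence "card {j\<in>{1..n}. a j \<le> s} \<le> i - 1" using card_mono[of "{1..<i}"] by fastforce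
    thus False using i assms by auto
  qed
qed

lemma quantile_le_iff:
  assumes \<nu>: "real_distribution \<nu>" "AE x in \<nu>. \<bar>x\<bar> \<le> V" and t: "0 < t" "t \<le> 1"
  shows "quantile \<nu> t \<le> z \<longleftrightarrow> t \<le> cdf \<nu> z"
proof -
  interpret real_distribution \<nu> by fact
  let ?F = "{x. t \<le> cdf \<nu> x}"
  have "cdf \<nu> V = 1" unfolding cdf_def
    using \<nu>(2) by (subst prob_eq_1) (auto elim!: eventually_mono)
  hence "V \<in> ?F" using t by simp
  hence ne: "?F \<noteq> {}" by blast
  have low: "cdf \<nu> x = 0" if "x < - V" for x
    unfolding cdf_def using \<nu>(2) that by (subst prob_eq_0) (auto elim!: eventually_mono)
  have bdd: "bdd_below ?F"
    by (rule bdd_belowI[of _ "- V"]) (use low t in \<open>force simp: not_less[symmetric]\<close>)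
  show ?thesis
  proof
    assume *: "quantile \<nu> t \<le> z"
    have "t \<le> (INF s\<in>?F. cdf \<nu> s)" by (rule cINF_greatest[OF ne]) auto
    also have "\<dots> = cdf \<nu> (quantile \<nu> t)"
      unfolding quantile_def
      using continuous_at_Inf_mono[of "cdf \<nu>", OF _ cdf_is_right_cont ne bdd] cdf_nondecreasing by (auto simp: mono_def)
    also have "\<dots> \<le> cdf \<nu> z" using * by (rule cdf_nondecreasing)
    finally show "t \<le> cdf \<nu> z" .
  qed (auto simp: quantile_def intro!: cInf_lower bdd)
qed

lemma abs_quantile_le:
  assumes \<nu>: "real_distribution \<nu>" "AE x in \<nu>. \<bar>x\<bar> \<le> V" and t: "0 < t" "t \<le> 1"
  shows "\<bar>quantile \<nu> t\<bar> \<le> V"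
proof -
  interpret real_distribution \<nu> by fact
  have "cdf \<nu> V = 1" unfolding cdf_def
    using \<nu>(2) by (subst prob_eq_1) (auto elim!: eventually_mono)
  have "\<not> quantile \<nu> t \<le> x" if "x < - V" for x
  proof -
    have "cdf \<nu> x = 0" 
      unfolding cdf_def using \<nu>(2) that by (subst prob_eq_0) (auto elim!: eventually_mono)
    thus ?thesis using t by (simp add: quantile_le_iff[OF \<nu> t])
  qed
  hence "- V \<le> quantile \<nu> t" by (meson order_refl not_le)
  moreover have "quantile \<nu> t \<le> V"
    using t \<open>cdf \<nu> V = 1\<close> by (simp add: quantile_le_iff[OF \<nu> t])
  ultimately show ?thesis by simp
qed

section \<open>From characteristic functions to the loss\<close>

text \<open>The degree is chosen so that the tails at scale \<open>V / 2 ^ k\<close> contribute \<open>(2 ^ k / (2 * 2 ^ J)) ^ q\<close>.  Multiplied by the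
  weight \<open>(4 V / 2 ^ k) powr p\<close> of that scale this is at most \<open>(4 V / 2 ^ J) powr p\<close> times \<open>2 ^ (- (J - k))\<close>,
  because \<open>q \<ge> p + 1\<close>: the sum over scales is geometric and the finest scale dominates.\<close>

lemma isotonic_loss_le:
  fixes a b :: "nat \<Rightarrow> real" and \<mu> \<nu> :: "real measure" and J r n :: nat and p V h \<epsilon> :: real
  defines "m \<equiv> 64 * 2 ^ J" and "d \<equiv> 4 * (64 * 2 ^ J) * r + 1"
  assumes n: "n \<ge> 1" and a: "mono_on {1..n} a" "\<And>i. i \<in> {1..n} \<Longrightarrow> \<bar>a i\<bar> \<le> V"
    and \<mu>: "real_distribution \<mu>" "AE x in \<mu>. \<bar>x\<bar> \<le> V"
      "\<And>s. cdf \<mu> s = empirical_cdf n a s"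
    and \<nu>: "real_distribution \<nu>" "AE x in \<nu>. \<bar>x\<bar> \<le> V"
    and b: "\<And>i. i \<in> {1..n} \<Longrightarrow> b i = quantile \<nu> (real i / real n)"
    and V: "V > 0" and h: "h > 0" "h * V \<le> 1" and p: "p \<ge> 1" and r: "real r \<ge> p / 2 + 1"
    and close: "\<And>t. \<bar>t\<bar> \<le> h * real d \<Longrightarrow> cmod (char \<mu> t - char \<nu> t) \<le> \<epsilon>"
  shows "(1 / real n) * (\<Sum>i=1..n. \<bar>a i - b i\<bar> powr p) \<le> 5 * (4 * (V / 2 ^ J)) powr p
    + (4 * V) powr p * 2 ^ (J + 3) *
      (2 * 7 ^ (2 * m * r) * (1 / 2 + 1 / (2 * h * V)) ^ d * \<epsilon> + 1 / real n)"
proof -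
  interpret \<mu>: real_distribution \<mu> by fact
  interpret \<nu>: real_distribution \<nu> by fact
  define q where "q = 2 * r - 1"
  have r2: "r \<ge> 2" using r p by linarith
  have q: "real q \<ge> p + 1" "q \<ge> 2" using r r2 by (auto simp: q_def of_nat_diff)
  define N where "N = real (2 * m + 1)"
  define E where "E = 2 * 7 ^ (2 * m * r) * (1 / 2 + 1 / (2 * h * V)) ^ d * \<epsilon>"
  have m: "real m = 64 * 2 ^ J" by (simp add: m_def)
  have N: "N \<ge> 128 * 2 ^ J" "N \<ge> 8"
  proof -
    have "(1::real) \<le> 2 ^ J" by simp
    moreover have "N = 128 * 2 ^ J + 1" by (simp add: N_def m)
    ultimately show "N \<ge> 128 * 2 ^ J" "N \<ge> 8" by linarith+
  qed
  have E0: "E \<ge> 0"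
  proof -
    have "\<epsilon> \<ge> 0" using close[of 0] h by (simp add: order_trans[OF norm_ge_zero])
    thus ?thesis using h V by (simp add: E_def)
  qed
  have gap: "dyadic_gap V k (cdf M) (cdf M') \<le> 4 * (2 ^ k / (2 * 2 ^ J)) ^ q + 2 * 2 ^ k * E"
    if M: "real_distribution M" "AE x in M. \<bar>x\<bar> \<le> V" and M': "real_distribution M'" "AE x in M'. \<bar>x\<bar> \<le> V"
      and cl: "\<And>t. \<bar>t\<bar> \<le> h * real d \<Longrightarrow> cmod (char M t - char M' t) \<le> \<epsilon>" for M M' k
  proof -
    have "dyadic_gap V k (cdf M) (cdf M')
      \<le> 4 * (64 * 2 ^ k / N) ^ q + 4 * 2 ^ k * 7 ^ (2 * m * r) * (1 / 2 + 1 / (2 * h * V)) ^ d * \<epsilon>"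
      unfolding N_def q_def d_def m_def
      by (rule dyadic_gap_cdf_le[OF M M' V h _ r2]) (use cl N in \<open>simp_all add: d_def N_def m_def\<close>)
    also have "64 * 2 ^ k / N \<le> 64 * 2 ^ k / (128 * 2 ^ J)"
      using N by (intro divide_left_mono mult_pos_pos) auto
    hence "(64 * 2 ^ k / N) ^ q \<le> (2 ^ k / (2 * 2 ^ J)) ^ q"
      using N by (intro power_mono) auto
    finally show ?thesis by (simp add: E_def algebra_simps)
  qed
  have "(1 / real n) * (\<Sum>i=1..n. \<bar>a i - b i\<bar> powr p) \<le> (4 * (V / 2 ^ J)) powr p +
    (\<Sum>k\<le>J. (4 * (V / 2 ^ k)) powr p *
      (dyadic_gap V k (cdf \<mu>) (cdf \<nu>) + dyadic_gap V k (cdf \<nu>) (cdf \<mu>) + 4 * 2 ^ k / real n))"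
  proof (rule monotone_rearrangement_loss[OF n V p])
    show "a i \<le> s \<longleftrightarrow> real i \<le> real n * cdf \<mu> s" if "i \<in> {1..n}" for i s
      using sorted_le_iff_count[OF a(1) that] n by (simp add: \<mu>(3) empirical_cdf_def)
    show "b i \<le> s \<longleftrightarrow> real i \<le> real n * cdf \<nu> s" if "i \<in> {1..n}" for i s
      using quantile_le_iff[OF \<nu>, of "real i / real n" s] that n by (simp add: b field_simps)
    show "\<bar>b i\<bar> \<le> V" if "i \<in> {1..n}" for i
      using abs_quantile_le[OF \<nu>, of "real i / real n"] that n by (simp add: b)
  qed (auto simp: \<mu>.cdf_nonneg \<nu>.cdf_nonneg a)
  also have "\<dots> \<le> (4 * (V / 2 ^ J)) powr p + (\<Sum>k\<le>J. (4 * (V / 2 ^ k)) powr p *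
     ((4 * (2 ^ k / (2 * 2 ^ J)) ^ q + 2 * 2 ^ k * E) + (4 * (2 ^ k / (2 * 2 ^ J)) ^ q + 2 * 2 ^ k * E) + 4 * 2 ^ k / real n))"
    using close
    by (intro add_mono sum_mono mult_left_mono gap \<mu> \<nu> order_refl) (auto simp: norm_minus_commute)
  also have "\<dots> = (4 * (V / 2 ^ J)) powr p + 8 * (\<Sum>k\<le>J. (4 * (V / 2 ^ k)) powr p * (2 ^ k / (2 * 2 ^ J)) ^ q)
      + 4 * (E + 1 / real n) * (\<Sum>k\<le>J. (4 * (V / 2 ^ k)) powr p * 2 ^ k)"
    by (simp add: algebra_simps sum.distrib sum_distrib_left sum_divide_distrib)
  also have "\<dots> \<le> (4 * (V / 2 ^ J)) powr p + 8 * ((4 * (V / 2 ^ J)) powr p / 2) + 4 * (E + 1 / real n) * ((4 * V) powr p * 2 ^ (J + 1))"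
  proof (intro add_mono mult_left_mono order_refl)
    have "(4 * (V / 2 ^ k)) powr p * (2 ^ k / (2 * 2 ^ J)) ^ q \<le> (4 * (V / 2 ^ J)) powr p * ((1 / 2) ^ 2 * (1 / 2) ^ (J - k))"
      if k: "k \<le> J" for k
    proof -
      define e where "e = J - k"
      have J: "J = k + e" using k by (simp add: e_def)
      have "4 * (V / 2 ^ k) = 4 * (V / 2 ^ J) * 2 ^ e" by (simp add: J power_add)
      hence "(4 * (V / 2 ^ k)) powr p = (4 * (V / 2 ^ J)) powr p * (2 ^ e) powr p"
        by (simp only: powr_mult)
      moreover have "(2 ^ k / (2 * 2 ^ J)) ^ q = (1 / 2) ^ q * (1 / 2 ^ e :: real) ^ q"
        by (simp add: J power_add flip: power_mult_distrib)
      moreover have "(2 ^ e :: real) powr p * ((1 / 2) ^ q * (1 / 2 ^ e) ^ q) \<le> (1 / 2) ^ 2 * (1 / 2) ^ e"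
      proof -
        have "(2 ^ e) powr p * (1 / 2 ^ e) ^ q = (2 ^ e) powr (p - real q)"
          by (simp add: powr_diff powr_realpow power_divide)
        also have "\<dots> \<le> (2 ^ e) powr (- 1 :: real)"
          using q one_le_power[of "2::real" e] by (intro powr_mono) auto
        also have "\<dots> = (1 / 2) ^ e" by (simp add: powr_minus power_divide field_simps)
        finally have 1: "(2 ^ e) powr p * (1 / 2 ^ e) ^ q \<le> (1 / 2 :: real) ^ e" .
        have 2: "(1 / 2 :: real) ^ q \<le> (1 / 2) ^ 2" using q by (intro power_decreasing) auto
        have "(1 / 2 :: real) ^ q * ((2 ^ e) powr p * (1 / 2 ^ e) ^ q) \<le> (1 / 2) ^ 2 * (1 / 2) ^ e"
          by (rule mult_mono[OF 2 1]) auto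
        thus ?thesis by (simp add: mult_ac)
      qed
      ultimately show ?thesis
        using mult_left_mono[of _ _ "(4 * (V / 2 ^ J)) powr p"] by (simp add: e_def mult.assoc)
    qed
    hence "(\<Sum>k\<le>J. (4 * (V / 2 ^ k)) powr p * (2 ^ k / (2 * 2 ^ J)) ^ q)
      \<le> (\<Sum>k\<le>J. (4 * (V / 2 ^ J)) powr p * ((1 / 2) ^ 2 * (1 / 2) ^ (J - k)))"
      by (intro sum_mono) auto
    also have "\<dots> = (4 * (V / 2 ^ J)) powr p * (1 / 4 * (\<Sum>k\<le>J. (1 / 2) ^ (J - k)))"
      by (simp add: sum_distrib_left power2_eq_square)
    also have "(\<Sum>k\<le>J. (1 / 2 :: real) ^ (J - k)) = (\<Sum>k\<le>J. (1 / 2) ^ k)"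
      by (simp only: atMost_atLeast0 sum.nat_diff_reindex) (rule sum.atLeastAtMost_rev[of "\<lambda>k. (1 / 2 :: real) ^ (J - k)" 0 J, simplified])
    also have "\<dots> \<le> 2"
      by (subst sum_gp0) (simp add: power_one_over)
    finally show "(\<Sum>k\<le>J. (4 * (V / 2 ^ k)) powr p * (2 ^ k / (2 * 2 ^ J)) ^ q) \<le> (4 * (V / 2 ^ J)) powr p / 2"
      by (simp add: mult_left_mono)
    have "(\<Sum>k\<le>J. (4 * (V / 2 ^ k)) powr p * 2 ^ k) \<le> (\<Sum>k\<le>J. (4 * V) powr p * 2 ^ k)"
    proof (intro sum_mono mult_right_mono powr_mono2)
      fix k
      have "V / 2 ^ k \<le> V / 1" using V by (intro divide_left_mono) auto
      thus "4 * (V / 2 ^ k) \<le> 4 * V" by simp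
    qed (use p V in auto)
    also have "\<dots> = (4 * V) powr p * (\<Sum>k\<le>J. 2 ^ k)" by (simp add: sum_distrib_left)
    also have "(\<Sum>k\<le>J. 2 ^ k :: real) \<le> 2 ^ (J + 1)"
      by (subst sum_gp0) simp
    finally show "(\<Sum>k\<le>J. (4 * (V / 2 ^ k)) powr p * 2 ^ k) \<le> (4 * V) powr p * 2 ^ (J + 1)"
      by (simp add: mult_left_mono)
  qed (use E0 in auto)
  finally show ?thesis by (simp add: E_def algebra_simps power_add)
qed

section \<open>Wasserstein distance, empirical measures and convolutions\<close>

lemma iexp_diff_le: "cmod (iexp a - iexp b) \<le> \<bar>a - b\<bar>"
proof -
  have "iexp a - iexp b = iexp b * (iexp (a - b) - 1)"
  proof -
    have "iexp b * iexp (a - b) = iexp a"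
      by (simp only: exp_add[symmetric]) (simp add: algebra_simps)
    thus ?thesis by (simp add: right_diff_distrib)
  qed
  hence "cmod (iexp a - iexp b) = cmod (iexp (a - b) - 1)"
    by (simp add: norm_mult)
  also have "\<dots> \<le> \<bar>a - b\<bar>" using iexp_approx1[of "a - b" 0] by simp
  finally show ?thesis .
qed

lemma iexp_diff_le_2: "cmod (iexp a - iexp b) \<le> 2"
  using norm_triangle_ineq4[of "iexp a" "iexp b"] by simp

text \<open>Characters are Lipschitz, and a first moment under a coupling is bounded by the second via
  \<open>\<bar>u\<bar> \<le> b / 2 + u\<^sup>2 / (2 b)\<close> with \<open>b = sqrt e\<close>.  The strict inequality
  provides a coupling of cost below \<open>e\<close>.\<close>

lemma char_diff_le_wasserstein:
  assumes \<alpha>: "real_distribution \<alpha>" and e: "e > 0" "wasserstein2_sq \<alpha> \<beta> < ennreal e"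
  shows "cmod (char \<alpha> t - char \<beta> t) \<le> \<bar>t\<bar> * sqrt e"
proof -
  obtain \<gamma> where \<gamma>: "\<gamma> \<in> couplings \<alpha> \<beta>" "(\<integral>\<^sup>+ z. ennreal (\<bar>fst z - snd z\<bar>\<^sup>2) \<partial>\<gamma>) < ennreal e"
    using e(2) unfolding wasserstein2_sq_def INF_less_iff by blast
  have [measurable_cong]: "sets \<gamma> = sets (borel \<Otimes>\<^sub>M borel)"
    and d: "distr \<gamma> borel fst = \<alpha>" "distr \<gamma> borel snd = \<beta>"
    using \<gamma>(1) by (auto simp: couplings_def)
  interpret \<alpha>: real_distribution \<alpha> by fact
  have f: "fst \<in> \<gamma> \<rightarrow>\<^sub>M borel" by measurable
  interpret \<gamma>: prob_space \<gamma>
    using \<alpha>.prob_space_axioms prob_space_distrD[OF f] d(1) by simp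
  define b where "b = sqrt e"
  have b: "b > 0" "b * b = e" using e(1) by (auto simp: b_def)
  define D where "D = (\<lambda>z::real\<times>real. (fst z - snd z)\<^sup>2)"
  have Dm [measurable]: "D \<in> borel_measurable \<gamma>" unfolding D_def by measurable
  have nn: "(\<integral>\<^sup>+ z. ennreal (D z) \<partial>\<gamma>) < ennreal e" using \<gamma>(2) by (simp add: D_def)
  have Di: "integrable \<gamma> D"
    using nn by (intro integrableI_nonneg) (auto simp: D_def intro: less_trans[OF _ ennreal_less_top])
  have Dle: "(\<integral>z. D z \<partial>\<gamma>) \<le> e"
  proof -
    have "ennreal (\<integral>z. D z \<partial>\<gamma>) = (\<integral>\<^sup>+ z. ennreal (D z) \<partial>\<gamma>)"
      by (rule nn_integral_eq_integral[symmetric, OF Di]) (simp add: D_def)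
    thus ?thesis using nn e(1) by (metis ennreal_less_iff integral_nonneg_AE AE_I2 D_def zero_le_power2 less_imp_le)
  qed
  have i: "integrable \<gamma> (\<lambda>z. iexp (t * fst z))" "integrable \<gamma> (\<lambda>z. iexp (t * snd z))"
    by (auto intro!: \<gamma>.integrable_iexp)
  have "char \<alpha> t - char \<beta> t = (CLINT z|\<gamma>. iexp (t * fst z)) - (CLINT z|\<gamma>. iexp (t * snd z))"
    unfolding char_def d[symmetric] by (subst (1 2) integral_distr) auto
  also have "\<dots> = (CLINT z|\<gamma>. iexp (t * fst z) - iexp (t * snd z))"
    using i by simp
  also have "cmod \<dots> \<le> (\<integral>z. \<bar>t\<bar> * (b / 2 + D z / (2 * b)) \<partial>\<gamma>)"
  proof (rule Bochner_Integration.integral_norm_bound_integral)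
    fix z
    have "0 \<le> (\<bar>fst z - snd z\<bar> - b)\<^sup>2" by simp
    hence "2 * b * \<bar>fst z - snd z\<bar> \<le> b * b + D z"
      by (simp add: D_def power2_eq_square algebra_simps abs_mult_self_eq)
    hence "\<bar>fst z - snd z\<bar> \<le> b / 2 + D z / (2 * b)" using b by (simp add: field_simps)
    moreover have "cmod (iexp (t * fst z) - iexp (t * snd z)) \<le> \<bar>t\<bar> * \<bar>fst z - snd z\<bar>"
      using iexp_diff_le[of "t * fst z" "t * snd z"] by (simp only: right_diff_distrib[symmetric] abs_mult)
    ultimately show "cmod (iexp (t * fst z) - iexp (t * snd z)) \<le> \<bar>t\<bar> * (b / 2 + D z / (2 * b))"
      by (meson mult_left_mono abs_ge_zero order_trans)
  qed (use i Di in auto)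
  also have "\<dots> = \<bar>t\<bar> * (b / 2 + (\<integral>z. D z \<partial>\<gamma>) / (2 * b))"
    using Di by (simp add: \<gamma>.prob_space)
  also have "\<dots> \<le> \<bar>t\<bar> * (b / 2 + e / (2 * b))"
    using Dle b by (intro mult_left_mono add_left_mono divide_right_mono) auto
  also have "b / 2 + e / (2 * b) = b" using b by (simp add: b(2)[symmetric])
  finally show ?thesis by (simp add: b_def)
qed

definition cdf_distance :: "real \<Rightarrow> (real \<Rightarrow> real) \<Rightarrow> (real \<Rightarrow> real) \<Rightarrow> ennreal" where
  "cdf_distance R F G = (\<integral>\<^sup>+ z. ennreal \<bar>F z - G z\<bar> * indicator {-R..R} z \<partial>lborel)"

text \<open>Use the quantile coupling: both quantile functions are evaluated at the same uniform variable \<open>u\<close>.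
  On \<open>[-R, R]\<close> the quadratic cost is at most \<open>2 R\<close> times the linear one, and the linear cost of this coupling is
  the area between the two graphs, which can be computed along either axis.\<close>

lemma wasserstein_le_cdf_distance:
  assumes \<alpha>: "real_distribution \<alpha>" "AE x in \<alpha>. \<bar>x\<bar> \<le> R" and \<beta>: "real_distribution \<beta>" "AE x in \<beta>. \<bar>x\<bar> \<le> R"
    and R: "R \<ge> 0"
  shows "wasserstein2_sq \<alpha> \<beta> \<le> ennreal (2 * R) *
    cdf_distance R (cdf \<alpha>) (cdf \<beta>)"
proof -
  interpret \<alpha>: cdf_distribution \<alpha> using \<alpha>(1) by (simp add: cdf_distribution_def)
  interpret \<beta>: cdf_distribution \<beta> using \<beta>(1) by (simp add: cdf_distribution_def)
  define \<Omega> where "\<Omega> = restrict_space lborel {0<..<1::real}"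
  have [measurable]: "\<alpha>.I \<in> \<Omega> \<rightarrow>\<^sub>M borel" "\<beta>.I \<in> \<Omega> \<rightarrow>\<^sub>M borel"
    using \<alpha>.measurable_CI \<beta>.measurable_CI unfolding \<Omega>_def
    by (simp_all cong: measurable_cong_sets sets_restrict_space_cong)
  define \<gamma> where "\<gamma> = distr \<Omega> (borel \<Otimes>\<^sub>M borel) (\<lambda>u. (\<alpha>.I u, \<beta>.I u))"
  have bound: "\<bar>Inf {x. u \<le> cdf M x}\<bar> \<le> R" if "cdf_distribution M" "AE x in M. \<bar>x\<bar> \<le> R" "0 < u" "u < 1" for M u
  proof -
    interpret M: cdf_distribution M by fact
    have "cdf M R = 1" unfolding cdf_def
      using that(2) by (subst M.prob_eq_1) (auto elim!: eventually_mono)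
    hence 1: "M.I u \<le> R" using that by (simp add: M.pseudoinverse[symmetric])
    have "\<not> M.I u \<le> x" if "x < - R" for x
    proof -
      have "cdf M x = 0"
        unfolding cdf_def using \<open>AE x in M. \<bar>x\<bar> \<le> R\<close> that by (subst M.prob_eq_0) (auto elim!: eventually_mono)
      thus ?thesis using \<open>0 < u\<close> \<open>u < 1\<close> by (simp add: M.pseudoinverse[symmetric])
    qed
    hence "- R \<le> M.I u" by (meson order_refl not_le)
    with 1 show ?thesis by simp
  qed
  have "\<gamma> \<in> couplings \<alpha> \<beta>"
    using \<alpha>.distr_I_eq_M \<beta>.distr_I_eq_M
    by (simp add: couplings_def \<gamma>_def distr_distr comp_def \<Omega>_def[symmetric])
  hence "wasserstein2_sq \<alpha> \<beta> \<le> (\<integral>\<^sup>+ z. ennreal (\<bar>fst z - snd z\<bar>\<^sup>2) \<partial>\<gamma>)"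
    unfolding wasserstein2_sq_def by (rule INF_lower)
  also have "\<dots> = (\<integral>\<^sup>+ u. ennreal (\<bar>\<alpha>.I u - \<beta>.I u\<bar>\<^sup>2) \<partial>\<Omega>)"
    unfolding \<gamma>_def by (subst nn_integral_distr) auto
  also have "\<dots> \<le> (\<integral>\<^sup>+ u. ennreal (2 * R) * (\<integral>\<^sup>+ z. indicator {-R..R} z *
      indicator {(u, z). (u \<le> cdf \<alpha> z) \<noteq> (u \<le> cdf \<beta> z)} (u, z) \<partial>lborel) \<partial>\<Omega>)"
  proof (rule nn_integral_mono)
    fix u assume "u \<in> space \<Omega>"
    hence u: "0 < u" "u < 1" by (auto simp: \<Omega>_def space_restrict_space)
    have b: "\<bar>\<alpha>.I u\<bar> \<le> R" "\<bar>\<beta>.I u\<bar> \<le> R"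
      using bound[OF \<alpha>.cdf_distribution_axioms \<alpha>(2) u] bound[OF \<beta>.cdf_distribution_axioms \<beta>(2) u] by auto
    have pt: "indicator {-R..R} z * indicator {(u, z). (u \<le> cdf \<alpha> z) \<noteq> (u \<le> cdf \<beta> z)} (u, z)
      = (indicator {min A B..<max A B} z :: ennreal)"
      if "u \<le> cdf \<alpha> z \<longleftrightarrow> A \<le> z" "u \<le> cdf \<beta> z \<longleftrightarrow> B \<le> z" "\<bar>A\<bar> \<le> R" "\<bar>B\<bar> \<le> R" for A B z
    proof -
      have "(z \<in> {-R..R} \<and> (u \<le> cdf \<alpha> z) \<noteq> (u \<le> cdf \<beta> z)) \<longleftrightarrow> z \<in> {min A B..<max A B}"
        unfolding that(1,2) using that(3,4) by (simp add: min_def max_def) linarith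
      thus ?thesis by (simp add: indicator_def) blast
    qed
    have "(\<integral>\<^sup>+ z. indicator {-R..R} z * indicator {(u, z). (u \<le> cdf \<alpha> z) \<noteq> (u \<le> cdf \<beta> z)} (u, z) \<partial>lborel)
      = (\<integral>\<^sup>+ z. indicator {min (\<alpha>.I u) (\<beta>.I u)..<max (\<alpha>.I u) (\<beta>.I u)} z \<partial>lborel)"
      by (rule nn_integral_cong, rule pt[OF \<alpha>.pseudoinverse[OF u] \<beta>.pseudoinverse[OF u] b])
    also have "\<dots> = ennreal \<bar>\<alpha>.I u - \<beta>.I u\<bar>"
      by (subst nn_integral_indicator, simp, subst emeasure_lborel_Ico)
         (auto simp: min_def max_def intro!: arg_cong[where f=ennreal])
    finally have eq: "(\<integral>\<^sup>+ z. indicator {-R..R} z * indicator {(u, z). (u \<le> cdf \<alpha> z) \<noteq> (u \<le> cdf \<beta> z)} (u, z) \<partial>lborel)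
      = ennreal \<bar>\<alpha>.I u - \<beta>.I u\<bar>" .
    have "\<bar>\<alpha>.I u - \<beta>.I u\<bar>\<^sup>2 \<le> 2 * R * \<bar>\<alpha>.I u - \<beta>.I u\<bar>"
      unfolding power2_eq_square using b by (intro mult_right_mono) auto
    thus "ennreal (\<bar>\<alpha>.I u - \<beta>.I u\<bar>\<^sup>2) \<le> ennreal (2 * R) * (\<integral>\<^sup>+ z. indicator {-R..R} z *
      indicator {(u, z). (u \<le> cdf \<alpha> z) \<noteq> (u \<le> cdf \<beta> z)} (u, z) \<partial>lborel)"
      unfolding eq using R by (simp add: ennreal_mult[symmetric] ennreal_leI)
  qed
  also have "\<dots> = ennreal (2 * R) * (\<integral>\<^sup>+ u. (\<integral>\<^sup>+ z. indicator {0<..<1} u * (indicator {-R..R} z *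
      indicator {(u, z). (u \<le> cdf \<alpha> z) \<noteq> (u \<le> cdf \<beta> z)} (u, z)) \<partial>lborel) \<partial>lborel)"
  proof -
    define H where "H = (\<lambda>u. \<integral>\<^sup>+ z. indicator {-R..R} z *
      indicator {(u, z). (u \<le> cdf \<alpha> z) \<noteq> (u \<le> cdf \<beta> z)} (u, z) \<partial>lborel)"
    have [measurable]: "H \<in> borel_measurable lborel" unfolding H_def by measurable
    have "(\<integral>\<^sup>+ u. ennreal (2 * R) * H u \<partial>\<Omega>) = (\<integral>\<^sup>+ u. ennreal (2 * R) * H u * indicator {0<..<1} u \<partial>lborel)"
      unfolding \<Omega>_def by (subst nn_integral_restrict_space) auto
    also have "\<dots> = (\<integral>\<^sup>+ u. ennreal (2 * R) * (indicator {0<..<1} u * H u) \<partial>lborel)"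
      by (simp only: mult_ac)
    also have "\<dots> = ennreal (2 * R) * (\<integral>\<^sup>+ u. indicator {0<..<1} u * H u \<partial>lborel)"
      by (rule nn_integral_cmult) measurable
    also have "(\<lambda>u. indicator {0<..<1} u * H u) = (\<lambda>u. \<integral>\<^sup>+ z. indicator {0<..<1} u * (indicator {-R..R} z *
      indicator {(u, z). (u \<le> cdf \<alpha> z) \<noteq> (u \<le> cdf \<beta> z)} (u, z)) \<partial>lborel)"
      unfolding H_def by (rule ext, rule nn_integral_cmult[symmetric]) measurable
    finally show ?thesis unfolding H_def .
  qed
  also have "(\<integral>\<^sup>+ u. (\<integral>\<^sup>+ z. indicator {0<..<1} u * (indicator {-R..R} z *
      indicator {(u, z). (u \<le> cdf \<alpha> z) \<noteq> (u \<le> cdf \<beta> z)} (u, z)) \<partial>lborel) \<partial>lborel)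
    = (\<integral>\<^sup>+ z. (\<integral>\<^sup>+ u. indicator {0<..<1} u * (indicator {-R..R} z *
      indicator {(u, z). (u \<le> cdf \<alpha> z) \<noteq> (u \<le> cdf \<beta> z)} (u, z)) \<partial>lborel) \<partial>lborel)"
    by (rule lborel_pair.Fubini') measurable
  also have "\<dots> \<le> (\<integral>\<^sup>+ z. ennreal \<bar>cdf \<alpha> z - cdf \<beta> z\<bar> * indicator {-R..R} z \<partial>lborel)"
  proof (rule nn_integral_mono)
    fix z :: real
    have "(\<integral>\<^sup>+ u. indicator {0<..<1} u * (indicator {-R..R} z *
      indicator {(u, z). (u \<le> cdf \<alpha> z) \<noteq> (u \<le> cdf \<beta> z)} (u, z)) \<partial>lborel)
      \<le> (\<integral>\<^sup>+ u. indicator {-R..R} z * indicator {min (cdf \<alpha> z) (cdf \<beta> z)..max (cdf \<alpha> z) (cdf \<beta> z)} u \<partial>lborel)"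
      by (intro nn_integral_mono) (auto simp: indicator_def min_def max_def split: if_splits)
    also have "\<dots> = ennreal \<bar>cdf \<alpha> z - cdf \<beta> z\<bar> * indicator {-R..R} z"
      by (subst nn_integral_cmult) (auto simp: min_def max_def abs_if mult.commute)
    finally show "(\<integral>\<^sup>+ u. indicator {0<..<1} u * (indicator {-R..R} z *
      indicator {(u, z). (u \<le> cdf \<alpha> z) \<noteq> (u \<le> cdf \<beta> z)} (u, z)) \<partial>lborel)
      \<le> ennreal \<bar>cdf \<alpha> z - cdf \<beta> z\<bar> * indicator {-R..R} z" .
  qed
  finally show ?thesis by (simp add: mult_left_mono cdf_distance_def)
qed

lemma empirical_measure_unordered:
  assumes "n \<ge> 1"
  shows "empirical_measure (unordered n y) = distr (measure_pmf (pmf_of_set {1..n})) borel y"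
proof -
  have "pmf_of_multiset (unordered n y) = map_pmf y (pmf_of_set {1..n})"
    unfolding unordered_def using assms by (subst map_pmf_of_set) auto
  thus ?thesis
    unfolding empirical_measure_def by (simp add: map_pmf_rep_eq distr_distr comp_def)
qed

lemma real_distribution_empirical:
  assumes "n \<ge> 1"
  shows "real_distribution (empirical_measure (unordered n y))"
  unfolding empirical_measure_unordered[OF assms]
  by (rule prob_space.real_distribution_distr[OF measure_pmf.prob_space_axioms]) simp

lemma AE_empirical:
  assumes "n \<ge> 1" "\<And>i. i \<in> {1..n} \<Longrightarrow> P (y i)" and [measurable]: "Measurable.pred borel P"
  shows "AE x in empirical_measure (unordered n y). P x"
  unfolding empirical_measure_unordered[OF assms(1)]
  by (subst AE_distr_iff) (use assms in \<open>auto simp: AE_measure_pmf_iff\<close>)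

lemma cdf_empirical:
  assumes "n \<ge> 1"
  shows "cdf (empirical_measure (unordered n y)) s = empirical_cdf n y s"
  unfolding empirical_cdf_def empirical_measure_unordered[OF assms] cdf_def
  using assms by (simp add: measure_distr measure_pmf_of_set vimage_def Int_def)

lemma integral_empirical:
  fixes f :: "real \<Rightarrow> 'b :: {banach, second_countable_topology}"
  assumes "n \<ge> 1" and [measurable]: "f \<in> borel_measurable borel"
  shows "(\<integral>x. f x \<partial>empirical_measure (unordered n y)) = (\<Sum>i=1..n. f (y i)) /\<^sub>R real n"
  unfolding empirical_measure_unordered[OF assms(1)]
  using assms(1)
  by (subst integral_distr, simp_all)
     (subst integral_measure_pmf[of "{1..n}"], auto simp: scaleR_sum_right inverse_eq_divide)

lemma real_distribution_convolution:
  assumes "real_distribution \<nu>" "real_distribution D"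
  shows "real_distribution (\<nu> \<star> D)"
proof -
  interpret \<nu>: real_distribution \<nu> by fact
  interpret D: real_distribution D by fact
  interpret P: pair_prob_space \<nu> D ..
  have [measurable_cong]: "sets \<nu> = sets borel" "sets D = sets borel" by auto
  show ?thesis unfolding convolution_def
    by (rule P.P.real_distribution_distr) measurable
qed

lemma char_convolution:
  assumes "real_distribution \<nu>" "real_distribution D"
  shows "char (\<nu> \<star> D) t = char \<nu> t * char D t"
proof -
  interpret \<nu>: real_distribution \<nu> by fact
  interpret D: real_distribution D by fact
  interpret P: pair_prob_space \<nu> D ..
  have [measurable_cong]: "sets \<nu> = sets borel" "sets D = sets borel" by auto
  have "char (\<nu> \<star> D) t = (CLINT z|(\<nu> \<Otimes>\<^sub>M D). iexp (t * (fst z + snd z)))"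
    unfolding char_def convolution_def by (subst integral_distr) (auto simp: case_prod_beta)
  also have "\<dots> = (CLINT x|\<nu>. CLINT y|D. iexp (t * (x + y)))"
    by (subst P.integral_fst'[symmetric]) (auto intro!: P.P.integrable_iexp)
  also have "\<dots> = (CLINT x|\<nu>. iexp (t * x) * char D t)"
  proof -
    have "(CLINT y|D. iexp (t * (x + y))) = iexp (t * x) * char D t" for x
    proof -
      have "(CLINT y|D. iexp (t * (x + y))) = (CLINT y|D. iexp (t * x) * iexp (t * y))"
        by (simp add: distrib_left exp_add)
      thus ?thesis unfolding char_def by (simp only: integral_mult_right_zero)
    qed
    thus ?thesis by simp
  qed
  also have "\<dots> = char \<nu> t * char D t"
    unfolding char_def[of \<nu>] by (simp only: integral_mult_left_zero)
  finally show ?thesis .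
qed

lemma prob_convolution_outside_le:
  assumes "real_distribution \<nu>" "real_distribution D" "AE x in \<nu>. \<bar>x\<bar> \<le> V"
  shows "measure (\<nu> \<star> D) {z. \<bar>z\<bar> > V + c} \<le> measure D {u. \<bar>u\<bar> > c}"
proof -
  interpret \<nu>: real_distribution \<nu> by fact
  interpret D: real_distribution D by fact
  interpret P: pair_prob_space \<nu> D ..
  have [measurable_cong]: "sets \<nu> = sets borel" "sets D = sets borel" by auto
  have AEp: "AE z in \<nu> \<Otimes>\<^sub>M D. \<bar>fst z\<bar> \<le> V"
  proof (rule P.AE_pair_measure)
    show "{z \<in> space (\<nu> \<Otimes>\<^sub>M D). \<bar>fst z\<bar> \<le> V} \<in> sets (\<nu> \<Otimes>\<^sub>M D)" by measurable
  qed (use assms(3) in auto)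
  have "measure (\<nu> \<star> D) {z. \<bar>z\<bar> > V + c} = measure (\<nu> \<Otimes>\<^sub>M D) {z. \<bar>fst z + snd z\<bar> > V + c}"
    unfolding convolution_def by (subst measure_distr) (auto simp: space_pair_measure case_prod_beta vimage_def)
  also have "\<dots> \<le> measure (\<nu> \<Otimes>\<^sub>M D) (UNIV \<times> {u. \<bar>u\<bar> > c})"
  proof (rule P.P.finite_measure_mono_AE)
    show "AE z in \<nu> \<Otimes>\<^sub>M D. z \<in> {z. V + c < \<bar>fst z + snd z\<bar>} \<longrightarrow> z \<in> UNIV \<times> {u. c < \<bar>u\<bar>}"
      using AEp by eventually_elim auto
    have "UNIV \<times> {u. c < \<bar>u\<bar>} \<in> sets (borel \<Otimes>\<^sub>M borel :: (real \<times> real) measure)" by measurable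
    thus "UNIV \<times> {u. c < \<bar>u\<bar>} \<in> sets (\<nu> \<Otimes>\<^sub>M D)" by (simp cong: sets_pair_measure_cong)
  qed
  also have "\<dots> = measure D {u. \<bar>u\<bar> > c}"
    using \<nu>.emeasure_space_1
    by (simp add: measure_def) (subst D.emeasure_pair_measure_Times; simp)
  finally show ?thesis .
qed

section \<open>The grid and the noise\<close>

lemma grid_pt_eq: "grid_pt V \<sigma> n i = grid_pt V \<sigma> n 0 + real i * ((V + \<sigma>) / real n powr (1/4))"
  by (simp add: grid_pt_def)

text \<open>The closed form makes measurability and the distance to the argument immediate.  Arguments below the
  grid have a negative quotient, which \<open>nat\<close> truncates to the index zero.\<close>

lemma grid_proj_eq:
  assumes "V + \<sigma> > 0" "n \<ge> 2"
  shows "grid_proj V \<sigma> n z = grid_pt V \<sigma> n (min (grid_size n)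
    (nat \<lfloor>(z - grid_pt V \<sigma> n 0) / ((V + \<sigma>) / real n powr (1/4))\<rfloor>))"
proof -
  define d where "d = (V + \<sigma>) / real n powr (1/4)"
  define k where "k = \<lfloor>(z - grid_pt V \<sigma> n 0) / d\<rfloor>"
  have d: "d > 0" using assms by (simp add: d_def)
  have g: "grid_pt V \<sigma> n i = grid_pt V \<sigma> n 0 + real i * d" for i
    unfolding d_def by (rule grid_pt_eq)
  have le: "grid_pt V \<sigma> n i \<le> z \<longleftrightarrow> int i \<le> k" for i
    unfolding g[of i] k_def le_floor_iff using d by (simp add: field_simps)
  show ?thesis
  proof (cases "z < grid_pt V \<sigma> n 0")
    case True
    hence "k < 0" using le[of 0] by simp
    thus ?thesis using True by (simp add: grid_proj_def k_def[symmetric] d_def[symmetric])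
  next
    case False
    hence k0: "k \<ge> 0" using le[of 0] by simp
    show ?thesis
    proof (cases "grid_pt V \<sigma> n (grid_size n) \<le> z")
      case True
      hence "int (grid_size n) \<le> k" using le by simp
      hence "min (grid_size n) (nat k) = grid_size n" by simp
      thus ?thesis using True False by (simp add: grid_proj_def k_def[symmetric] d_def[symmetric])
    next
      case F2: False
      hence kN: "k < int (grid_size n)" using le by simp
      have "(THE i. i < grid_size n \<and> grid_pt V \<sigma> n i \<le> z \<and> z < grid_pt V \<sigma> n (Suc i)) = nat k"
      proof (rule the_equality)
        show "nat k < grid_size n \<and> grid_pt V \<sigma> n (nat k) \<le> z \<and> z < grid_pt V \<sigma> n (Suc (nat k))"
          using kN k0 le by (auto simp: not_le[symmetric])
        fix i assume "i < grid_size n \<and> grid_pt V \<sigma> n i \<le> z \<and> z < grid_pt V \<sigma> n (Suc i)"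
        thus "i = nat k" using le[of i] le[of "Suc i"] by (auto simp: not_le[symmetric])
      qed
      moreover have "min (grid_size n) (nat k) = nat k" using kN by simp
      ultimately show ?thesis using False F2 by (simp add: grid_proj_def k_def[symmetric] d_def[symmetric])
    qed
  qed
qed

lemma measurable_grid_proj [measurable]:
  assumes "V + \<sigma> > 0" "n \<ge> 2"
  shows "grid_proj V \<sigma> n \<in> borel_measurable borel"
proof -
  have "grid_proj V \<sigma> n = (\<lambda>z. grid_pt V \<sigma> n (min (grid_size n)
    (nat \<lfloor>(z - grid_pt V \<sigma> n 0) / ((V + \<sigma>) / real n powr (1/4))\<rfloor>)))"
    by (rule ext, rule grid_proj_eq[OF assms])
  thus ?thesis by simp
qed

lemma grid_proj_in_grid:
  assumes "V + \<sigma> > 0" "n \<ge> 2"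
  shows "grid_proj V \<sigma> n z \<in> grid V \<sigma> n"
  unfolding grid_proj_eq[OF assms] grid_def by auto

lemma grid_size_bounds:
  assumes "n \<ge> 2"
  shows "2 * real n powr (1/4) * ln (real n) \<le> real (grid_size n)"
    "real (grid_size n) \<le> 2 * real n powr (1/4) * ln (real n) + 1"
proof -
  have "0 \<le> 2 * real n powr (1/4) * ln (real n)" using assms by simp
  thus "2 * real n powr (1/4) * ln (real n) \<le> real (grid_size n)"
    "real (grid_size n) \<le> 2 * real n powr (1/4) * ln (real n) + 1"
    unfolding grid_size_def by linarith+
qed

lemma abs_grid_proj_le:
  assumes "V + \<sigma> > 0" "n \<ge> 2"
  shows "\<bar>grid_proj V \<sigma> n z\<bar> \<le> (V + \<sigma>) * ln (real n) + (V + \<sigma>) / real n powr (1/4)"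
proof -
  define d where "d = (V + \<sigma>) / real n powr (1/4)"
  have d: "d > 0" using assms by (simp add: d_def)
  obtain i where i: "i \<le> grid_size n" "grid_proj V \<sigma> n z = grid_pt V \<sigma> n i"
    using grid_proj_in_grid[OF assms, of z] unfolding grid_def by auto
  have "real i \<le> 2 * real n powr (1/4) * ln (real n) + 1" using i(1) grid_size_bounds(2)[OF assms(2)] by simp
  hence "real i * d \<le> (2 * real n powr (1/4) * ln (real n) + 1) * d" using d by (intro mult_right_mono) auto
  also have "\<dots> = 2 * ((V + \<sigma>) * ln (real n)) + d" using assms by (simp add: d_def field_simps)
  finally have 1: "real i * d \<le> 2 * ((V + \<sigma>) * ln (real n)) + d" .
  have 2: "0 \<le> real i * d" using d by simp
  have "grid_proj V \<sigma> n z = real i * d - (V + \<sigma>) * ln (real n)"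
    unfolding i(2) by (simp add: grid_pt_def d_def algebra_simps)
  thus ?thesis using 1 2 d unfolding d_def[symmetric] abs_le_iff by linarith
qed

lemma grid_proj_near:
  assumes "V + \<sigma> > 0" "n \<ge> 2" and z: "\<bar>z\<bar> \<le> (V + \<sigma>) * ln (real n)"
  shows "grid_proj V \<sigma> n z \<le> z" "z \<le> grid_proj V \<sigma> n z + (V + \<sigma>) / real n powr (1/4)"
proof -
  define d where "d = (V + \<sigma>) / real n powr (1/4)"
  have d: "d > 0" using assms by (simp add: d_def)
  define g where "g = grid_pt V \<sigma> n 0"
  have g: "g = - ((V + \<sigma>) * ln (real n))" by (simp add: g_def grid_pt_def algebra_simps)
  define u where "u = (z - g) / d"
  have z': "z = g + u * d" using d by (simp add: u_def)
  have "z - g \<ge> 0" using z unfolding g by linarith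
  hence u0: "u \<ge> 0" using d by (simp add: u_def)
  have "u * d \<le> 2 * ((V + \<sigma>) * ln (real n))" using z z' g by linarith
  also have "\<dots> = (2 * real n powr (1/4) * ln (real n)) * d" using assms by (simp add: d_def field_simps)
  finally have "u \<le> 2 * real n powr (1/4) * ln (real n)" using d by simp
  hence uN: "u \<le> real (grid_size n)" using grid_size_bounds(1)[OF assms(2)] by linarith
  define k where "k = nat \<lfloor>u\<rfloor>"
  have "k \<le> grid_size n" using uN u0 unfolding k_def by linarith
  hence e: "grid_proj V \<sigma> n z = g + real k * d"
    unfolding grid_proj_eq[OF assms(1,2)]
    by (simp add: g_def[symmetric] d_def[symmetric] u_def[symmetric] k_def[symmetric])
       (simp add: grid_pt_eq[of V \<sigma> n k] g_def[symmetric] d_def[symmetric])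
  have k: "real k \<le> u" "u \<le> real k + 1" using u0 unfolding k_def by linarith+
  have 1: "real k * d \<le> u * d" "u * d \<le> (real k + 1) * d" using k d by (auto intro!: mult_right_mono)
  have 2: "(real k + 1) * d = real k * d + d" by (simp add: algebra_simps)
  show "grid_proj V \<sigma> n z \<le> z" "z \<le> grid_proj V \<sigma> n z + (V + \<sigma>) / real n powr (1/4)"
    unfolding d_def[symmetric] using e z' 1 2 by linarith+
qed

lemma char_grid_proj:
  assumes "V + \<sigma> > 0" "n \<ge> 2" and \<beta>: "real_distribution \<beta>"
  shows "cmod (char (distr \<beta> borel (grid_proj V \<sigma> n)) t - char \<beta> t) \<le>
    \<bar>t\<bar> * ((V + \<sigma>) / real n powr (1/4)) + 2 * measure \<beta> {z. \<bar>z\<bar> > (V + \<sigma>) * ln (real n)}"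
proof -
  interpret real_distribution \<beta> by fact
  have [measurable_cong]: "sets \<beta> = sets borel" by auto
  note measurable_grid_proj[OF assms(1,2), measurable]
  define d where "d = (V + \<sigma>) / real n powr (1/4)"
  have d: "d > 0" using assms by (simp add: d_def)
  define A where "A = {z::real. \<bar>z\<bar> > (V + \<sigma>) * ln (real n)}"
  have [measurable]: "A \<in> sets borel" unfolding A_def by measurable
  have i: "integrable \<beta> (\<lambda>z. iexp (t * grid_proj V \<sigma> n z))" "integrable \<beta> (\<lambda>z. iexp (t * z))"
    by (auto intro!: integrable_iexp)
  have "char (distr \<beta> borel (grid_proj V \<sigma> n)) t - char \<beta> t
      = (CLINT z|\<beta>. iexp (t * grid_proj V \<sigma> n z) - iexp (t * z))"
    unfolding char_def using i by (subst integral_distr) auto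
  also have "cmod \<dots> \<le> (\<integral>z. \<bar>t\<bar> * d + 2 * indicator A z \<partial>\<beta>)"
  proof (rule Bochner_Integration.integral_norm_bound_integral)
    fix z
    show "cmod (iexp (t * grid_proj V \<sigma> n z) - iexp (t * z)) \<le> \<bar>t\<bar> * d + 2 * indicator A z"
    proof (cases "z \<in> A")
      case True
      thus ?thesis using iexp_diff_le_2[of "t * grid_proj V \<sigma> n z" "t * z"] d by (simp add: add_increasing)
    next
      case False
      hence "\<bar>grid_proj V \<sigma> n z - z\<bar> \<le> d"
        using grid_proj_near[OF assms(1,2), of z] by (simp add: A_def d_def not_less abs_le_iff)
      hence "\<bar>t * grid_proj V \<sigma> n z - t * z\<bar> \<le> \<bar>t\<bar> * d"
        by (simp only: right_diff_distrib[symmetric] abs_mult mult_left_mono abs_ge_zero)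
      thus ?thesis using iexp_diff_le[of "t * grid_proj V \<sigma> n z" "t * z"] False by simp
    qed
  qed (use i in \<open>auto simp: integrable_indicator_iff less_top[symmetric]\<close>)
  also have "\<dots> = \<bar>t\<bar> * d + 2 * measure \<beta> A"
    by (simp add: prob_space[simplified] integrable_indicator_iff less_top[symmetric])
  finally show ?thesis by (simp add: A_def d_def)
qed

text \<open>Rounding down could leave \<open>[-V, V]\<close>, so values within one grid step of \<open>-V\<close> are first moved up.\<close>

lemma grid_rounding_exists:
  assumes V: "V > 0" and \<sigma>: "\<sigma> \<ge> 0" and n: "n \<ge> 3" and d: "(V + \<sigma>) / real n powr (1/4) \<le> V" and v: "\<bar>v\<bar> \<le> V"
  shows "\<exists>w\<in>grid V \<sigma> n \<inter> {-V..V}. \<bar>w - v\<bar> \<le> (V + \<sigma>) / real n powr (1/4)"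
proof -
  define d where "d = (V + \<sigma>) / real n powr (1/4)"
  have d0: "d > 0" using V \<sigma> n by (simp add: d_def)
  define u where "u = max v (d - V)"
  have u: "\<bar>u\<bar> \<le> V" using d d0 v by (auto simp: u_def d_def[symmetric])
  have "1 \<le> ln (real n)" using n exp_le by (subst ln_ge_iff) (auto intro: order_trans[OF exp_le])
  hence "(V + \<sigma>) * 1 \<le> (V + \<sigma>) * ln (real n)" using V \<sigma> by (intro mult_left_mono) auto
  hence "V + \<sigma> \<le> (V + \<sigma>) * ln (real n)" by simp
  hence "\<bar>u\<bar> \<le> (V + \<sigma>) * ln (real n)" using u \<sigma> by linarith
  note near = grid_proj_near[OF _ _ this, folded d_def]
  have "grid_proj V \<sigma> n u \<le> u" "u \<le> grid_proj V \<sigma> n u + d" using near V \<sigma> n by auto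
  hence "grid_proj V \<sigma> n u \<in> {-V..V} \<and> \<bar>grid_proj V \<sigma> n u - v\<bar> \<le> d"
    using u v by (auto simp: u_def max_def split: if_splits)
  moreover have "grid_proj V \<sigma> n u \<in> grid V \<sigma> n" using V \<sigma> n by (intro grid_proj_in_grid) auto
  ultimately show ?thesis unfolding d_def by blast
qed

text \<open>As the norm is below \<open>s\<close>, some admissible scale \<open>t > 0\<close> lies below \<open>s\<close>, and the exponential moment decreases in the
  scale.\<close>

lemma psi1_norm_exp_moment:
  assumes D: "real_distribution D" and psi: "psi1_norm D \<le> ereal \<sigma>" and s: "\<sigma> < s"
  shows "0 < s" "(\<integral>\<^sup>+ z. ennreal (exp (\<bar>z\<bar> / s)) \<partial>D) \<le> 2"
proof -
  interpret real_distribution D by fact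
  have [measurable_cong]: "sets D = sets borel" by auto
  have "psi1_norm D < ereal s" using psi s by (metis ereal_less_eq(3) le_less_trans less_ereal.simps(1))
  then obtain t where t: "0 < t" "t < s" "(\<integral>\<^sup>+ z. ennreal (exp (\<bar>z\<bar> / t) - 1) \<partial>D) \<le> 1"
    unfolding psi1_norm_def Inf_less_iff by auto
  show "0 < s" using t by simp
  have "(\<integral>\<^sup>+ z. ennreal (exp (\<bar>z\<bar> / s)) \<partial>D) \<le> (\<integral>\<^sup>+ z. ennreal (exp (\<bar>z\<bar> / t) - 1) + 1 \<partial>D)"
  proof (rule nn_integral_mono)
    fix z :: real
    have "\<bar>z\<bar> / s \<le> \<bar>z\<bar> / t" using t by (intro divide_left_mono) auto
    moreover have "ennreal (exp (\<bar>z\<bar> / t) - 1) + 1 = ennreal (exp (\<bar>z\<bar> / t))"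
      using t by (subst ennreal_1[symmetric], subst ennreal_plus[symmetric]) auto
    ultimately show "ennreal (exp (\<bar>z\<bar> / s)) \<le> ennreal (exp (\<bar>z\<bar> / t) - 1) + 1"
      by (simp add: ennreal_leI)
  qed
  also have "\<dots> = (\<integral>\<^sup>+ z. ennreal (exp (\<bar>z\<bar> / t) - 1) \<partial>D) + 1"
    by (subst nn_integral_add) (auto simp: emeasure_space_1[simplified])
  also have "\<dots> \<le> 1 + 1" using t by (intro add_right_mono)
  finally show "(\<integral>\<^sup>+ z. ennreal (exp (\<bar>z\<bar> / s)) \<partial>D) \<le> 2" by (simp add: one_add_one)
qed

lemma exp_moment_tail:
  assumes D: "real_distribution D" and s: "0 < s" "(\<integral>\<^sup>+ z. ennreal (exp (\<bar>z\<bar> / s)) \<partial>D) \<le> 2"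
  shows "measure D {z. \<bar>z\<bar> > s * c} \<le> 2 * exp (- c)"
proof -
  interpret real_distribution D by fact
  have [measurable_cong]: "sets D = sets borel" by auto
  have "emeasure D {z. \<bar>z\<bar> > s * c} = (\<integral>\<^sup>+ z. indicator {z. \<bar>z\<bar> > s * c} z \<partial>D)" by simp
  also have "\<dots> \<le> (\<integral>\<^sup>+ z. ennreal (exp (- c)) * ennreal (exp (\<bar>z\<bar> / s)) \<partial>D)"
  proof (rule nn_integral_mono)
    fix z :: real
    have "1 \<le> exp (- c) * exp (\<bar>z\<bar> / s)" if "\<bar>z\<bar> > s * c"
    proof -
      have "c \<le> \<bar>z\<bar> / s" using that s by (simp add: field_simps)
      thus ?thesis by (simp add: exp_add[symmetric])
    qed
    thus "indicator {z. \<bar>z\<bar> > s * c} z \<le> ennreal (exp (- c)) * ennreal (exp (\<bar>z\<bar> / s))"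
      by (auto simp: indicator_def ennreal_mult[symmetric] ennreal_leI simp flip: ennreal_1)
  qed
  also have "\<dots> = ennreal (exp (- c)) * (\<integral>\<^sup>+ z. ennreal (exp (\<bar>z\<bar> / s)) \<partial>D)"
    by (rule nn_integral_cmult) measurable
  also have "\<dots> \<le> ennreal (exp (- c)) * 2" using s by (intro mult_left_mono) auto
  also have "\<dots> = ennreal (2 * exp (- c))" by (simp add: ennreal_mult mult.commute)
  finally show ?thesis by (simp add: emeasure_eq_measure)
qed

text \<open>The exponential moment gives \<open>E \<bar>\<xi>\<bar> \<le> s\<close>, hence \<open>\<bar>char D t - 1\<bar> \<le> \<bar>t\<bar> * s\<close>.  This is the range of frequencies on which
  the noise can be divided out.\<close>

lemma exp_moment_char:
  assumes D: "real_distribution D" and s: "0 < s" "(\<integral>\<^sup>+ z. ennreal (exp (\<bar>z\<bar> / s)) \<partial>D) \<le> 2"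
    and t: "\<bar>t\<bar> * s \<le> 1 / 2"
  shows "1 / 2 \<le> cmod (char D t)"
proof -
  interpret real_distribution D by fact
  have [measurable_cong]: "sets D = sets borel" by auto
  have i: "integrable D (\<lambda>z. exp (\<bar>z\<bar> / s))"
    using s by (intro integrableI_nonneg) (auto intro: le_less_trans)
  have "ennreal (\<integral>z. exp (\<bar>z\<bar> / s) \<partial>D) = (\<integral>\<^sup>+ z. ennreal (exp (\<bar>z\<bar> / s)) \<partial>D)"
    by (rule nn_integral_eq_integral[symmetric, OF i]) simp
  hence "ennreal (\<integral>z. exp (\<bar>z\<bar> / s) \<partial>D) \<le> ennreal 2" using s by simp
  hence E: "(\<integral>z. exp (\<bar>z\<bar> / s) \<partial>D) \<le> 2" by (subst (asm) ennreal_le_iff) auto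
  have ii: "integrable D (\<lambda>z. iexp (t * z))" by (auto intro!: integrable_iexp)
  have "char D t - 1 = (CLINT z|D. iexp (t * z) - 1)"
    unfolding char_def using ii by (simp add: prob_space[simplified])
  also have "cmod \<dots> \<le> (\<integral>z. \<bar>t\<bar> * (s * (exp (\<bar>z\<bar> / s) - 1)) \<partial>D)"
  proof (rule Bochner_Integration.integral_norm_bound_integral)
    fix z
    have "\<bar>z\<bar> / s + 1 \<le> exp (\<bar>z\<bar> / s)" using exp_ge_add_one_self[of "\<bar>z\<bar> / s"] by (simp only: add.commute)
    hence "\<bar>z\<bar> \<le> s * (exp (\<bar>z\<bar> / s) - 1)" using s by (simp add: field_simps)
    hence "\<bar>t\<bar> * \<bar>z\<bar> \<le> \<bar>t\<bar> * (s * (exp (\<bar>z\<bar> / s) - 1))" by (rule mult_left_mono) simp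
    thus "cmod (iexp (t * z) - 1) \<le> \<bar>t\<bar> * (s * (exp (\<bar>z\<bar> / s) - 1))"
      using iexp_diff_le[of "t * z" 0] by (simp add: abs_mult)
  qed (use i ii in auto)
  also have "\<dots> = \<bar>t\<bar> * (s * ((\<integral>z. exp (\<bar>z\<bar> / s) \<partial>D) - 1))"
    using i by (simp add: prob_space[simplified])
  also have "\<dots> \<le> \<bar>t\<bar> * (s * 1)" using E s by (intro mult_left_mono) auto
  finally have "cmod (char D t - 1) \<le> 1 / 2" using t by simp
  thus ?thesis using norm_triangle_ineq2[of 1 "1 - char D t"] by (simp add: norm_minus_commute)
qed

section \<open>Fluctuations of the noise\<close>

lemma prob_space_noise: "real_distribution D \<Longrightarrow> prob_space (\<Pi>\<^sub>M j\<in>I. D)"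
  by (rule prob_space_PiM) (simp add: real_distribution_def)

lemma measurable_noise_component:
  assumes "real_distribution D" "i \<in> I"
  shows "(\<lambda>\<xi>. \<xi> i) \<in> (\<Pi>\<^sub>M j\<in>I. D) \<rightarrow>\<^sub>M borel"
proof -
  interpret real_distribution D by fact
  have "(\<lambda>\<xi>. \<xi> i) \<in> (\<Pi>\<^sub>M j\<in>I. D) \<rightarrow>\<^sub>M D" using assms(2) by (rule measurable_component_singleton)
  thus ?thesis by (simp cong: measurable_cong_sets)
qed

lemma prob_noise_component:
  assumes "real_distribution D" "i \<in> I" and [measurable]: "A \<in> sets borel"
  shows "measure (\<Pi>\<^sub>M j\<in>I. D) {\<xi> \<in> space (\<Pi>\<^sub>M j\<in>I. D). \<xi> i \<in> A} = measure D A"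
proof -
  interpret real_distribution D by fact
  have [measurable_cong]: "sets D = sets borel" by auto
  have "distr (\<Pi>\<^sub>M j\<in>I. D) D (\<lambda>\<xi>. \<xi> i) = D"
    using assms(2) prob_space_axioms by (intro distr_PiM_component) auto
  hence "measure D A = measure (distr (\<Pi>\<^sub>M j\<in>I. D) D (\<lambda>\<xi>. \<xi> i)) A" by simp
  also have "\<dots> = measure (\<Pi>\<^sub>M j\<in>I. D) ((\<lambda>\<xi>. \<xi> i) -` A \<inter> space (\<Pi>\<^sub>M j\<in>I. D))"
    using assms(2) by (intro measure_distr) auto
  finally show ?thesis by (simp add: vimage_def Int_def conj_commute)
qed

text \<open>The summands are independent and centred with variance at most one, so the sum has
  second moment at most \<open>n\<close>; the first moment follows from \<open>\<bar>u\<bar> \<le> b / 2 + u\<^sup>2 / (2 b)\<close> with \<open>b = sqrt n\<close>.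
  The sets \<open>B i\<close> differ from one coordinate to the next, since the data are not identically distributed.\<close>

lemma expected_empirical_deviation_le:
  fixes B :: "nat \<Rightarrow> real set"
  assumes D: "real_distribution D" and n: "n \<ge> 1" and B [measurable]: "\<And>i. B i \<in> sets borel"
  shows "(\<integral>\<^sup>+ \<xi>. ennreal \<bar>(\<Sum>i=1..n. indicator (B i) (\<xi> i)) / real n - (\<Sum>i=1..n. measure D (B i)) / real n\<bar>
      \<partial>(\<Pi>\<^sub>M j\<in>{1..n}. D)) \<le> ennreal (1 / sqrt (real n))"
proof -
  interpret D: real_distribution D by fact
  have [measurable_cong]: "sets D = sets borel" by auto
  define P where "P = (\<Pi>\<^sub>M j\<in>{1..n}. D)"
  interpret P: prob_space P unfolding P_def by (rule prob_space_noise[OF D])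
  interpret PS: product_sigma_finite "\<lambda>_::nat. D"
    by (simp add: product_sigma_finite_def D.sigma_finite_measure_axioms)
  define X where "X = (\<lambda>i u. indicator (B i) u - measure D (B i))"
  have X1: "\<bar>X i u\<bar> \<le> 1" for i u
  proof -
    have "0 \<le> measure D (B i)" "measure D (B i) \<le> 1" by (rule measure_nonneg, rule D.prob_le_1)
    moreover have "indicator (B i) u = (0::real) \<or> indicator (B i) u = (1::real)" by (simp add: indicator_def)
    ultimately show ?thesis unfolding X_def by linarith
  qed
  have Xm [measurable]: "X i \<in> borel_measurable borel" for i unfolding X_def by measurable
  have Xi: "integrable D (X i)" for i
    by (rule D.integrable_const_bound[of _ 1]) (use X1 in auto)
  have X0: "(\<integral>u. X i u \<partial>D) = 0" for i
    unfolding X_def by (simp add: integrable_indicator_iff less_top[symmetric] D.prob_space[simplified])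
  have comp [measurable]: "(\<lambda>\<xi>. \<xi> i) \<in> P \<rightarrow>\<^sub>M borel" if "i \<in> {1..n}" for i
    unfolding P_def by (rule measurable_noise_component[OF D that])
  have XXi: "integrable P (\<lambda>\<xi>. X i (\<xi> i) * X j (\<xi> j))" if "i \<in> {1..n}" "j \<in> {1..n}" for i j
  proof (rule P.integrable_const_bound[of _ 1])
    show "AE \<xi> in P. norm (X i (\<xi> i) * X j (\<xi> j)) \<le> 1"
      using X1 by (intro AE_I2) (simp add: abs_mult mult_le_one)
    show "(\<lambda>\<xi>. X i (\<xi> i) * X j (\<xi> j)) \<in> borel_measurable P"
      using comp[OF that(1)] comp[OF that(2)] by measurable
  qed
  have XX: "(\<integral>\<xi>. X i (\<xi> i) * X j (\<xi> j) \<partial>P) \<le> (if i = j then 1 else 0)"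
    if ij: "i \<in> {1..n}" "j \<in> {1..n}" for i j
  proof (cases "i = j")
    case True
    have "(\<integral>\<xi>. X i (\<xi> i) * X j (\<xi> j) \<partial>P) \<le> 1"
    proof (intro P.integral_le_const XXi ij AE_I2)
      fix \<xi> :: "nat \<Rightarrow> real"
      have "\<bar>X i (\<xi> i) * X j (\<xi> j)\<bar> \<le> 1" using X1 by (simp add: abs_mult mult_le_one)
      thus "X i (\<xi> i) * X j (\<xi> j) \<le> 1" by linarith
    qed
    thus ?thesis using True by simp
  next
    case False
    \<comment> \<open>A product over all coordinates with all but two factors equal to one: its integral contains the factor \<open>E (X i) = 0\<close>.\<close>
    define f where "f = (\<lambda>l. if l = i then X i else if l = j then X j else (\<lambda>_. 1))"
    have fi: "integrable D (f l)" for l using Xi by (simp add: f_def D.integrable_const)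
    have "(\<integral>\<xi>. (\<Prod>l\<in>{1..n}. f l (\<xi> l)) \<partial>P) = (\<Prod>l\<in>{1..n}. \<integral>u. f l u \<partial>D)"
      unfolding P_def by (rule PS.product_integral_prod) (auto simp: fi)
    also have "\<dots> = 0" using ij(1) X0[of i] by (intro prod_zero bexI[of _ i]) (auto simp: f_def)
    also have "(\<lambda>\<xi>. \<Prod>l\<in>{1..n}. f l (\<xi> l)) = (\<lambda>\<xi>. X i (\<xi> i) * X j (\<xi> j))"
    proof
      fix \<xi> :: "nat \<Rightarrow> real"
      have "(\<Prod>l\<in>{1..n}. f l (\<xi> l)) = (\<Prod>l\<in>{i, j}. f l (\<xi> l))"
        using ij by (intro prod.mono_neutral_right) (auto simp: f_def)
      thus "(\<Prod>l\<in>{1..n}. f l (\<xi> l)) = X i (\<xi> i) * X j (\<xi> j)" using False by (simp add: f_def)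
    qed
    finally show ?thesis using False by simp
  qed
  define S where "S = (\<lambda>\<xi>. \<Sum>i=1..n. X i (\<xi> i))"
  have S2: "(S \<xi>)\<^sup>2 = (\<Sum>i=1..n. \<Sum>j=1..n. X i (\<xi> i) * X j (\<xi> j))" for \<xi>
    by (simp add: S_def power2_eq_square sum_product)
  have S2i: "integrable P (\<lambda>\<xi>. (S \<xi>)\<^sup>2)" unfolding S2
    by (intro Bochner_Integration.integrable_sum XXi)
  have "(\<integral>\<xi>. (S \<xi>)\<^sup>2 \<partial>P) = (\<Sum>i=1..n. \<Sum>j=1..n. \<integral>\<xi>. X i (\<xi> i) * X j (\<xi> j) \<partial>P)"
    unfolding S2
    by (subst Bochner_Integration.integral_sum, intro Bochner_Integration.integrable_sum XXi, assumption, assumption)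
       (intro sum.cong refl Bochner_Integration.integral_sum XXi)
  also have "\<dots> \<le> (\<Sum>i=1..n. \<Sum>j=1..n. if i = j then 1 else 0)"
    by (intro sum_mono XX)
  also have "\<dots> = real n" by simp
  finally have ES2: "(\<integral>\<xi>. (S \<xi>)\<^sup>2 \<partial>P) \<le> real n" .
  define b where "b = sqrt (real n)"
  have b: "b > 0" "b * b = real n" using n by (auto simp: b_def)
  have "(\<integral>\<^sup>+ \<xi>. ennreal \<bar>(\<Sum>i=1..n. indicator (B i) (\<xi> i)) / real n - (\<Sum>i=1..n. measure D (B i)) / real n\<bar> \<partial>P)
     \<le> (\<integral>\<^sup>+ \<xi>. ennreal ((b / 2 + (S \<xi>)\<^sup>2 / (2 * b)) / real n) \<partial>P)"
  proof (intro nn_integral_mono ennreal_leI)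
    fix \<xi>
    have "0 \<le> (\<bar>S \<xi>\<bar> - b)\<^sup>2" by simp
    hence "2 * b * \<bar>S \<xi>\<bar> \<le> b * b + (S \<xi>)\<^sup>2"
      by (simp add: power2_eq_square algebra_simps abs_mult_self_eq)
    hence "\<bar>S \<xi>\<bar> \<le> b / 2 + (S \<xi>)\<^sup>2 / (2 * b)" using b by (simp add: field_simps)
    moreover have "(\<Sum>i=1..n. indicator (B i) (\<xi> i)) / real n - (\<Sum>i=1..n. measure D (B i)) / real n = S \<xi> / real n"
      by (simp add: S_def X_def sum_subtractf diff_divide_distrib)
    ultimately show "\<bar>(\<Sum>i=1..n. indicator (B i) (\<xi> i)) / real n - (\<Sum>i=1..n. measure D (B i)) / real n\<bar>
        \<le> (b / 2 + (S \<xi>)\<^sup>2 / (2 * b)) / real n"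
      using n by (simp add: divide_right_mono)
  qed
  also have "\<dots> = ennreal (\<integral>\<xi>. (b / 2 + (S \<xi>)\<^sup>2 / (2 * b)) / real n \<partial>P)"
    using S2i b by (intro nn_integral_eq_integral) auto
  also have "(\<integral>\<xi>. (b / 2 + (S \<xi>)\<^sup>2 / (2 * b)) / real n \<partial>P) = (b / 2 + (\<integral>\<xi>. (S \<xi>)\<^sup>2 \<partial>P) / (2 * b)) / real n"
    using S2i by (simp add: P.prob_space)
  also have "ennreal \<dots> \<le> ennreal ((b / 2 + real n / (2 * b)) / real n)"
    using ES2 b n by (intro ennreal_leI divide_right_mono add_left_mono) auto
  also have "(b / 2 + real n / (2 * b)) / real n = 1 / sqrt (real n)"
    unfolding b_def[symmetric] b(2)[symmetric] using b(1) by (simp add: field_simps)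
  finally show ?thesis by (simp add: P_def)
qed

lemma measurable_count_le:
  fixes h :: "nat \<Rightarrow> real \<Rightarrow> real"
  assumes "\<And>i. h i \<in> borel_measurable borel" and D: "real_distribution D"
  shows "(\<lambda>(\<xi>, z). real (card {i\<in>{1..n}. h i (\<xi> i) \<le> z}) :: real)
    \<in> borel_measurable ((\<Pi>\<^sub>M j\<in>{1..n::nat}. D) \<Otimes>\<^sub>M lborel)"
proof -
  define P where "P = (\<Pi>\<^sub>M j\<in>{1..n}. D)"
  have "(\<lambda>(\<xi>, z). real (card {i\<in>{1..n}. h i (\<xi> i) \<le> z}) :: real) =
     (\<lambda>(\<xi>, z). \<Sum>i=1..n. if h i (\<xi> i) \<le> z then 1 else 0)"
    by (auto simp: sum.If_cases Int_def)
  also have "\<dots> \<in> borel_measurable (P \<Otimes>\<^sub>M lborel)"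
    unfolding case_prod_beta
  proof (rule borel_measurable_sum)
    fix i assume i: "i \<in> {1..n}"
    have "(\<lambda>x. fst x i) \<in> P \<Otimes>\<^sub>M lborel \<rightarrow>\<^sub>M borel"
      unfolding P_def by (rule measurable_compose[OF measurable_fst measurable_noise_component[OF D i]])
    from measurable_compose[OF this assms(1)[of i]]
    have hi: "(\<lambda>x. h i (fst x i)) \<in> P \<Otimes>\<^sub>M lborel \<rightarrow>\<^sub>M borel" .
    have *: "(\<lambda>x. if g x \<le> snd x then 1 else 0 :: real) \<in> borel_measurable (P \<Otimes>\<^sub>M lborel)"
      if [measurable]: "g \<in> P \<Otimes>\<^sub>M lborel \<rightarrow>\<^sub>M borel" for g :: "(nat \<Rightarrow> real) \<times> real \<Rightarrow> real"
      by measurable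
    show "(\<lambda>x. if h i (fst x i) \<le> snd x then 1 else 0 :: real) \<in> borel_measurable (P \<Otimes>\<^sub>M lborel)"
      by (rule *[OF hi])
  qed
  finally show ?thesis unfolding P_def .
qed

lemma measurable_count_deviation:
  fixes h :: "nat \<Rightarrow> real \<Rightarrow> real"
  assumes h: "\<And>i. h i \<in> borel_measurable borel" and D: "real_distribution D"
    and [measurable]: "F \<in> borel_measurable borel"
  shows "(\<lambda>(\<xi>, z). ennreal \<bar>real (card {i\<in>{1..n}. h i (\<xi> i) \<le> z}) / real n - F z\<bar> * indicator {-R..R::real} z)
     \<in> borel_measurable ((\<Pi>\<^sub>M j\<in>{1..n::nat}. D) \<Otimes>\<^sub>M lborel)"
proof -
  define P where "P = (\<Pi>\<^sub>M j\<in>{1..n}. D)"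
  note measurable_count_le[OF h D, of n, folded P_def, measurable]
  have "(\<lambda>x. \<bar>(\<lambda>(\<xi>, z). real (card {i\<in>{1..n}. h i (\<xi> i) \<le> z}) :: real) x / real n - F (snd x)\<bar>)
     \<in> borel_measurable (P \<Otimes>\<^sub>M lborel)" by measurable
  hence dev: "(\<lambda>x. \<bar>real (card {i\<in>{1..n}. h i (fst x i) \<le> snd x}) / real n - F (snd x)\<bar>)
     \<in> borel_measurable (P \<Otimes>\<^sub>M lborel)" by (simp only: case_prod_beta)
  have *: "(\<lambda>x. ennreal (g x) * indicator {-R..R::real} (snd x)) \<in> borel_measurable (P \<Otimes>\<^sub>M lborel)"
    if [measurable]: "g \<in> P \<Otimes>\<^sub>M lborel \<rightarrow>\<^sub>M borel" for g :: "(nat \<Rightarrow> real) \<times> real \<Rightarrow> real"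
    by measurable
  show ?thesis unfolding case_prod_beta P_def[symmetric] by (rule *[OF dev])
qed

lemma expected_cdf_distance_le:
  fixes h :: "nat \<Rightarrow> real \<Rightarrow> real" and R :: real
  assumes D: "real_distribution D" and n: "n \<ge> 1" and h: "\<And>i. h i \<in> borel_measurable borel" and R: "R \<ge> 0"
    and F: "F \<in> borel_measurable borel" "\<And>z. F z = (\<Sum>i=1..n. measure D {u. h i u \<le> z}) / real n"
  shows "(\<integral>\<^sup>+ \<xi>. cdf_distance R (empirical_cdf n (\<lambda>i. h i (\<xi> i))) F
      \<partial>(\<Pi>\<^sub>M j\<in>{1..n}. D)) \<le> ennreal (2 * R / sqrt (real n))"
proof -
  interpret P: prob_space "\<Pi>\<^sub>M j\<in>{1..n}. D" by (rule prob_space_noise[OF D])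
  interpret PL: pair_sigma_finite "\<Pi>\<^sub>M j\<in>{1..n}. D" lborel ..
  note measurable_count_le[OF h D, of n, measurable]
  have m: "(\<lambda>(\<xi>, z). ennreal \<bar>real (card {i\<in>{1..n}. h i (\<xi> i) \<le> z}) / real n - F z\<bar> * indicator {-R..R} z)
     \<in> borel_measurable ((\<Pi>\<^sub>M j\<in>{1..n}. D) \<Otimes>\<^sub>M lborel)"
    by (rule measurable_count_deviation[OF h D F(1)])
  have "(\<integral>\<^sup>+ \<xi>. cdf_distance R (empirical_cdf n (\<lambda>i. h i (\<xi> i))) F
      \<partial>(\<Pi>\<^sub>M j\<in>{1..n}. D)) =
    (\<integral>\<^sup>+ z. (\<integral>\<^sup>+ \<xi>. ennreal \<bar>real (card {i\<in>{1..n}. h i (\<xi> i) \<le> z}) / real n - F z\<bar> * indicator {-R..R} z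
      \<partial>(\<Pi>\<^sub>M j\<in>{1..n}. D)) \<partial>lborel)"
    unfolding cdf_distance_def empirical_cdf_def by (rule PL.Fubini'[symmetric]) (rule m)
  also have "\<dots> \<le> (\<integral>\<^sup>+ z. ennreal (1 / sqrt (real n)) * indicator {-R..R} z \<partial>lborel)"
  proof (rule nn_integral_mono)
    fix z :: real
    have "(\<integral>\<^sup>+ \<xi>. ennreal \<bar>real (card {i\<in>{1..n}. h i (\<xi> i) \<le> z}) / real n - F z\<bar> \<partial>(\<Pi>\<^sub>M j\<in>{1..n}. D))
      \<le> ennreal (1 / sqrt (real n))"
    proof -
      have *: "real (card {i\<in>{1..n}. h i (\<xi> i) \<le> z}) = (\<Sum>i=1..n. indicator {u. h i u \<le> z} (\<xi> i))" for \<xi> :: "nat \<Rightarrow> real"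
        by (simp add: indicator_def sum.If_cases Int_def)
      show ?thesis unfolding F(2) *
      proof (rule expected_empirical_deviation_le[OF D n, of "\<lambda>i. {u. h i u \<le> z}"])
        fix i
        note h[of i, measurable]
        show "{u. h i u \<le> z} \<in> sets borel" by measurable
      qed
    qed
    thus "(\<integral>\<^sup>+ \<xi>. ennreal \<bar>real (card {i\<in>{1..n}. h i (\<xi> i) \<le> z}) / real n - F z\<bar> * indicator {-R..R} z
      \<partial>(\<Pi>\<^sub>M j\<in>{1..n}. D)) \<le> ennreal (1 / sqrt (real n)) * indicator {-R..R} z"
      by (cases "z \<in> {-R..R}") auto
  qed
  also have "\<dots> = ennreal (1 / sqrt (real n)) * ennreal (2 * R)"
    using R by (subst nn_integral_cmult) auto
  also have "\<dots> = ennreal (2 * R / sqrt (real n))" using R by (simp add: ennreal_mult[symmetric])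
  finally show ?thesis .
qed

text \<open>The union bound for the coordinates above \<open>c1\<close>, and Markov's inequality for the distance
  between the empirical distribution function and its mean and for the fraction of coordinates above \<open>c2\<close>.
  Two thresholds serve because the grid only covers noise up to a level \<open>c2\<close> that a few of the
  coordinates exceed; all of them stay below a larger \<open>c1\<close>.\<close>

lemma good_noise_event:
  fixes h :: "nat \<Rightarrow> real \<Rightarrow> real" and R c1 c2 q1 q2 \<eta>1 \<eta>2 :: real
  assumes D: "real_distribution D" and n: "n \<ge> 1" and h: "\<And>i. h i \<in> borel_measurable borel" and R: "R \<ge> 0"
    and F: "F \<in> borel_measurable borel" "\<And>z. F z = (\<Sum>i=1..n. measure D {u. h i u \<le> z}) / real n"
    and q: "measure D {u. \<bar>u\<bar> > c1} \<le> q1" "measure D {u. \<bar>u\<bar> > c2} \<le> q2" and \<eta>: "\<eta>1 > 0" "\<eta>2 > 0"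
  obtains Bad where "Bad \<in> sets (\<Pi>\<^sub>M j\<in>{1..n}. D)"
    "measure (\<Pi>\<^sub>M j\<in>{1..n}. D) Bad \<le> real n * q1 + 2 * R / sqrt (real n) / \<eta>1 + q2 / \<eta>2"
    "\<And>\<xi>. \<xi> \<in> space (\<Pi>\<^sub>M j\<in>{1..n}. D) - Bad \<Longrightarrow> (\<forall>i\<in>{1..n}. \<bar>\<xi> i\<bar> \<le> c1) \<and>
      cdf_distance R (empirical_cdf n (\<lambda>i. h i (\<xi> i))) F < ennreal \<eta>1 \<and>
      real (card {i\<in>{1..n}. \<bar>\<xi> i\<bar> > c2}) / real n < \<eta>2"
proof -
  define P where "P = (\<Pi>\<^sub>M j\<in>{1..n}. D)"
  interpret P: prob_space P unfolding P_def by (rule prob_space_noise[OF D])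
  have [measurable_cong]: "sets D = sets borel" using D by (simp add: real_distribution_def real_distribution_axioms_def)
  have comp [measurable]: "(\<lambda>\<xi>. \<xi> i) \<in> P \<rightarrow>\<^sub>M borel" if "i \<in> {1..n}" for i
    unfolding P_def by (rule measurable_noise_component[OF D that])
  define Z where "Z = (\<lambda>\<xi>. cdf_distance R (empirical_cdf n (\<lambda>i. h i (\<xi> i))) F)"
  have Zm [measurable]: "Z \<in> borel_measurable P"
    unfolding Z_def P_def cdf_distance_def empirical_cdf_def
    by (rule lborel.borel_measurable_nn_integral) (rule measurable_count_deviation[OF h D F(1)])
  define W where "W = (\<lambda>\<xi>. \<Sum>i=1..n. indicator {u. \<bar>u\<bar> > c2} (\<xi> i :: real) :: ennreal)"
  have Wc: "W \<xi> = ennreal (real (card {i\<in>{1..n}. \<bar>\<xi> i\<bar> > c2}))" for \<xi>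
    by (simp add: W_def indicator_def sum.If_cases Int_def ennreal_of_nat_eq_real_of_nat)
  have i1: "{u::real. \<bar>u\<bar> > c} \<in> sets borel" for c by measurable
  have Wm [measurable]: "W \<in> borel_measurable P"
    unfolding W_def
  proof (rule borel_measurable_sum)
    fix i assume "i \<in> {1..n}"
    note comp[OF this, measurable]
    show "(\<lambda>\<xi>. indicator {u. \<bar>u\<bar> > c2} (\<xi> i) :: ennreal) \<in> borel_measurable P" by measurable
  qed
  define B1 where "B1 = (\<Union>i\<in>{1..n}. {\<xi> \<in> space P. \<xi> i \<in> {u. \<bar>u\<bar> > c1}})"
  define B2 where "B2 = {\<xi> \<in> space P. ennreal \<eta>1 \<le> Z \<xi>}"
  define B3 where "B3 = {\<xi> \<in> space P. ennreal (\<eta>2 * real n) \<le> W \<xi>}"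
  have cs: "{\<xi> \<in> space P. \<xi> i \<in> A} \<in> sets P" if "i \<in> {1..n}" "A \<in> sets borel" for i A
    using measurable_sets[OF comp[OF that(1)] that(2)] by (simp add: vimage_def Int_def conj_commute)
  have Bs [measurable]: "B1 \<in> sets P" "B2 \<in> sets P" "B3 \<in> sets P"
  proof -
    show "B1 \<in> sets P" unfolding B1_def by (intro sets.finite_UN cs i1; simp)
    show "B2 \<in> sets P" unfolding B2_def by measurable
    show "B3 \<in> sets P" unfolding B3_def by measurable
  qed
  have markov: "measure P {\<xi> \<in> space P. ennreal c \<le> U \<xi>} \<le> e / c"
    if [measurable]: "U \<in> borel_measurable P" and "(\<integral>\<^sup>+ \<xi>. U \<xi> \<partial>P) \<le> ennreal e" "c > 0" "e \<ge> 0" for U c e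
  proof -
    have "ennreal c * emeasure P {\<xi> \<in> space P. ennreal c \<le> U \<xi>} = (\<integral>\<^sup>+ \<xi>. ennreal c * indicator {\<xi> \<in> space P. ennreal c \<le> U \<xi>} \<xi> \<partial>P)"
      by (rule nn_integral_cmult_indicator[symmetric]) measurable
    also have "\<dots> \<le> (\<integral>\<^sup>+ \<xi>. U \<xi> \<partial>P)" by (rule nn_integral_mono) (auto simp: indicator_def)
    also have "\<dots> \<le> ennreal e" by fact
    finally have "ennreal (c * measure P {\<xi> \<in> space P. ennreal c \<le> U \<xi>}) \<le> ennreal e"
      using that(3) by (simp add: P.emeasure_eq_measure ennreal_mult)
    thus ?thesis using that(3,4) by (simp add: field_simps)
  qed
  have q0: "q1 \<ge> 0" "q2 \<ge> 0" using order_trans[OF measure_nonneg q(1)] order_trans[OF measure_nonneg q(2)] by auto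
  have comp_eq: "measure P {\<xi> \<in> space P. \<xi> i \<in> A} = measure D A" if "i \<in> {1..n}" "A \<in> sets borel" for i A
    unfolding P_def by (rule prob_noise_component[OF D that])
  have b1: "measure P B1 \<le> real n * q1"
  proof -
    have "measure P B1 \<le> (\<Sum>i\<in>{1..n}. measure P {\<xi> \<in> space P. \<xi> i \<in> {u. \<bar>u\<bar> > c1}})"
      unfolding B1_def by (rule P.finite_measure_subadditive_finite) (use cs i1 in blast)+
    also have "\<dots> \<le> (\<Sum>i\<in>{1..n}. q1)" by (intro sum_mono) (subst comp_eq; use q i1 in simp)
    finally show ?thesis by simp
  qed
  have b2: "measure P B2 \<le> 2 * R / sqrt (real n) / \<eta>1"
    unfolding B2_def
  proof (rule markov)
    show "(\<integral>\<^sup>+ \<xi>. Z \<xi> \<partial>P) \<le> ennreal (2 * R / sqrt (real n))"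
      unfolding Z_def P_def by (rule expected_cdf_distance_le[OF D n h R F])
  qed (use \<eta> R in auto)
  have b3: "measure P B3 \<le> real n * q2 / (\<eta>2 * real n)"
    unfolding B3_def
  proof (rule markov)
    have "(\<integral>\<^sup>+ \<xi>. W \<xi> \<partial>P) = (\<Sum>i\<in>{1..n}. \<integral>\<^sup>+ \<xi>. indicator {u. \<bar>u\<bar> > c2} (\<xi> i) \<partial>P)"
      unfolding W_def
    proof (rule nn_integral_sum)
      fix i assume "i \<in> {1..n}"
      note comp[OF this, measurable]
      show "(\<lambda>\<xi>. indicator {u. \<bar>u\<bar> > c2} (\<xi> i) :: ennreal) \<in> borel_measurable P" by measurable
    qed
    also have "\<dots> \<le> (\<Sum>i\<in>{1..n}. ennreal q2)"
    proof (rule sum_mono)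
      fix i assume i: "i \<in> {1..n}"
      note comp[OF this, measurable]
      have "(\<integral>\<^sup>+ \<xi>. indicator {u. \<bar>u\<bar> > c2} (\<xi> i) \<partial>P) = (\<integral>\<^sup>+ \<xi>. indicator {\<xi> \<in> space P. \<xi> i \<in> {u. \<bar>u\<bar> > c2}} \<xi> \<partial>P)"
        by (intro nn_integral_cong) (auto simp: indicator_def)
      also have "\<dots> = emeasure P {\<xi> \<in> space P. \<xi> i \<in> {u. \<bar>u\<bar> > c2}}" by simp
      also have "\<dots> = ennreal (measure D {u. \<bar>u\<bar> > c2})"
        unfolding P.emeasure_eq_measure comp_eq[OF i i1] ..
      also have "\<dots> \<le> ennreal q2" using q(2) by (rule ennreal_leI)
      finally show "(\<integral>\<^sup>+ \<xi>. indicator {u. \<bar>u\<bar> > c2} (\<xi> i) \<partial>P) \<le> ennreal q2" .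
    qed
    also have "\<dots> = ennreal (real n * q2)" using q0 by (simp add: ennreal_mult ennreal_of_nat_eq_real_of_nat)
    finally show "(\<integral>\<^sup>+ \<xi>. W \<xi> \<partial>P) \<le> ennreal (real n * q2)" .
  qed (use \<eta> n q0 in auto)
  show thesis
  proof (rule that[folded P_def])
    show "B1 \<union> B2 \<union> B3 \<in> sets P" by measurable
    have "measure P (B1 \<union> B2 \<union> B3) \<le> measure P B1 + measure P B2 + measure P B3"
      using measure_Un_le[of "B1 \<union> B2" P B3] measure_Un_le[of B1 P B2] Bs by auto
    thus "measure P (B1 \<union> B2 \<union> B3) \<le> real n * q1 + 2 * R / sqrt (real n) / \<eta>1 + q2 / \<eta>2"
      using b1 b2 b3 n by simp
    fix \<xi> assume \<xi>: "\<xi> \<in> space P - (B1 \<union> B2 \<union> B3)"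
    have "\<forall>i\<in>{1..n}. \<bar>\<xi> i\<bar> \<le> c1" using \<xi> by (auto simp: B1_def not_le[symmetric])
    moreover have "Z \<xi> < ennreal \<eta>1" using \<xi> by (auto simp: B2_def)
    moreover have "\<not> ennreal (\<eta>2 * real n) \<le> W \<xi>" using \<xi> by (auto simp: B3_def)
    hence "real (card {i\<in>{1..n}. \<bar>\<xi> i\<bar> > c2}) < \<eta>2 * real n"
      unfolding Wc by (simp add: not_le ennreal_less_iff)
    hence "real (card {i\<in>{1..n}. \<bar>\<xi> i\<bar> > c2}) / real n < \<eta>2" using n by (simp add: field_simps)
    ultimately show "(\<forall>i\<in>{1..n}. \<bar>\<xi> i\<bar> \<le> c1) \<and>
      cdf_distance R (empirical_cdf n (\<lambda>i. h i (\<xi> i))) F < ennreal \<eta>1 \<and>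
      real (card {i\<in>{1..n}. \<bar>\<xi> i\<bar> > c2}) / real n < \<eta>2"
      unfolding Z_def by blast
  qed
qed

section \<open>Characteristic functions of the estimator and of the truth\<close>

lemma grid_measures_D:
  assumes "\<mu> \<in> grid_measures V \<sigma> n"
  shows "real_distribution \<mu>" "AE x in \<mu>. \<bar>x\<bar> \<le> V"
proof -
  show rd: "real_distribution \<mu>" using assms by (simp add: grid_measures_def)
  interpret real_distribution \<mu> by fact
  have "finite (grid V \<sigma> n \<inter> {-V..V})" by (simp add: grid_def)

  hence "AE x in \<mu>. x \<in> grid V \<sigma> n \<inter> {-V..V}"
    using assms by (intro AE_prob_1) (simp add: grid_measures_def)
  thus "AE x in \<mu>. \<bar>x\<bar> \<le> V" by eventually_elim auto
qed

lemma empirical_in_grid_measures: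
  assumes "n \<ge> 1" "\<And>i. i \<in> {1..n} \<Longrightarrow> w i \<in> grid V \<sigma> n \<inter> {-V..V}"
  shows "empirical_measure (unordered n w) \<in> grid_measures V \<sigma> n"
proof -
  interpret real_distribution "empirical_measure (unordered n w)"
    by (rule real_distribution_empirical[OF assms(1)])
  have "finite (grid V \<sigma> n \<inter> {-V..V})" by (simp add: grid_def)
  hence m: "grid V \<sigma> n \<inter> {-V..V} \<in> sets borel" by (simp add: borel_closed finite_imp_closed)
  have "AE x in empirical_measure (unordered n w). x \<in> grid V \<sigma> n \<inter> {-V..V}"
    by (rule AE_empirical[where P = "\<lambda>x. x \<in> grid V \<sigma> n \<inter> {-V..V}", OF assms])
       (assumption, use m in measurable)
  hence "prob (grid V \<sigma> n \<inter> {-V..V}) = 1" using m by (subst prob_eq_1) auto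
  thus ?thesis by (simp add: grid_measures_def real_distribution_axioms)
qed

lemma cdf_empirical_convolution:
  assumes n: "n \<ge> 1" and D: "real_distribution D" and g [measurable]: "g \<in> borel_measurable borel"
  shows "cdf (distr (empirical_measure (unordered n w) \<star> D) borel g) z
    = (\<Sum>i=1..n. measure D {u. g (w i + u) \<le> z}) / real n"
proof -
  interpret D: real_distribution D by fact
  interpret \<nu>: real_distribution "empirical_measure (unordered n w)"
    by (rule real_distribution_empirical[OF n])
  interpret C: real_distribution "empirical_measure (unordered n w) \<star> D"
    by (rule real_distribution_convolution) unfold_locales
  have [measurable_cong]: "sets D = sets borel" "sets (empirical_measure (unordered n w)) = sets borel" by auto
  have A: "{v. g v \<le> z} \<in> sets borel" by measurable
  have m: "(\<lambda>x. measure D {u. g (x + u) \<le> z}) \<in> borel_measurable borel"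
  proof -
    have "(\<lambda>x. measure D {u \<in> space D. g (x + u) \<le> z}) \<in> borel_measurable borel"
      by measurable
    thus ?thesis by simp
  qed
  have "emeasure (empirical_measure (unordered n w) \<star> D) {v. g v \<le> z}
     = (\<integral>\<^sup>+ x. emeasure D {u. x + u \<in> {v. g v \<le> z}} \<partial>empirical_measure (unordered n w))"
    using convolution_emeasure[OF A, of "empirical_measure (unordered n w)" D]
    by (simp add: D.finite_measure_axioms \<nu>.finite_measure_axioms add.commute)
  also have "\<dots> = (\<integral>\<^sup>+ x. ennreal (measure D {u. g (x + u) \<le> z}) \<partial>empirical_measure (unordered n w))"
    by (simp add: D.emeasure_eq_measure)
  also have "\<dots> = ennreal (\<integral> x. measure D {u. g (x + u) \<le> z} \<partial>empirical_measure (unordered n w))"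
    using m by (intro nn_integral_eq_integral \<nu>.integrable_const_bound[of _ 1]) auto
  also have "(\<integral> x. measure D {u. g (x + u) \<le> z} \<partial>empirical_measure (unordered n w))
     = (\<Sum>i=1..n. measure D {u. g (w i + u) \<le> z}) / real n"
    using m by (subst integral_empirical[OF n]) (auto simp: divide_inverse mult.commute)
  finally have "measure (empirical_measure (unordered n w) \<star> D) {v. g v \<le> z}
     = (\<Sum>i=1..n. measure D {u. g (w i + u) \<le> z}) / real n"
    by (simp add: C.emeasure_eq_measure sum_nonneg)
  thus ?thesis unfolding cdf_def by (subst measure_distr) (auto simp: vimage_def)
qed

lemma integral_step_difference:
  fixes a b :: real
  assumes "\<bar>a\<bar> \<le> R" "\<bar>b\<bar> \<le> R"
  shows "(\<integral>\<^sup>+ z. ennreal \<bar>indicator {a..} z - indicator {b..} z\<bar> * indicator {-R..R} z \<partial>lborel) = ennreal \<bar>a - b\<bar>"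
proof -
  have "(\<integral>\<^sup>+ z. ennreal \<bar>indicator {a..} z - indicator {b..} z\<bar> * indicator {-R..R} z \<partial>lborel)
      = (\<integral>\<^sup>+ z. indicator {min a b..<max a b} z \<partial>lborel)"
  proof (rule nn_integral_cong)
    fix z
    show "ennreal \<bar>indicator {a..} z - indicator {b..} z\<bar> * indicator {-R..R} z = indicator {min a b..<max a b} z"
      using assms by (cases "a \<le> z"; cases "b \<le> z"; cases "-R \<le> z"; cases "z \<le> R"; simp add: indicator_def min_def max_def)
  qed
  also have "\<dots> = ennreal \<bar>a - b\<bar>"
    by (subst nn_integral_indicator, simp, subst emeasure_lborel_Ico)
       (auto simp: min_def max_def intro!: arg_cong[where f=ennreal])
  finally show ?thesis .
qed

lemma empirical_cdf_distance_le:
  fixes y y' :: "nat \<Rightarrow> real"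
  assumes n: "n \<ge> 1" and R: "\<And>i. i \<in> {1..n} \<Longrightarrow> \<bar>y i\<bar> \<le> R" "\<And>i. i \<in> {1..n} \<Longrightarrow> \<bar>y' i\<bar> \<le> R"
  shows "cdf_distance R (empirical_cdf n y) (empirical_cdf n y') \<le> ennreal ((\<Sum>i=1..n. \<bar>y i - y' i\<bar>) / real n)"
proof -
  have c: "real (card {i\<in>{1..n}. v i \<le> z}) = (\<Sum>i=1..n. indicator {v i..} z)" for v :: "nat \<Rightarrow> real" and z
    by (simp add: indicator_def sum.If_cases Int_def)
  have "cdf_distance R (empirical_cdf n y) (empirical_cdf n y')
    \<le> (\<integral>\<^sup>+ z. (\<Sum>i=1..n. ennreal (1 / real n) * (ennreal \<bar>indicator {y i..} z - indicator {y' i..} z\<bar> * indicator {-R..R} z)) \<partial>lborel)"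
    unfolding cdf_distance_def
  proof (rule nn_integral_mono)
    fix z
    have "\<bar>empirical_cdf n y z - empirical_cdf n y' z\<bar>
      = \<bar>\<Sum>i=1..n. indicator {y i..} z - indicator {y' i..} z\<bar> / real n"
      unfolding empirical_cdf_def c by (simp add: sum_subtractf diff_divide_distrib[symmetric])
    also have "\<dots> \<le> (\<Sum>i=1..n. \<bar>indicator {y i..} z - indicator {y' i..} z\<bar>) / real n"
      by (intro divide_right_mono sum_abs) auto
    finally have "ennreal \<bar>empirical_cdf n y z - empirical_cdf n y' z\<bar>
       \<le> ennreal ((\<Sum>i=1..n. \<bar>indicator {y i..} z - indicator {y' i..} z\<bar>) / real n)" by (rule ennreal_leI)
    also have "\<dots> = (\<Sum>i=1..n. ennreal (1 / real n) * ennreal \<bar>indicator {y i..} z - indicator {y' i..} z\<bar>)"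
      by (simp add: sum_divide_distrib ennreal_mult[symmetric])
    finally show "ennreal \<bar>empirical_cdf n y z - empirical_cdf n y' z\<bar> * indicator {-R..R} z
       \<le> (\<Sum>i=1..n. ennreal (1 / real n) * (ennreal \<bar>indicator {y i..} z - indicator {y' i..} z\<bar> * indicator {-R..R} z))"
      by (cases "z \<in> {-R..R}") auto
  qed
  also have "\<dots> = (\<Sum>i=1..n. ennreal (1 / real n) *
      (\<integral>\<^sup>+ z. ennreal \<bar>indicator {y i..} z - indicator {y' i..} z\<bar> * indicator {-R..R} z \<partial>lborel))"
    by (simp add: nn_integral_sum nn_integral_cmult)
  also have "\<dots> = (\<Sum>i=1..n. ennreal (1 / real n) * ennreal \<bar>y i - y' i\<bar>)"
    by (intro sum.cong refl arg_cong2[where f="(*)"] integral_step_difference R)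
  also have "\<dots> = ennreal ((\<Sum>i=1..n. \<bar>y i - y' i\<bar>) / real n)"
    by (simp add: sum_divide_distrib ennreal_mult[symmetric])
  finally show ?thesis .
qed

text \<open>Compare \<open>\<alpha>\<close>, the law of the projected noisy rounded values, with the data through the intermediate points
  \<open>y' i = grid_proj (w i + \<xi> i)\<close>, which use the noise of the data.  The empirical distribution function
  of \<open>y'\<close> has mean \<open>cdf \<alpha>\<close>, so their distance is pure fluctuation, at most \<open>\<eta>1\<close>.  The points \<open>y'\<close> and the data
  differ by two grid steps, except for the fraction \<open>\<eta>2\<close> that the grid does not cover.\<close>

lemma wasserstein_rounded_design_le:
  fixes a w \<xi> :: "nat \<Rightarrow> real" and V \<sigma> c2 \<eta>1 \<eta>2 :: real and n :: nat and D :: "real measure"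
  defines "S \<equiv> V + \<sigma>" and "d \<equiv> (V + \<sigma>) / real n powr (1/4)" and "R \<equiv> 3 * (V + \<sigma>) * ln (real n)"
  defines "h \<equiv> (\<lambda>i u. grid_proj V \<sigma> n (w i + u))"
  defines "F \<equiv> (\<lambda>z. (\<Sum>i=1..n. measure D {u. h i u \<le> z}) / real n)"
  assumes V: "V > 0" "\<sigma> \<ge> 0" and n: "n \<ge> 3" "2 \<le> ln (real n)" and dV: "d \<le> V" and D: "real_distribution D"
    and a: "\<And>i. i \<in> {1..n} \<Longrightarrow> \<bar>a i\<bar> \<le> V"
    and w: "\<And>i. i \<in> {1..n} \<Longrightarrow> \<bar>w i\<bar> \<le> V \<and> \<bar>w i - a i\<bar> \<le> d"
    and c2: "V + c2 \<le> S * ln (real n)"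
    and \<xi>: "\<And>i. i \<in> {1..n} \<Longrightarrow> \<bar>\<xi> i\<bar> \<le> 2 * S * ln (real n)"
    and \<eta>1: "\<eta>1 \<ge> 0" "cdf_distance R (empirical_cdf n (\<lambda>i. h i (\<xi> i))) F \<le> ennreal \<eta>1"
    and \<eta>2: "real (card {i\<in>{1..n}. \<bar>\<xi> i\<bar> > c2}) / real n \<le> \<eta>2"
  shows "wasserstein2_sq (distr (empirical_measure (unordered n w) \<star> D) borel (grid_proj V \<sigma> n))
      (empirical_measure (unordered n (\<lambda>i. a i + \<xi> i))) \<le> ennreal (2 * R * (\<eta>1 + 2 * d + 2 * R * \<eta>2))"
proof -
  have S: "S > 0" "n \<ge> 1" "n \<ge> 2" "V + \<sigma> > 0" using V n by (auto simp: S_def)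
  note gm = measurable_grid_proj[OF S(4,3)]
  have d0: "d \<ge> 0" using S by (simp add: d_def)
  have SL: "2 * S \<le> S * ln (real n)" using S(1) n(2) by (simp add: mult.commute)
  have R: "R = 3 * (S * ln (real n))" by (simp add: R_def S_def)
  have R0: "R > 0" using SL S by (simp add: R)
  define \<alpha> where "\<alpha> = distr (empirical_measure (unordered n w) \<star> D) borel (grid_proj V \<sigma> n)"
  define y where "y = (\<lambda>i. a i + \<xi> i)"
  define y' where "y' = (\<lambda>i. h i (\<xi> i))"
  have VS: "V \<le> S" using V by (simp add: S_def)
  have y: "\<bar>y i\<bar> \<le> R" if "i \<in> {1..n}" for i
    using a[OF that] \<xi>[OF that] SL VS S unfolding y_def R by linarith
  have gR: "\<bar>grid_proj V \<sigma> n z\<bar> \<le> R" for z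
    using abs_grid_proj_le[OF S(4,3), of z, folded d_def, folded S_def] dV SL VS S unfolding R by linarith
  interpret C: real_distribution "empirical_measure (unordered n w) \<star> D"
    by (intro real_distribution_convolution real_distribution_empirical S D)
  have \<alpha>: "real_distribution \<alpha>" unfolding \<alpha>_def using gm by simp
  have \<alpha>R: "AE z in \<alpha>. \<bar>z\<bar> \<le> R"
    unfolding \<alpha>_def using gm gR by (subst AE_distr_iff) auto
  have cdf\<alpha>: "cdf \<alpha> z = F z" for z
    unfolding \<alpha>_def F_def h_def by (rule cdf_empirical_convolution[OF S(2) D gm])
  have Fm [measurable]: "F \<in> borel_measurable borel"
  proof -
    interpret \<alpha>: real_distribution \<alpha> by (rule \<alpha>)
    have "mono (cdf \<alpha>)" by (auto simp: mono_def \<alpha>.cdf_nondecreasing)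
    hence "cdf \<alpha> \<in> borel_measurable borel" by (rule borel_measurable_mono)
    thus ?thesis by (simp add: cdf\<alpha>[abs_def])
  qed
  have \<pi>: "real_distribution (empirical_measure (unordered n y))" by (rule real_distribution_empirical[OF S(2)])
  have \<pi>R: "AE z in empirical_measure (unordered n y). \<bar>z\<bar> \<le> R"
    by (rule AE_empirical[OF S(2)]) (use y in auto)
  have cm: "empirical_cdf n v \<in> borel_measurable borel" for v :: "nat \<Rightarrow> real"
    unfolding empirical_cdf_def by (intro borel_measurable_mono monoI divide_right_mono) (auto intro!: card_mono)
  note cm[measurable]
  have diff: "(\<Sum>i=1..n. \<bar>y' i - y i\<bar>) / real n \<le> 2 * d + 2 * R * \<eta>2"
  proof -
    have "\<bar>y' i - y i\<bar> \<le> 2 * d + 2 * R * (if \<bar>\<xi> i\<bar> > c2 then 1 else 0)" if i: "i \<in> {1..n}" for i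
    proof (cases "\<bar>\<xi> i\<bar> > c2")
      case True
      have "\<bar>y' i - y i\<bar> \<le> R + R"
        using gR[of "w i + \<xi> i"] y[OF i] unfolding y'_def h_def by linarith
      thus ?thesis using True d0 by simp
    next
      case False
      hence "\<bar>w i + \<xi> i\<bar> \<le> S * ln (real n)" using w[OF i] c2 by linarith
      hence "y' i \<le> w i + \<xi> i" "w i + \<xi> i \<le> y' i + d"
        using grid_proj_near[OF S(4,3), of "w i + \<xi> i"] unfolding y'_def h_def d_def S_def by auto
      thus ?thesis using False w[OF i] unfolding y_def by (simp add: abs_le_iff)
    qed
    hence "(\<Sum>i=1..n. \<bar>y' i - y i\<bar>) \<le> (\<Sum>i=1..n. 2 * d + 2 * R * (if \<bar>\<xi> i\<bar> > c2 then 1 else 0))"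
      by (rule sum_mono)
    also have "\<dots> = real n * (2 * d) + 2 * R * real (card {i\<in>{1..n}. \<bar>\<xi> i\<bar> > c2})"
      by (simp add: sum.distrib sum_distrib_left[symmetric] sum.If_cases Int_def)
    finally have "(\<Sum>i=1..n. \<bar>y' i - y i\<bar>) / real n \<le> (real n * (2 * d) + 2 * R * real (card {i\<in>{1..n}. \<bar>\<xi> i\<bar> > c2})) / real n"
      by (rule divide_right_mono) simp
    also have "\<dots> = 2 * d + 2 * R * (real (card {i\<in>{1..n}. \<bar>\<xi> i\<bar> > c2}) / real n)" using S by (simp add: add_divide_distrib)
    also have "\<dots> \<le> 2 * d + 2 * R * \<eta>2" using \<eta>2 R0 by (intro add_left_mono mult_left_mono) auto
    finally show ?thesis .
  qed
  have \<eta>20: "0 \<le> \<eta>2" using \<eta>2 by (rule order_trans[rotated]) simp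
  have "wasserstein2_sq \<alpha> (empirical_measure (unordered n y)) \<le> ennreal (2 * R) *
    cdf_distance R (cdf \<alpha>) (cdf (empirical_measure (unordered n y)))"
    using R0 by (intro wasserstein_le_cdf_distance \<alpha> \<alpha>R \<pi> \<pi>R) auto
  also have "\<dots> \<le> ennreal (2 * R) *
    (\<integral>\<^sup>+ z. ennreal \<bar>empirical_cdf n y' z - F z\<bar> * indicator {-R..R} z +
      ennreal \<bar>empirical_cdf n y' z - empirical_cdf n y z\<bar> * indicator {-R..R} z \<partial>lborel)"
    unfolding cdf_distance_def
  proof (intro mult_left_mono nn_integral_mono)
    fix z
    have "\<bar>F z - u\<bar> \<le> \<bar>v - F z\<bar> + \<bar>v - u\<bar>" for u v :: real by linarith
    hence "ennreal \<bar>F z - u\<bar> \<le> ennreal \<bar>v - F z\<bar> + ennreal \<bar>v - u\<bar>" for u v :: real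
      by (simp add: ennreal_plus[symmetric] ennreal_leI del: ennreal_plus)
    thus "ennreal \<bar>cdf \<alpha> z - cdf (empirical_measure (unordered n y)) z\<bar> * indicator {-R..R} z
      \<le> ennreal \<bar>empirical_cdf n y' z - F z\<bar> * indicator {-R..R} z +
      ennreal \<bar>empirical_cdf n y' z - empirical_cdf n y z\<bar> * indicator {-R..R} z"
      unfolding cdf\<alpha> cdf_empirical[OF S(2)] by (cases "z \<in> {-R..R}") auto
  qed simp
  also have "\<dots> = ennreal (2 * R) *
    (cdf_distance R (empirical_cdf n y') F +
    cdf_distance R (empirical_cdf n y') (empirical_cdf n y))"
    unfolding cdf_distance_def by (subst nn_integral_add) measurable
  also have "\<dots> \<le> ennreal (2 * R) * (ennreal \<eta>1 + ennreal (2 * d + 2 * R * \<eta>2))"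
  proof (intro mult_left_mono add_mono)
    show "cdf_distance R (empirical_cdf n y') F \<le> ennreal \<eta>1"
      using \<eta>1(2) by (simp add: y'_def)
    have "cdf_distance R (empirical_cdf n y') (empirical_cdf n y)
      \<le> ennreal ((\<Sum>i=1..n. \<bar>y' i - y i\<bar>) / real n)"
      by (rule empirical_cdf_distance_le[OF S(2)]) (auto simp: y y'_def h_def gR)
    also have "\<dots> \<le> ennreal (2 * d + 2 * R * \<eta>2)" by (rule ennreal_leI[OF diff])
    finally show "cdf_distance R (empirical_cdf n y') (empirical_cdf n y)
      \<le> ennreal (2 * d + 2 * R * \<eta>2)" .
  qed simp
  also have "\<dots> = ennreal (2 * R * (\<eta>1 + 2 * d + 2 * R * \<eta>2))"
    using R0 d0 \<eta>1(1) \<eta>20 by (simp add: ennreal_plus[symmetric] ennreal_mult[symmetric] add.assoc del: ennreal_plus)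
  finally show ?thesis unfolding \<alpha>_def y_def .
qed

text \<open>Since \<open>\<mu>\<close> minimises, both \<open>\<mu>\<close> and the competitor \<open>\<nu>\<close>, the law of the rounded values, have Wasserstein distance
  below \<open>sqrt e\<close> from the data after convolution and projection, so at \<open>t\<close> their characteristic functions then
  differ by at most \<open>2 \<bar>t\<bar> sqrt e\<close>.  Undo the projection, which costs a grid step and the mass
  outside the grid, then the convolution, by dividing by \<open>char D t\<close>, and finally the rounding.\<close>

lemma char_deconvolution_le:
  fixes a w :: "nat \<Rightarrow> real" and V \<sigma> c2 e :: real and n :: nat and D \<mu> :: "real measure" and Y :: "real multiset"
  defines "S \<equiv> V + \<sigma>" and "d \<equiv> (V + \<sigma>) / real n powr (1/4)"
  assumes V: "V > 0" "\<sigma> \<ge> 0" and n: "n \<ge> 3" and D: "real_distribution D"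
    and w: "\<And>i. i \<in> {1..n} \<Longrightarrow> w i \<in> grid V \<sigma> n \<inter> {-V..V} \<and> \<bar>w i - a i\<bar> \<le> d"
    and c2: "V + c2 \<le> S * ln (real n)" "measure D {u. \<bar>u\<bar> > c2} \<le> 2 / real n"
    and \<mu>: "deconvolution_argmin V \<sigma> D n Y \<mu>"
    and e: "e > 0" "wasserstein2_sq (distr (empirical_measure (unordered n w) \<star> D) borel (grid_proj V \<sigma> n))
      (empirical_measure Y) < ennreal e"
    and t: "1 / 2 \<le> cmod (char D t)"
  shows "cmod (char (empirical_measure (unordered n a)) t - char \<mu> t) \<le> \<bar>t\<bar> * (4 * sqrt e + 5 * d) + 16 / real n"
proof -
  have S: "S > 0" "n \<ge> 1" "n \<ge> 2" "V + \<sigma> > 0" using V n by (auto simp: S_def)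
  note gm = measurable_grid_proj[OF S(4,3)]
  define \<nu> where "\<nu> = empirical_measure (unordered n w)"
  define T where "T = (\<lambda>M. distr (M \<star> D) borel (grid_proj V \<sigma> n))"
  have \<nu>: "\<nu> \<in> grid_measures V \<sigma> n" unfolding \<nu>_def by (rule empirical_in_grid_measures[OF S(2)]) (use w in blast)
  have \<mu>g: "\<mu> \<in> grid_measures V \<sigma> n"
    and le: "wasserstein2_sq (T \<mu>) (empirical_measure Y) \<le> wasserstein2_sq (T \<nu>) (empirical_measure Y)"
    using \<mu> \<nu> unfolding deconvolution_argmin_def is_arg_min_def T_def by (auto simp: not_less)
  have rdP: "real_distribution (T M)" if "M \<in> grid_measures V \<sigma> n" for M
  proof -
    interpret C: real_distribution "M \<star> D"
      by (intro real_distribution_convolution grid_measures_D[OF that] D)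
    show ?thesis unfolding T_def using gm by simp
  qed
  have W: "cmod (char (T \<mu>) t - char (empirical_measure Y) t) \<le> \<bar>t\<bar> * sqrt e"
    "cmod (char (T \<nu>) t - char (empirical_measure Y) t) \<le> \<bar>t\<bar> * sqrt e"
  proof -
    have "wasserstein2_sq (T \<nu>) (empirical_measure Y) < ennreal e" using e(2) by (simp add: \<nu>_def T_def)
    thus "cmod (char (T \<mu>) t - char (empirical_measure Y) t) \<le> \<bar>t\<bar> * sqrt e"
      "cmod (char (T \<nu>) t - char (empirical_measure Y) t) \<le> \<bar>t\<bar> * sqrt e"
      using e(1) le by (auto intro: char_diff_le_wasserstein[OF rdP[OF \<mu>g]] char_diff_le_wasserstein[OF rdP[OF \<nu>]] le_less_trans)
  qed
  have proj: "cmod (char (T M) t - char M t * char D t) \<le> \<bar>t\<bar> * d + 4 / real n" if M: "M \<in> grid_measures V \<sigma> n" for M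
  proof -
    interpret C: real_distribution "M \<star> D"
      by (intro real_distribution_convolution grid_measures_D[OF M] D)
    have "measure (M \<star> D) {z. \<bar>z\<bar> > (V + \<sigma>) * ln (real n)} \<le> measure (M \<star> D) {z. \<bar>z\<bar> > V + c2}"
      using c2(1) by (intro C.finite_measure_mono) (auto simp: S_def)
    also have "\<dots> \<le> measure D {u. \<bar>u\<bar> > c2}"
      by (rule prob_convolution_outside_le[OF grid_measures_D(1)[OF M] D grid_measures_D(2)[OF M]])
    finally have "2 * measure (M \<star> D) {z. \<bar>z\<bar> > (V + \<sigma>) * ln (real n)} \<le> 4 / real n" using c2(2) by simp
    moreover have "cmod (char (T M) t - char (M \<star> D) t) \<le>
      \<bar>t\<bar> * d + 2 * measure (M \<star> D) {z. \<bar>z\<bar> > (V + \<sigma>) * ln (real n)}"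
      unfolding T_def d_def by (rule char_grid_proj[OF S(4,3) C.real_distribution_axioms])
    ultimately show ?thesis by (simp add: char_convolution[OF grid_measures_D(1)[OF M] D])
  qed
  have "cmod (char D t) * cmod (char \<nu> t - char \<mu> t) = cmod (char \<nu> t * char D t - char \<mu> t * char D t)"
    by (simp add: norm_mult[symmetric] algebra_simps)
  also have "\<dots> = cmod ((char (T \<nu>) t - char (empirical_measure Y) t) - (char (T \<mu>) t - char (empirical_measure Y) t)
     - (char (T \<nu>) t - char \<nu> t * char D t) + (char (T \<mu>) t - char \<mu> t * char D t))"
    by (simp add: algebra_simps)
  also have "\<dots> \<le> cmod (char (T \<nu>) t - char (empirical_measure Y) t) + cmod (char (T \<mu>) t - char (empirical_measure Y) t)
     + cmod (char (T \<nu>) t - char \<nu> t * char D t) + cmod (char (T \<mu>) t - char \<mu> t * char D t)"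
    by (intro order_trans[OF norm_triangle_ineq] add_mono order_trans[OF norm_triangle_ineq4] order_refl)
  also have "\<dots> \<le> \<bar>t\<bar> * sqrt e + \<bar>t\<bar> * sqrt e + (\<bar>t\<bar> * d + 4 / real n) + (\<bar>t\<bar> * d + 4 / real n)"
    by (intro add_mono W proj \<mu>g \<nu>)
  finally have "cmod (char D t) * cmod (char \<nu> t - char \<mu> t) \<le> 2 * (\<bar>t\<bar> * sqrt e) + 2 * (\<bar>t\<bar> * d) + 8 / real n" by linarith
  moreover have "1 / 2 * cmod (char \<nu> t - char \<mu> t) \<le> cmod (char D t) * cmod (char \<nu> t - char \<mu> t)"
    using t by (intro mult_right_mono) auto
  ultimately have 1: "cmod (char \<nu> t - char \<mu> t) \<le> 4 * (\<bar>t\<bar> * sqrt e) + 4 * (\<bar>t\<bar> * d) + 16 / real n" by linarith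
  have 2: "cmod (char (empirical_measure (unordered n a)) t - char \<nu> t) \<le> \<bar>t\<bar> * d"
  proof -
    have m: "(\<lambda>x. iexp (t * x)) \<in> borel_measurable borel" by measurable
    have "char (empirical_measure (unordered n a)) t - char \<nu> t = (\<Sum>i=1..n. iexp (t * a i) - iexp (t * w i)) /\<^sub>R real n"
      unfolding char_def \<nu>_def integral_empirical[OF S(2) m] by (simp add: sum_subtractf scaleR_diff_right)
    also have "cmod \<dots> = cmod (\<Sum>i=1..n. iexp (t * a i) - iexp (t * w i)) / real n"
      by (simp add: divide_inverse mult.commute)
    also have "\<dots> \<le> (\<Sum>i=1..n. \<bar>t\<bar> * d) / real n"
    proof (intro divide_right_mono order_trans[OF norm_sum] sum_mono)
      fix i assume i: "i \<in> {1..n}"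
      have "cmod (iexp (t * a i) - iexp (t * w i)) \<le> \<bar>t * a i - t * w i\<bar>" by (rule iexp_diff_le)
      also have "\<dots> = \<bar>t\<bar> * \<bar>w i - a i\<bar>" by (simp only: right_diff_distrib[symmetric] abs_mult abs_minus_commute)
      also have "\<dots> \<le> \<bar>t\<bar> * d" using w[OF i] by (intro mult_left_mono) auto
      finally show "cmod (iexp (t * a i) - iexp (t * w i)) \<le> \<bar>t\<bar> * d" .
    qed simp
    also have "\<dots> = \<bar>t\<bar> * d" using S by simp
    finally show ?thesis .
  qed
  have "cmod (char (empirical_measure (unordered n a)) t - char \<mu> t) \<le>
     cmod (char (empirical_measure (unordered n a)) t - char \<nu> t) + cmod (char \<nu> t - char \<mu> t)"
    using norm_triangle_ineq[of "char (empirical_measure (unordered n a)) t - char \<nu> t" "char \<nu> t - char \<mu> t"] by simp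
  thus ?thesis using 1 2 by (simp add: algebra_simps)
qed

section \<open>The risk for a fixed sample size\<close>

lemma isotonic_design_mono:
  assumes "f \<in> isotonic_class V" "fixed_design n x"
  shows "mono_on {1..n} (\<lambda>i. f (x i))" "\<And>i. i \<in> {1..n} \<Longrightarrow> \<bar>f (x i)\<bar> \<le> V"
proof -
  have x: "x i \<in> {0..1}" if "i \<in> {1..n}" for i using assms(2) imageI[OF that, of x] unfolding fixed_design_def by blast
  show "\<bar>f (x i)\<bar> \<le> V" if "i \<in> {1..n}" for i using assms(1) x[OF that] by (simp add: isotonic_class_def)
  have "mono_on {1..n} x" using assms(2) by (simp add: fixed_design_def strict_mono_on_imp_mono_on)
  thus "mono_on {1..n} (\<lambda>i. f (x i))"
    using assms(1) x unfolding isotonic_class_def mono_on_def by blast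
qed

lemma empirical_norm_pow_diff_le:
  assumes f: "f \<in> isotonic_class V" and g: "g \<in> isotonic_class V" and x: "fixed_design n x"
    and n: "n \<ge> 1" and p: "p \<ge> 1"
  shows "empirical_norm_pow n x p (\<lambda>t. f t - g t) \<le> (2 * V) powr p"
proof -
  have "(\<Sum>i=1..n. \<bar>f (x i) - g (x i)\<bar> powr p) \<le> (\<Sum>i=1..n. (2 * V) powr p)"
  proof (intro sum_mono powr_mono2)
    fix i assume i: "i \<in> {1..n}"
    show "\<bar>f (x i) - g (x i)\<bar> \<le> 2 * V"
      using isotonic_design_mono(2)[OF f x i] isotonic_design_mono(2)[OF g x i] by linarith
  qed (use p in auto)
  hence "(1 / real n) * (\<Sum>i=1..n. \<bar>f (x i) - g (x i)\<bar> powr p) \<le> (1 / real n) * (\<Sum>i=1..n. (2 * V) powr p)"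
    by (intro mult_left_mono) auto
  thus ?thesis using n by (simp add: empirical_norm_pow_def)
qed

text \<open>The step \<open>h\<close> of the sine is chosen so that degree \<open>k\<close> reaches exactly the frequency \<open>1 / (2 S)\<close>.\<close>

lemma isotonic_loss_deconvolution_le:
  fixes V \<sigma> p c2 e :: real and n J r :: nat and D \<mu> :: "real measure" and a b :: "nat \<Rightarrow> real"
  defines "S \<equiv> V + \<sigma>" and "d \<equiv> (V + \<sigma>) / real n powr (1/4)"
    and "k \<equiv> 4 * (64 * 2 ^ J) * r + 1"
  assumes V: "V > 0" "\<sigma> \<ge> 0" and n: "n \<ge> 3" and D: "real_distribution D"
    and p: "p \<ge> 1" and r: "real r \<ge> p / 2 + 1"
    and a: "mono_on {1..n} a" "\<And>i. i \<in> {1..n} \<Longrightarrow> \<bar>a i\<bar> \<le> V"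
    and w: "\<And>i. i \<in> {1..n} \<Longrightarrow> w i \<in> grid V \<sigma> n \<inter> {-V..V} \<and> \<bar>w i - a i\<bar> \<le> d"
    and c2: "V + c2 \<le> S * ln (real n)" "measure D {u. \<bar>u\<bar> > c2} \<le> 2 / real n"
    and \<mu>: "deconvolution_argmin V \<sigma> D n Y \<mu>" "\<And>i. i \<in> {1..n} \<Longrightarrow> b i = quantile \<mu> (real i / real n)"
    and e: "e > 0" "wasserstein2_sq (distr (empirical_measure (unordered n w) \<star> D) borel (grid_proj V \<sigma> n))
      (empirical_measure Y) < ennreal e"
    and t: "\<And>t. \<bar>t\<bar> \<le> 1 / (2 * S) \<Longrightarrow> 1 / 2 \<le> cmod (char D t)"
  shows "(1 / real n) * (\<Sum>i=1..n. \<bar>a i - b i\<bar> powr p) \<le> 5 * (4 * (V / 2 ^ J)) powr p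
    + (4 * V) powr p * 2 ^ (J + 3) * (2 * 7 ^ (2 * (64 * 2 ^ J) * r) * (1 / 2 + S * real k / V) ^ k
        * ((4 * sqrt e + 5 * d) / (2 * S) + 16 / real n) + 1 / real n)"
proof -
  have S: "S > 0" "V \<le> S" "n \<ge> 1" "d \<ge> 0" using V n by (auto simp: S_def d_def)
  have k1: "real k \<ge> 1" by (simp add: k_def)
  define h where "h = 1 / (2 * S * real k)"
  have h: "h > 0" "h * V \<le> 1" "h * real k = 1 / (2 * S)"
  proof -
    have k0: "real k > 0" using k1 by linarith
    show "h > 0" unfolding h_def by (intro divide_pos_pos mult_pos_pos) (use S k0 in auto)
    show "h * real k = 1 / (2 * S)" using k0 by (simp add: h_def)
    have "S * 1 \<le> S * real k" using S k1 by (intro mult_left_mono) auto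
    hence "V \<le> 2 * S * real k" using S by linarith
    thus "h * V \<le> 1" using S k0 by (simp add: h_def field_simps)
  qed
  have eq: "1 / (2 * h * V) = S * real k / V" using S V k1 by (simp add: h_def)
  have \<mu>g: "\<mu> \<in> grid_measures V \<sigma> n"
    using \<mu>(1) by (simp add: deconvolution_argmin_def is_arg_min_def)
  have "(1 / real n) * (\<Sum>i=1..n. \<bar>a i - b i\<bar> powr p) \<le> 5 * (4 * (V / 2 ^ J)) powr p
    + (4 * V) powr p * 2 ^ (J + 3) * (2 * 7 ^ (2 * (64 * 2 ^ J) * r) * (1 / 2 + 1 / (2 * h * V)) ^ (4 * (64 * 2 ^ J) * r + 1)
        * ((4 * sqrt e + 5 * d) / (2 * S) + 16 / real n) + 1 / real n)"
  proof (rule isotonic_loss_le[OF S(3) a real_distribution_empirical[OF S(3)] _ cdf_empirical[OF S(3)]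
        grid_measures_D[OF \<mu>g] \<mu>(2) V(1) h(1,2) p r])
    show "AE x in empirical_measure (unordered n a). \<bar>x\<bar> \<le> V"
      by (rule AE_empirical[OF S(3)]) (use a in auto)
    fix t assume "\<bar>t\<bar> \<le> h * real (4 * (64 * 2 ^ J) * r + 1)"
    hence tS: "\<bar>t\<bar> \<le> 1 / (2 * S)" using h(3) by (simp only: k_def)
    have "cmod (char (empirical_measure (unordered n a)) t - char \<mu> t) \<le> \<bar>t\<bar> * (4 * sqrt e + 5 * d) + 16 / real n"
      using char_deconvolution_le[OF V n D w[unfolded d_def] c2[unfolded S_def] \<mu>(1) e t[OF tS]] by (simp only: d_def)
    also have "\<bar>t\<bar> * (4 * sqrt e + 5 * d) \<le> 1 / (2 * S) * (4 * sqrt e + 5 * d)"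
      using S e by (intro mult_right_mono tS) auto
    finally show "cmod (char (empirical_measure (unordered n a)) t - char \<mu> t) \<le> (4 * sqrt e + 5 * d) / (2 * S) + 16 / real n"
      by simp
  qed
  thus ?thesis by (simp only: eq k_def[symmetric])
qed

text \<open>On the good event the loss is bounded deterministically; elsewhere it is at most \<open>(2 V) powr p\<close>.\<close>

lemma risk_pow_le:
  fixes V \<sigma> p :: real and n J r :: nat and D :: "real measure" and x :: "nat \<Rightarrow> real" and f :: "real \<Rightarrow> real"
  defines "S \<equiv> V + \<sigma>" and "d \<equiv> (V + \<sigma>) / real n powr (1/4)" and "R \<equiv> 3 * (V + \<sigma>) * ln (real n)"
    and "e \<equiv> real n powr (-1/5)" and "k \<equiv> 4 * (64 * 2 ^ J) * r + 1"
  assumes V: "V > 0" and D: "real_distribution D" "psi1_norm D \<le> ereal \<sigma>"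
    and n: "n \<ge> 3" "2 \<le> ln (real n)" and dV: "d \<le> V"
    and small: "2 * R * (real n powr (-1/4) + 2 * d + 2 * R * real n powr (-1/2)) < e"
    and p: "p \<ge> 1" and r: "real r \<ge> p / 2 + 1"
    and x: "fixed_design n x" and G: "discretized_deconvolution_estimator V \<sigma> D n x G" and f: "f \<in> isotonic_class V"
  shows "risk_pow D n x p f G \<le> 5 * (4 * (V / 2 ^ J)) powr p
    + (4 * V) powr p * 2 ^ (J + 3) * (2 * 7 ^ (2 * (64 * 2 ^ J) * r) * (1 / 2 + S * real k / V) ^ k
        * ((4 * sqrt e + 5 * d) / (2 * S) + 16 / real n) + 1 / real n)
    + (2 * V) powr p * (real n * (2 / (real n)\<^sup>2) + 2 * R / sqrt (real n) / real n powr (-1/4)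
        + 2 / real n / real n powr (-1/2))"
proof -
  have \<sigma>: "\<sigma> \<ge> 0"
  proof (rule ccontr)
    assume "\<not> \<sigma> \<ge> 0"
    thus False using psi1_norm_exp_moment(1)[OF D, of "\<sigma> / 2"] by simp
  qed
  have S: "S > 0" "n \<ge> 1" "n \<ge> 2" "V + \<sigma> > 0" using V \<sigma> n by (auto simp: S_def)
  note gm = measurable_grid_proj[OF S(4,3)]
  have d0: "d \<ge> 0" using S by (simp add: d_def)
  have R0: "R \<ge> 0" using S n by (simp add: R_def)
  \<comment> \<open>A scale strictly above \<open>\<sigma>\<close>, but with \<open>V + s ln n \<le> (V + \<sigma>) ln n\<close>, so that the grid still covers noise up to \<open>s ln n\<close>.\<close>
  define s where "s = \<sigma> + V / 2"
  have s: "0 < s" "(\<integral>\<^sup>+ z. ennreal (exp (\<bar>z\<bar> / s)) \<partial>D) \<le> 2" "s \<le> S"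
    using psi1_norm_exp_moment[OF D, of s] V by (auto simp: s_def S_def)
  define L where "L = ln (real n)"
  have L: "L \<ge> 2" "exp (- L) = 1 / real n" using n by (auto simp: L_def exp_minus inverse_eq_divide)
  define c2 where "c2 = s * L"
  have c2: "V + c2 \<le> S * ln (real n)"
  proof -
    have "V / 2 * 2 \<le> V / 2 * L" using V L by (intro mult_left_mono) auto
    hence "V + s * L \<le> V / 2 * L + s * L" by simp
    also have "\<dots> = S * L" by (simp add: S_def s_def algebra_simps)
    finally show ?thesis by (simp add: c2_def L_def)
  qed
  interpret Dd: real_distribution D by (rule D)
  have q2: "measure D {u. \<bar>u\<bar> > c2} \<le> 2 / real n"
    using exp_moment_tail[OF D(1) s(1,2), of L] L by (simp add: c2_def)
  have q1: "measure D {u. \<bar>u\<bar> > 2 * S * L} \<le> 2 / (real n)\<^sup>2"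
  proof -
    have "s * (2 * L) \<le> S * (2 * L)" using s L by (intro mult_right_mono) auto
    hence "measure D {u. \<bar>u\<bar> > 2 * S * L} \<le> measure D {u. \<bar>u\<bar> > s * (2 * L)}"
      by (intro Dd.finite_measure_mono) (auto simp: algebra_simps)
    also have "\<dots> \<le> 2 * exp (- (2 * L))" by (rule exp_moment_tail[OF D(1) s(1,2)])
    also have "exp (- (2 * L)) = exp (- L) * exp (- L)" by (simp add: exp_add[symmetric])
    finally show ?thesis unfolding L(2) by (simp add: power2_eq_square)
  qed
  have tc: "1 / 2 \<le> cmod (char D t)" if "\<bar>t\<bar> \<le> 1 / (2 * S)" for t
  proof (rule exp_moment_char[OF D(1) s(1,2)])
    have "\<bar>t\<bar> * s \<le> 1 / (2 * S) * S" using that s by (intro mult_mono) auto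
    thus "\<bar>t\<bar> * s \<le> 1 / 2" using S by simp
  qed
  define a where "a = (\<lambda>i. f (x i))"
  have a: "mono_on {1..n} a" "\<And>i. i \<in> {1..n} \<Longrightarrow> \<bar>a i\<bar> \<le> V"
    unfolding a_def by (rule isotonic_design_mono[OF f x], assumption?)+
  have "\<forall>i\<in>{1..n}. \<exists>w. w \<in> grid V \<sigma> n \<inter> {-V..V} \<and> \<bar>w - a i\<bar> \<le> d"
    using grid_rounding_exists[OF V \<sigma> n(1) dV[unfolded d_def] a(2)] unfolding d_def by blast
  then obtain w where w: "\<And>i. i \<in> {1..n} \<Longrightarrow> w i \<in> grid V \<sigma> n \<inter> {-V..V} \<and> \<bar>w i - a i\<bar> \<le> d"
    by metis
  define h where "h = (\<lambda>i u. grid_proj V \<sigma> n (w i + u))"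
  define F where "F = (\<lambda>z. (\<Sum>i=1..n. measure D {u. h i u \<le> z}) / real n)"
  have hm: "h i \<in> borel_measurable borel" for i
    unfolding h_def by (rule measurable_compose[OF _ gm]) measurable
  have hs: "{u. h i u \<le> z} \<in> sets borel" for i z
    using hm[of i] by measurable
  have Fm: "F \<in> borel_measurable borel"
    unfolding F_def by (intro borel_measurable_mono monoI divide_right_mono sum_mono Dd.finite_measure_mono)
      (use hs in auto)
  define P where "P = (\<Pi>\<^sub>M j\<in>{1..n}. D)"
  interpret P: prob_space P unfolding P_def by (rule prob_space_noise[OF D(1)])
  define \<eta>1 where "\<eta>1 = real n powr (-1/4)"
  define \<eta>2 where "\<eta>2 = real n powr (-1/2)"
  have \<eta>: "\<eta>1 > 0" "\<eta>2 > 0" using S by (auto simp: \<eta>1_def \<eta>2_def)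
  obtain Bad where Bad: "Bad \<in> sets P"
    "measure P Bad \<le> real n * (2 / (real n)\<^sup>2) + 2 * R / sqrt (real n) / \<eta>1 + 2 / real n / \<eta>2"
    "\<And>\<xi>. \<xi> \<in> space P - Bad \<Longrightarrow> (\<forall>i\<in>{1..n}. \<bar>\<xi> i\<bar> \<le> 2 * S * L) \<and>
      cdf_distance R (empirical_cdf n (\<lambda>i. h i (\<xi> i))) F < ennreal \<eta>1 \<and>
      real (card {i\<in>{1..n}. \<bar>\<xi> i\<bar> > c2}) / real n < \<eta>2"
  proof (rule good_noise_event[OF D(1) S(2) hm R0 Fm _ q1 q2 \<eta>, folded P_def])
    show "F z = (\<Sum>i=1..n. measure D {u. h i u \<le> z}) / real n" for z by (simp only: F_def)
  qed (rule that)
  define B where "B = 5 * (4 * (V / 2 ^ J)) powr p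
    + (4 * V) powr p * 2 ^ (J + 3) * (2 * 7 ^ (2 * (64 * 2 ^ J) * r) * (1 / 2 + S * real k / V) ^ k
        * ((4 * sqrt e + 5 * d) / (2 * S) + 16 / real n) + 1 / real n)"
  have e0: "e > 0" using S by (simp add: e_def)
  have B0: "B \<ge> 0" using V S d0 e0 by (simp add: B_def)
  define loss where "loss = (\<lambda>\<xi>. empirical_norm_pow n x p (\<lambda>t. f t - G (unordered n (\<lambda>i. f (x i) + \<xi> i)) t))"
  have loss_eq: "loss \<xi> = (1 / real n) * (\<Sum>i=1..n. \<bar>a i - G (unordered n (\<lambda>i. a i + \<xi> i)) (x i)\<bar> powr p)" for \<xi>
    by (simp add: loss_def empirical_norm_pow_def a_def)
  have size: "size (unordered n y) = n" for y by (simp add: unordered_def)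
  have bad: "loss \<xi> \<le> (2 * V) powr p" for \<xi>
  proof -
    have "G (unordered n (\<lambda>i. f (x i) + \<xi> i)) \<in> isotonic_class V"
      using G size unfolding discretized_deconvolution_estimator_def by blast
    thus ?thesis unfolding loss_def by (rule empirical_norm_pow_diff_le[OF f _ x S(2) p])
  qed
  have good: "loss \<xi> \<le> B" if \<xi>: "\<xi> \<in> space P - Bad" for \<xi>
  proof -
    define Y where "Y = unordered n (\<lambda>i. a i + \<xi> i)"
    obtain \<mu> where \<mu>: "deconvolution_argmin V \<sigma> D n Y \<mu>" "\<forall>i\<in>{1..n}. G Y (x i) = quantile \<mu> (real i / real n)"
      using G size unfolding discretized_deconvolution_estimator_def Y_def by blast
    note g = Bad(3)[OF \<xi>]
    have "wasserstein2_sq (distr (empirical_measure (unordered n w) \<star> D) borel (grid_proj V \<sigma> n)) (empirical_measure Y)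
      \<le> ennreal (2 * R * (\<eta>1 + 2 * d + 2 * R * \<eta>2))"
      unfolding Y_def d_def R_def
    proof (rule wasserstein_rounded_design_le[OF V \<sigma> n dV[unfolded d_def] D(1) a(2)])
      show "\<bar>w i\<bar> \<le> V \<and> \<bar>w i - a i\<bar> \<le> (V + \<sigma>) / real n powr (1/4)" if "i \<in> {1..n}" for i
        using w[OF that] by (auto simp: d_def)
      show "V + c2 \<le> (V + \<sigma>) * ln (real n)" using c2 by (simp add: S_def)
      show "\<bar>\<xi> i\<bar> \<le> 2 * (V + \<sigma>) * ln (real n)" if "i \<in> {1..n}" for i
        using g that by (auto simp: S_def L_def)
      show "cdf_distance (3 * (V + \<sigma>) * ln (real n)) (empirical_cdf n (\<lambda>i. grid_proj V \<sigma> n (w i + \<xi> i)))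
          (\<lambda>z. (\<Sum>i=1..n. measure D {u. grid_proj V \<sigma> n (w i + u) \<le> z}) / real n) \<le> ennreal \<eta>1"
        using g unfolding h_def F_def R_def by (intro less_imp_le) blast
      show "real (card {i\<in>{1..n}. \<bar>\<xi> i\<bar> > c2}) / real n \<le> \<eta>2" using g by (intro less_imp_le) blast
    qed (use \<eta> in auto)
    also have "\<dots> < ennreal e"
      using small e0 by (intro ennreal_lessI) (auto simp: \<eta>1_def \<eta>2_def)
    finally have W: "wasserstein2_sq (distr (empirical_measure (unordered n w) \<star> D) borel (grid_proj V \<sigma> n)) (empirical_measure Y) < ennreal e" .
    show ?thesis
      unfolding loss_eq B_def k_def S_def d_def Y_def[symmetric]
      by (rule isotonic_loss_deconvolution_le[OF V \<sigma> n(1) D(1) p r a w[unfolded d_def] c2[unfolded S_def] q2 \<mu>(1) _ e0 W tc])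
         (use \<mu>(2) in \<open>auto simp: S_def\<close>)
  qed
  have "risk_pow D n x p f G = (\<integral>\<xi>. loss \<xi> \<partial>P)" by (simp add: risk_pow_def loss_def P_def)
  also have "\<dots> \<le> (\<integral>\<xi>. B + (2 * V) powr p * indicator Bad \<xi> \<partial>P)"
  proof (rule integral_mono')
    show "integrable P (\<lambda>\<xi>. B + (2 * V) powr p * indicator Bad \<xi>)"
      using Bad(1) by (auto simp: integrable_indicator_iff less_top[symmetric])
    show "loss \<xi> \<le> B + (2 * V) powr p * indicator Bad \<xi>" if "\<xi> \<in> space P" for \<xi>
      using good[of \<xi>] bad[of \<xi>] that B0 by (cases "\<xi> \<in> Bad") auto
  qed (use B0 in auto)
  also have "\<dots> = B + (2 * V) powr p * measure P Bad"
    using Bad(1) by (simp add: P.prob_space integrable_indicator_iff less_top[symmetric])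
  also have "\<dots> \<le> B + (2 * V) powr p * (real n * (2 / (real n)\<^sup>2) + 2 * R / sqrt (real n) / \<eta>1 + 2 / real n / \<eta>2)"
    using Bad(2) by (intro add_left_mono mult_left_mono) auto
  finally show ?thesis unfolding B_def \<eta>1_def \<eta>2_def .
qed

section \<open>The rate\<close>

lemma risk_pow_trivial:
  assumes V: "V > 0" and D: "real_distribution D" and n: "n \<ge> 1" and p: "p \<ge> 1"
    and x: "fixed_design n x" and G: "discretized_deconvolution_estimator V \<sigma> D n x G" and f: "f \<in> isotonic_class V"
  shows "0 \<le> risk_pow D n x p f G" "risk_pow D n x p f G \<le> (2 * V) powr p"
proof -
  interpret P: prob_space "\<Pi>\<^sub>M j\<in>{1..n}. D" by (rule prob_space_noise[OF D])
  show "0 \<le> risk_pow D n x p f G"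
    unfolding risk_pow_def empirical_norm_pow_def by (intro integral_nonneg_AE AE_I2 mult_nonneg_nonneg sum_nonneg) auto
  have "risk_pow D n x p f G \<le> (\<integral>\<xi>. (2 * V) powr p \<partial>(\<Pi>\<^sub>M j\<in>{1..n}. D))"
    unfolding risk_pow_def
  proof (rule integral_mono')
    fix \<xi> :: "nat \<Rightarrow> real"
    have "size (unordered n (\<lambda>i. f (x i) + \<xi> i)) = n" by (simp add: unordered_def)
    hence "G (unordered n (\<lambda>i. f (x i) + \<xi> i)) \<in> isotonic_class V"
      using G unfolding discretized_deconvolution_estimator_def by blast
    thus "empirical_norm_pow n x p (\<lambda>t. f t - G (unordered n (\<lambda>i. f (x i) + \<xi> i)) t) \<le> (2 * V) powr p"
      by (rule empirical_norm_pow_diff_le[OF f _ x n p])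
  next
    show "integrable (\<Pi>\<^sub>M j\<in>{1..n}. D) (\<lambda>\<xi>. (2 * V) powr p)" by (rule P.integrable_const)
  qed auto
  thus "risk_pow D n x p f G \<le> (2 * V) powr p" by (simp add: P.prob_space del: One_nat_def)
qed

lemma dyadic_below:
  assumes "1 \<le> (L::real)"
  obtains J :: nat where "2 ^ J \<le> L" "L < 2 * 2 ^ J"
proof -
  define k where "k = nat \<lfloor>L\<rfloor>"
  have "k \<ge> 1" using assms by (simp add: k_def le_nat_floor)
  then obtain J where J: "2 ^ J \<le> k" "k < 2 ^ (J + 1)" using ex_power_ivl1[of 2 k] by auto
  have "real (2 ^ J) \<le> real k" "real (k + 1) \<le> real (2 ^ (J + 1))" using J by (simp_all only: of_nat_le_iff)
  moreover have "real k \<le> L" "L < real k + 1" using assms unfolding k_def by linarith+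
  ultimately have "2 ^ J \<le> L" "L < 2 * 2 ^ J"
    by (simp_all only: of_nat_power of_nat_numeral of_nat_add of_nat_mult of_nat_1 power_add power_one_right)
  thus thesis by (rule that)
qed

text \<open>With \<open>l = ln n\<close> this says that \<open>(constant * k) ^ k\<close> is at most \<open>n powr (1/50)\<close> when \<open>k\<close> is a small multiple of
  \<open>ln n / ln (ln n)\<close>; it is the source of the iterated logarithm in the rate.\<close>

lemma power_le_root_of_sample_size:
  fixes l H :: real and k :: nat
  assumes l: "ln l \<ge> 1" "l > 0" and H: "H \<ge> 1" "ln (7 * H) \<le> ln l" and k: "k \<ge> 1" "real k \<le> l / (100 * ln l)"
  shows "(7 * H * real k) ^ k \<le> exp (l / 50)"
proof -
  have ll: "0 < 100 * ln l" using l by linarith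
  have "l / (100 * ln l) \<le> l / 1" using l ll by (intro divide_left_mono) linarith+
  hence "real k \<le> l" using k by simp
  hence "ln (real k) \<le> ln l" using k l by simp
  moreover have "ln (7 * H * real k) = ln (7 * H) + ln (real k)"
    using H k by (subst ln_mult) auto
  ultimately have "ln (7 * H * real k) \<le> 2 * ln l" using H by linarith
  hence "real k * ln (7 * H * real k) \<le> real k * (2 * ln l)" by (intro mult_left_mono) auto
  also have "\<dots> \<le> l / (100 * ln l) * (2 * ln l)" using l by (intro mult_right_mono k(2)) linarith
  also have "\<dots> = l / 50" using l ll by simp
  finally have "real k * ln (7 * H * real k) \<le> l / 50" .
  moreover have "(7 * H * real k) ^ k = exp (real k * ln (7 * H * real k))"
    using H k by (simp add: exp_of_nat_mult)
  ultimately show ?thesis by simp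
qed

text \<open>The sample sizes from which on the bound of \<open>risk_pow_le\<close> takes its asymptotic form.  The last two
  conditions say that everything except the main term is negligible against \<open>(V / ln n) powr p\<close>.\<close>

lemma eventually_large_sample:
  fixes V S p :: real and r :: nat
  assumes V: "V > 0" and S: "S > 0" and r: "r > 0"
  shows "eventually (\<lambda>n::nat. 3 \<le> n \<and> 2 \<le> ln (real n) \<and> 1 \<le> ln (ln (real n)) \<and> ln (7 * (1 + S / V)) \<le> ln (ln (real n)) \<and>
    S / real n powr (1/4) \<le> V \<and>
    2 * (3 * S * ln (real n)) * (real n powr (-1/4) + 2 * (S / real n powr (1/4)) + 2 * (3 * S * ln (real n)) * real n powr (-1/2))
      < real n powr (-1/5) \<and>
    1 \<le> ln (real n) / (25700 * real r * ln (ln (real n))) \<and>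
    8 * ln (real n) * (2 * real n powr (1/50) * ((4 * sqrt (real n powr (-1/5)) + 5 * (S / real n powr (1/4))) / (2 * S) + 16 / real n) + 1 / real n)
     + (real n * (2 / (real n)\<^sup>2) + 2 * (3 * S * ln (real n)) / sqrt (real n) / real n powr (-1/4) + 2 / real n / real n powr (-1/2))
      \<le> real n powr (-1/20) \<and>
    4 powr p * (ln (real n) powr p * real n powr (-1/20)) \<le> 1) sequentially"
proof (intro eventually_conj)
  show "eventually (\<lambda>n::nat. 3 \<le> n) sequentially" by (rule eventually_ge_at_top)
  show "eventually (\<lambda>n::nat. 2 \<le> ln (real n)) sequentially" by real_asymp
  show "eventually (\<lambda>n::nat. 1 \<le> ln (ln (real n))) sequentially" by real_asymp
  show "eventually (\<lambda>n::nat. ln (7 * (1 + S / V)) \<le> ln (ln (real n))) sequentially"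
  proof -
    have "filterlim (\<lambda>n::nat. ln (ln (real n))) at_top sequentially" by real_asymp
    thus ?thesis by (simp add: filterlim_at_top)
  qed
  show "eventually (\<lambda>n::nat. S / real n powr (1/4) \<le> V) sequentially" using V S by real_asymp
  show "eventually (\<lambda>n::nat. 2 * (3 * S * ln (real n)) * (real n powr (-1/4) + 2 * (S / real n powr (1/4)) + 2 * (3 * S * ln (real n)) * real n powr (-1/2))
      < real n powr (-1/5)) sequentially" using S by real_asymp
  have "real r > 0" using r by simp
  thus "eventually (\<lambda>n::nat. 1 \<le> ln (real n) / (25700 * real r * ln (ln (real n)))) sequentially" by real_asymp
  show "eventually (\<lambda>n::nat. 8 * ln (real n) * (2 * real n powr (1/50) * ((4 * sqrt (real n powr (-1/5)) + 5 * (S / real n powr (1/4))) / (2 * S) + 16 / real n) + 1 / real n)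
     + (real n * (2 / (real n)\<^sup>2) + 2 * (3 * S * ln (real n)) / sqrt (real n) / real n powr (-1/4) + 2 / real n / real n powr (-1/2))
      \<le> real n powr (-1/20)) sequentially" using S by real_asymp
  have "((\<lambda>n::nat. ln (real n) powr p * real n powr (-1/20)) \<longlongrightarrow> 0) sequentially" by real_asymp
  hence "eventually (\<lambda>n::nat. ln (real n) powr p * real n powr (-1/20) < 1 / 4 powr p) sequentially"
    by (rule order_tendstoD) simp
  thus "eventually (\<lambda>n::nat. 4 powr p * (ln (real n) powr p * real n powr (-1/20)) \<le> 1) sequentially"
    by eventually_elim (simp add: field_simps)
qed

text \<open>Take \<open>r\<close> between \<open>p / 2 + 1\<close> and \<open>3 p\<close>, and let \<open>2 ^ J\<close> be within a factor two of
  \<open>ln n / (25700 r ln (ln n))\<close>, so that the degree \<open>k \<le> 257 r 2 ^ J\<close> is at most \<open>ln n / (100 ln (ln n))\<close>.  The constants are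
  \<open>616800 = 4 * 2 * 3 * 25700\<close> for \<open>4 V / 2 ^ J\<close>, and six times that for the sum of the main term, with factor five, and
  the remainder.\<close>

lemma risk_rate:
  fixes V \<sigma> p :: real
  assumes V: "V > 0" and \<sigma>: "\<sigma> \<ge> 0" and p: "p \<ge> 1"
  shows "eventually (\<lambda>n::nat. \<forall>D x G f. real_distribution D \<and> psi1_norm D \<le> ereal \<sigma> \<and> fixed_design n x \<and>
      discretized_deconvolution_estimator V \<sigma> D n x G \<and> f \<in> isotonic_class V \<longrightarrow>
      (risk_pow D n x p f G) powr (1 / p) \<le> 3700800 * p * V * (ln (ln (real n)) / ln (real n))) sequentially"
proof -
  define S where "S = V + \<sigma>"
  define r where "r = nat \<lceil>p\<rceil> + 1"
  have S: "S > 0" using V \<sigma> by (simp add: S_def)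
  have r: "r > 0" "real r \<ge> p / 2 + 1" "real r \<le> 3 * p" using p unfolding r_def by linarith+
  show ?thesis
    using eventually_large_sample[OF V S r(1), of p]
  proof eventually_elim
    case (elim n)
    define l where "l = ln (real n)"
    define q where "q = ln l / l"
    have l: "l \<ge> 2" "ln l \<ge> 1" using elim by (auto simp: l_def)
    have n: "n \<ge> 3" "n \<ge> 1" using elim by auto
    have q: "q \<ge> 1 / l" "q > 0" using l by (auto simp: q_def divide_right_mono)
    define L where "L = l / (25700 * real r * ln l)"
    have "L \<ge> 1" using elim by (simp add: L_def l_def)
    then obtain J :: nat where J: "2 ^ J \<le> L" "L < 2 * 2 ^ J" by (rule dyadic_below)
    define k where "k = 4 * (64 * 2 ^ J) * r + 1"
    have k1: "k \<ge> 1" by (simp add: k_def)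
    have r1: "real r \<ge> 1" using r(1) by simp
    have k2: "real k \<le> l / (100 * ln l)"
    proof -
      have "1 * 1 \<le> 2 ^ J * real r" using r1 by (intro mult_mono) auto
      hence "real k \<le> 257 * real r * 2 ^ J" by (simp add: k_def mult.commute)
      also have "\<dots> \<le> 257 * real r * L" using J by (intro mult_left_mono) auto
      also have "\<dots> = l / (100 * ln l)" using r1 l by (simp add: L_def field_simps)
      finally show ?thesis .
    qed
    have Jl: "2 ^ J \<le> l"
    proof -
      have "1 * 1 \<le> 25700 * real r * ln l" using r1 l by (intro mult_mono) auto
      hence "l / (25700 * real r * ln l) \<le> l / 1" using l by (intro divide_left_mono) auto
      thus ?thesis using J by (simp add: L_def)
    qed
    have \<delta>: "4 * (V / 2 ^ J) \<le> 616800 * p * V * q"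
    proof -
      have "V / 2 ^ J \<le> 2 * V / L"
      proof -
        have "V * L \<le> V * (2 * 2 ^ J)" using J V by (intro mult_left_mono) auto
        thus ?thesis using \<open>L \<ge> 1\<close> by (simp add: field_simps)
      qed
      also have "\<dots> = 51400 * real r * V * q" using r1 l by (simp add: L_def q_def field_simps)
      also have "\<dots> \<le> 51400 * (3 * p) * V * q" using r V q by (intro mult_right_mono mult_left_mono) auto
      finally show ?thesis by simp
    qed
    have nl: "real n = exp l" using n by (simp add: l_def)
    have pow: "7 ^ (2 * (64 * 2 ^ J) * r) * (1 / 2 + S * real k / V) ^ k \<le> real n powr (1/50)"
    proof -
      have H: "1 + S / V \<ge> 1" using S V by simp
      have "(7::real) ^ (2 * (64 * 2 ^ J) * r) \<le> 7 ^ k" by (intro power_increasing) (auto simp: k_def)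
      moreover have "(1 / 2 + S * real k / V) ^ k \<le> ((1 + S / V) * real k) ^ k"
        using k1 S V by (intro power_mono) (auto simp: algebra_simps)
      ultimately have "7 ^ (2 * (64 * 2 ^ J) * r) * (1 / 2 + S * real k / V) ^ k \<le> 7 ^ k * ((1 + S / V) * real k) ^ k"
        using S V by (intro mult_mono) auto
      also have "\<dots> = (7 * (1 + S / V) * real k) ^ k" by (simp only: power_mult_distrib mult.assoc)
      also have "\<dots> \<le> exp (l / 50)"
        using l H k1 k2 elim by (intro power_le_root_of_sample_size) (auto simp: l_def)
      also have "\<dots> = real n powr (1/50)" unfolding nl by (simp add: powr_def)
      finally show ?thesis .
    qed
    show ?case
    proof (intro allI impI, elim conjE)
      fix D x G f
      assume D: "real_distribution D" "psi1_norm D \<le> ereal \<sigma>" and x: "fixed_design n x"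
        and G: "discretized_deconvolution_estimator V \<sigma> D n x G" and f: "f \<in> isotonic_class V"
      define \<epsilon> where "\<epsilon> = (4 * sqrt (real n powr (-1/5)) + 5 * (S / real n powr (1/4))) / (2 * S) + 16 / real n"
      define B where "B = real n * (2 / (real n)\<^sup>2) + 2 * (3 * S * l) / sqrt (real n) / real n powr (-1/4) + 2 / real n / real n powr (-1/2)"
      have \<epsilon>0: "\<epsilon> \<ge> 0" using S by (simp add: \<epsilon>_def)
      have B0: "B \<ge> 0" using S l by (simp add: B_def)
      have "risk_pow D n x p f G \<le> 5 * (4 * (V / 2 ^ J)) powr p
        + (4 * V) powr p * 2 ^ (J + 3) * (2 * 7 ^ (2 * (64 * 2 ^ J) * r) * (1 / 2 + S * real k / V) ^ k * \<epsilon> + 1 / real n)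
        + (2 * V) powr p * B"
        unfolding k_def \<epsilon>_def S_def B_def l_def
        by (rule risk_pow_le[OF V D n(1) _ _ _ p r(2) x G f]) (use elim in \<open>auto simp: S_def\<close>)
      also have "\<dots> \<le> 5 * (616800 * p * V * q) powr p + (4 * V) powr p * (8 * l * (2 * real n powr (1/50) * \<epsilon> + 1 / real n))
        + (4 * V) powr p * B"
      proof (intro add_mono mult_left_mono mult_right_mono powr_mono2 \<delta>)
        have "2 ^ (J + 3) * (2 * 7 ^ (2 * (64 * 2 ^ J) * r) * (1 / 2 + S * real k / V) ^ k * \<epsilon> + 1 / real n)
          \<le> (8 * l) * (2 * real n powr (1/50) * \<epsilon> + 1 / real n)"
        proof (rule mult_mono)
          have "2 * 7 ^ (2 * (64 * 2 ^ J) * r) * (1 / 2 + S * real k / V) ^ k * \<epsilon> \<le> 2 * real n powr (1/50) * \<epsilon>"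
            using pow \<epsilon>0 by (intro mult_right_mono) auto
          thus "2 * 7 ^ (2 * (64 * 2 ^ J) * r) * (1 / 2 + S * real k / V) ^ k * \<epsilon> + 1 / real n
            \<le> 2 * real n powr (1/50) * \<epsilon> + 1 / real n" by simp
          show "2 ^ (J + 3) \<le> 8 * l" using Jl by (simp add: power_add)
        qed (use l \<epsilon>0 S V in auto)
        thus "(4 * V) powr p * 2 ^ (J + 3) * (2 * 7 ^ (2 * (64 * 2 ^ J) * r) * (1 / 2 + S * real k / V) ^ k * \<epsilon> + 1 / real n)
          \<le> (4 * V) powr p * (8 * l * (2 * real n powr (1/50) * \<epsilon> + 1 / real n))"
          unfolding mult.assoc by (intro mult_left_mono) (auto simp: mult.assoc)
      qed (use V p B0 in auto)
      also have "\<dots> = 5 * (616800 * p * V * q) powr p + (4 * V) powr p * (8 * l * (2 * real n powr (1/50) * \<epsilon> + 1 / real n) + B)"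
        by (simp add: algebra_simps)
      also have "\<dots> \<le> 5 * (616800 * p * V * q) powr p + (4 * V) powr p * real n powr (-1/20)"
        using elim unfolding \<epsilon>_def B_def l_def by (intro add_left_mono mult_left_mono) auto
      also have "(4 * V) powr p * real n powr (-1/20) \<le> (616800 * p * V * q) powr p"
      proof -
        have "(4 * V) powr p * real n powr (-1/20) = V powr p * (1 / l) powr p * (4 powr p * (l powr p * real n powr (-1/20)))"
          using l V by (simp add: powr_mult powr_divide)
        also have "\<dots> \<le> V powr p * (1 / l) powr p * 1"
          using elim unfolding l_def by (intro mult_left_mono) auto
        also have "\<dots> = (V * (1 / l)) powr p" by (simp only: powr_mult mult_1_right)
        also have "\<dots> \<le> (616800 * p * V * q) powr p"
        proof (rule powr_mono2)
          have "V * (1 / l) \<le> V * q" using q V by (intro mult_left_mono) auto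
          also have "\<dots> \<le> (616800 * p) * (V * q)" using mult_right_mono[of 1 "616800 * p" "V * q"] p q V by simp
          finally show "V * (1 / l) \<le> 616800 * p * V * q" by (simp add: mult.assoc)
        qed (use p V l in auto)
        finally show ?thesis .
      qed
      finally have "risk_pow D n x p f G \<le> 6 * (616800 * p * V * q) powr p" by simp
      hence "(risk_pow D n x p f G) powr (1 / p) \<le> (6 * (616800 * p * V * q) powr p) powr (1 / p)"
        using risk_pow_trivial(1)[OF V D(1) n(2) p x G f] p by (intro powr_mono2) auto
      also have "\<dots> = 6 powr (1 / p) * (616800 * p * V * q)"
        using p V q by (simp add: powr_mult powr_powr)
      also have "\<dots> \<le> 6 powr 1 * (616800 * p * V * q)"
        using p V q by (intro mult_right_mono powr_mono) auto
      finally show "(risk_pow D n x p f G) powr (1 / p) \<le> 3700800 * p * V * (ln (ln (real n)) / ln (real n))"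
        by (simp add: q_def l_def)
    qed
  qed
qed

theorem proposition2:
  shows "\<exists>C::real. C > 0 \<and>
    (\<forall>(V::real) (\<sigma>::real) (p::real). V > 0 \<and> 1 \<le> p \<longrightarrow>
      (\<exists>r::nat \<Rightarrow> real. r \<longlonglongrightarrow> 0 \<and>
        (\<forall>(n::nat) (D::real measure) (x::nat \<Rightarrow> real) (G::real multiset \<Rightarrow> real \<Rightarrow> real).
          3 \<le> n \<and> real_distribution D \<and> centered D \<and> psi1_norm D \<le> ereal \<sigma> \<and>
          fixed_design n x \<and> discretized_deconvolution_estimator V \<sigma> D n x G \<longrightarrow>
          (SUP f\<in>isotonic_class V. (risk_pow D n x p f G) powr (1 / p))
            \<le> C * p * V * (ln (ln (real n)) / ln (real n)) * (1 + r n))))"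
proof (intro exI[of _ 3700800] conjI allI impI, simp, elim conjE)
  fix V \<sigma> p :: real
  assume V: "V > 0" and p: "1 \<le> p"
  define q where "q = (\<lambda>n::nat. ln (ln (real n)) / ln (real n))"
  obtain n0 where n0: "\<And>n D x G f. n \<ge> n0 \<Longrightarrow> real_distribution D \<Longrightarrow> psi1_norm D \<le> ereal \<bar>\<sigma>\<bar> \<Longrightarrow> fixed_design n x \<Longrightarrow>
      discretized_deconvolution_estimator V \<bar>\<sigma>\<bar> D n x G \<Longrightarrow> f \<in> isotonic_class V \<Longrightarrow>
      (risk_pow D n x p f G) powr (1 / p) \<le> 3700800 * p * V * q n"
    using risk_rate[OF V abs_ge_zero[of \<sigma>] p] unfolding eventually_sequentially q_def by meson
  \<comment> \<open>For \<open>n < n0\<close> the right-hand side becomes at least \<open>2 V\<close>; the rate is positive because \<open>ln (ln n) > 0\<close> for \<open>n \<ge> 3\<close>.\<close>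
  define r where "r = (\<lambda>n. if n < n0 then 2 * V / (3700800 * p * V * q n) else 0)"
  have "r \<longlonglongrightarrow> 0"
    by (rule tendsto_eventually) (auto simp: r_def eventually_sequentially intro!: exI[of _ n0])
  moreover have "(SUP f\<in>isotonic_class V. (risk_pow D n x p f G) powr (1 / p)) \<le> 3700800 * p * V * q n * (1 + r n)"
    if n: "3 \<le> n" and D: "real_distribution D" and psi: "psi1_norm D \<le> ereal \<sigma>" and x: "fixed_design n x"
      and G: "discretized_deconvolution_estimator V \<sigma> D n x G" for n D x G
  proof (rule cSUP_least)
    have "(\<lambda>_. 0) \<in> isotonic_class V" using V by (simp add: isotonic_class_def mono_on_def)
    thus "isotonic_class V \<noteq> {}" by blast
    fix f assume f: "f \<in> isotonic_class V"
    have "\<sigma> \<ge> 0"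
    proof (rule ccontr)
      assume "\<not> \<sigma> \<ge> 0"
      thus False using psi1_norm_exp_moment(1)[OF D psi, of "\<sigma> / 2"] by simp
    qed
    hence \<sigma>: "\<bar>\<sigma>\<bar> = \<sigma>" by simp
    show "(risk_pow D n x p f G) powr (1 / p) \<le> 3700800 * p * V * q n * (1 + r n)"
    proof (cases "n < n0")
      case False
      thus ?thesis using n0[of n D x G f, unfolded \<sigma>] D psi x G f by (simp add: r_def)
    next
      case True
      have "exp (1::real) < 3" by (rule e_less_272[THEN less_trans]) simp
      hence "1 < ln (real n)" using n ln_less_cancel_iff[of "exp 1" "real n"] by simp
      hence q0: "q n > 0" by (simp add: q_def)
      have "(risk_pow D n x p f G) powr (1 / p) \<le> ((2 * V) powr p) powr (1 / p)"
        using risk_pow_trivial[OF V D _ p x G f] n p by (intro powr_mono2) auto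
      also have "\<dots> = 2 * V" using p V by (simp add: powr_powr)
      also have "\<dots> = 3700800 * p * V * q n * r n" using True p V q0 by (simp add: r_def)
      also have "\<dots> \<le> 3700800 * p * V * q n * (1 + r n)"
        using p V q0 by (intro mult_left_mono) auto
      finally show ?thesis .
    qed
  qed
  ultimately show "\<exists>r::nat \<Rightarrow> real. r \<longlonglongrightarrow> 0 \<and>
        (\<forall>(n::nat) (D::real measure) (x::nat \<Rightarrow> real) (G::real multiset \<Rightarrow> real \<Rightarrow> real).
          3 \<le> n \<and> real_distribution D \<and> centered D \<and> psi1_norm D \<le> ereal \<sigma> \<and>
          fixed_design n x \<and> discretized_deconvolution_estimator V \<sigma> D n x G \<longrightarrow>
          (SUP f\<in>isotonic_class V. (risk_pow D n x p f G) powr (1 / p))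
            \<le> 3700800 * p * V * (ln (ln (real n)) / ln (real n)) * (1 + r n))"
    unfolding q_def by blast
qed

end
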